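(* Let $Q_n(x)$, $L_1$, $L_2$, $Li_3$ and $x^*$ be as in the context. (a) Let $X\subset(x^*,0)$ be compact. Then, as $n\to\infty$, uniformly for $x\in X$, \[ Q_n(x)=2^{7/6}\sqrt[12]{1-x}\,\frac{1}{\sqrt{6\pi n^{4/3}}}\,|Li_3(x)|^{1/6}\exp\!\left(\tfrac34\sqrt[3]{2}\,n^{2/3}|Li_3(x)|^{1/3}\right)\left(\cos\!\left(\tfrac{3\sqrt3}{4}\sqrt[3]{2}\,n^{2/3}|Li_3(x)|^{1/3}+\tfrac{\pi}{6}\right)+O_X(n^{-1/3})\right). \] (b) Let $X$ be a compact subset of $\{x:0<|x|<1,\ \Re L_1(x)=\Re L_2(x),\ x\ne x^*\}$. Then, as $n\to\infty$, uniformly for $x\in X$, \begin{align*} Q_n(x)&=\sqrt[12]{1-x}\,\sqrt{\frac{L_1(x)}{6\pi n^{4/3}}}\exp\!\left(\tfrac32n^{2/3}L_1(x)\right)\left(1+O_X(n^{-1/3})\right)\\ &\quad+(-1)^n\sqrt[24]{1-x^2}\,\sqrt[8]{\frac{1-x}{1+x}}\,\sqrt{\frac{L_2(x)}{6\pi n^{4/3}}}\exp\!\left(\tfrac32n^{2/3}L_2(x)\right)\left(1+O_X(n^{-1/3})\right). \end{align*}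
   Context: A plane partition of a positive integer $n$ is an array $(\pi_{i,j})$ of nonnegative integers with $\sum\pi_{i,j}=n$; its trace is $\sum_i\pi_{i,i}$. Let $pp_k(n)$ be the number of plane partitions of $n$ with trace $k$, and let $Q_n(x)=\sum_{k=1}^n pp_k(n)x^k$. Equivalently, $\prod_{m\ge1}(1-xu^m)^{-m}=1+\sum_{n\ge1}Q_n(x)u^n$. Let $Li_3(x)=\sum_{n\ge1}x^n/n^3$. For $k\ge1$ and $|x|<1$, set $L_k(x)=\frac1k\sqrt[3]{2\,Li_3(x^k)}$, with the principal branch of the cube root. All other roots are principal branches. It is known that the set $\{x:0<|x|<1,\ \Re L_1(x)=\Re L_2(x)\}$ contains exactly one real point $x^*\approx-0.8250030529$. The notation $O_X$ means the implied constant depends only on $X$. *)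

theory Defs
  imports "HOL-Complex_Analysis.Complex_Analysis"
begin

text \<open>The array is indexed from 0 and has finite support; as usual for plane partitions, rows and
  columns are weakly decreasing.\<close>

definition plane_partition :: "(nat \<Rightarrow> nat \<Rightarrow> nat) \<Rightarrow> nat \<Rightarrow> bool" where
  "plane_partition \<pi> n \<longleftrightarrow>
     (\<forall>i j. \<pi> (Suc i) j \<le> \<pi> i j) \<and> (\<forall>i j. \<pi> i (Suc j) \<le> \<pi> i j) \<and>
     finite {(i, j). \<pi> i j \<noteq> 0} \<and> (\<Sum>(i, j)\<in>{(i, j). \<pi> i j \<noteq> 0}. \<pi> i j) = n"

definition pp_trace :: "(nat \<Rightarrow> nat \<Rightarrow> nat) \<Rightarrow> nat" where
  "pp_trace \<pi> = (\<Sum>i\<in>{i. \<pi> i i \<noteq> 0}. \<pi> i i)"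

definition pp :: "nat \<Rightarrow> nat \<Rightarrow> nat" where
  "pp k n = card {\<pi>. plane_partition \<pi> n \<and> pp_trace \<pi> = k}"

definition pp_poly :: "nat \<Rightarrow> 'a::comm_semiring_1 \<Rightarrow> 'a" where
  "pp_poly n x = (\<Sum>k=1..n. of_nat (pp k n) * x ^ k)"

definition Li3 :: "'a::{real_normed_field, banach} \<Rightarrow> 'a" where
  "Li3 x = (\<Sum>n. x ^ Suc n / of_nat (Suc n) ^ 3)"

text \<open>On complex arguments \<open>powr\<close> and \<open>csqrt\<close> are principal branches, with argument in
  \<open>(-pi, pi]\<close>; in particular the cube root of a negative real has argument \<open>pi/3\<close>.\<close>

definition L_phase :: "nat \<Rightarrow> complex \<Rightarrow> complex" where
  "L_phase k x = (2 * Li3 (x ^ k)) powr (1/3) / of_nat k"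

definition level_set :: "complex set" where
  "level_set = {x. 0 < norm x \<and> norm x < 1 \<and> Re (L_phase 1 x) = Re (L_phase 2 x)}"

definition x_star :: real where
  "x_star = (THE x. complex_of_real x \<in> level_set)"

end

theory Submission
  imports Defs "HOL-Probability.Distributions" "HOL-Real_Asymp.Real_Asymp"
begin

text \<open>
  The diagonals of a plane partition form two interlacing chains of partitions that start at the main
  diagonal. A local rule exchanges two interlacing steps at the cost of a geometric series;
  iterating it gives \<open>\<Prod>m\<ge>1. (1 - x u^m)^(-m)\<close> for the generating function by trace.
  Hence \<open>Q_n(x)\<close> is an integral over the circle \<open>u = exp (-\<sigma> - i\<theta>)\<close>, where \<open>\<sigma> = Re L_1(x) n^(-1/3)\<close>.

  Near \<open>u = 1\<close> and \<open>u = -1\<close> the logarithm of the product, as a function of \<open>w = \<sigma> + i\<theta>\<close>, is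
  \<open>L^3 / (2 w^2)\<close> plus a constant and an error \<open>O(w^2)\<close>, for \<open>L = L_1\<close> and \<open>L = L_2\<close>, so that the saddle points
  are at \<open>w = L n^(-1/3)\<close>. On the level set \<open>Re L_1 = Re L_2\<close> a single circle passes through both of them, and
  the identity \<open>a^3/(2 b^2) + b - 3a/2 = (b - a)^2 (2b + a) / (2 b^2)\<close> controls the phase on the whole arc.
  For real \<open>x\<close> between \<open>x_star\<close> and 0 the cube root of the negative number \<open>Li_3(x)\<close> has two conjugate
  branches, hence two conjugate saddle points near \<open>u = 1\<close>, whose sum is the cosine, while the arc at
  \<open>u = -1\<close> is exponentially smaller. The rest of the circle is negligible by
  the termwise bound for the logarithm.
\<close>

section \<open>The trace generating function of plane partitions\<close>

text \<open>The obstacle is to keep one circle below its saddle values everywhere. With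
  \<open>a = 1 + i \<tau>\<close> and \<open>b = 1 + i t\<close>, the real part of the cofactor has
  the sign of \<open>(t + \<tau>)^2 + 3 - \<tau>^2\<close>. A principal cube root has argument at
  most pi/3, so \<open>\<tau>^2 <= 3\<close>, with equality exactly for the root of a negative real.
  At non-real points of the level set the inequality is strict for both saddles, because such points
  are not imaginary, and compactness bounds the cofactor below on the whole arc. On the negative
  axis \<open>\<tau> = sqrt 3\<close>, and the cofactor vanishes at the conjugate saddle
  \<open>t = - \<tau>\<close>; there only the half arc \<open>t >= 0\<close> is treated, and the
  other half is its conjugate. The arcs have half-width \<open>24 \<sigma>\<close>. Outside them the
  logarithm is at most 35/76 of \<open>\<nu> = n \<sigma>\<close>, less than the 1/2 that the saddle
  value \<open>3/2 \<nu>\<close> leaves after \<open>n \<sigma>\<close>, so no other root of unity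
  gets an arc. The combinatorial sums are taken in \<open>ennreal\<close> over all sequences, and
  the finiteness of the number of partitions of given size and trace is deduced from the finite
  total.\<close>

definition fin_supp :: "(nat \<Rightarrow> nat) \<Rightarrow> bool" where
  "fin_supp l \<longleftrightarrow> finite {i. l i \<noteq> 0}"

definition psize :: "(nat \<Rightarrow> nat) \<Rightarrow> nat" where
  "psize l = (\<Sum>i | l i \<noteq> 0. l i)"

text \<open>Horizontal strips. The two inequalities force both \<open>m\<close> and \<open>l\<close>
  to decrease weakly, so a sequence that interlaces with another one is a partition as soon as its
  support is finite.\<close>

definition interlaces :: "(nat \<Rightarrow> nat) \<Rightarrow> (nat \<Rightarrow> nat) \<Rightarrow> bool"  (infix \<open>\<preceq>i\<close> 50) where
  "m \<preceq>i l \<longleftrightarrow> (\<forall>i. m i \<le> l i \<and> l (Suc i) \<le> m i)"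

lemma fin_supp_iff: "fin_supp l \<longleftrightarrow> (\<exists>N. \<forall>i\<ge>N. l i = 0)"
proof
  assume "fin_supp l"
  then obtain N where "\<forall>i\<in>{i. l i \<noteq> 0}. i < N"
    unfolding fin_supp_def by (meson finite_nat_bounded lessThan_iff subsetD)
  then have "\<forall>i\<ge>N. l i = 0" by (auto simp: not_less[symmetric])
  then show "\<exists>N. \<forall>i\<ge>N. l i = 0" ..
next
  assume "\<exists>N. \<forall>i\<ge>N. l i = 0"
  then obtain N where "\<forall>i\<ge>N. l i = 0" ..
  then have "{i. l i \<noteq> 0} \<subseteq> {..<N}" by (auto simp: not_less[symmetric])
  then show "fin_supp l" unfolding fin_supp_def by (rule finite_subset) simp
qed

lemma psize_eq: "(\<And>i. i \<ge> N \<Longrightarrow> l i = 0) \<Longrightarrow> psize l = (\<Sum>i<N. l i)"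
  unfolding psize_def by (rule sum.mono_neutral_left) (auto intro: ccontr)

lemma interlaces_fin_supp:
  assumes "m \<preceq>i l" shows "fin_supp m \<longleftrightarrow> fin_supp l"
proof -
  have "m i = 0" if "l i = 0" for i using assms that by (auto simp: interlaces_def dest: spec[of _ i])
  moreover have "l i = 0" if "m (i - 1) = 0" "i \<ge> 1" for i
    using assms that by (auto simp: interlaces_def dest: spec[of _ "i - 1"])
  moreover have "\<forall>i\<ge>Suc N. l i = 0" if "\<forall>i\<ge>N. m i = 0" for N
    using that calculation(2) by auto
  ultimately show ?thesis unfolding fin_supp_iff by metis
qed

lemma interlaces_psize_le:
  assumes "m \<preceq>i l" "fin_supp l" shows "psize m \<le> psize l"
proof -
  from assms(2) obtain N where N: "\<forall>i\<ge>N. l i = 0" by (auto simp: fin_supp_iff)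
  then have M: "\<forall>i\<ge>N. m i = 0" using assms(1) unfolding interlaces_def by (metis le_zero_eq)
  show ?thesis using psize_eq[of N l] psize_eq[of N m] N M assms(1)
    by (auto simp: interlaces_def intro: sum_mono)
qed

lemma psize_zero [simp]: "psize (\<lambda>_. 0) = 0" by (simp add: psize_def)

text \<open>The piecewise linear local move behind the RSK correspondence.\<close>

definition raise :: "(nat \<Rightarrow> nat) \<Rightarrow> (nat \<Rightarrow> nat) \<Rightarrow> nat \<times> (nat \<Rightarrow> nat) \<Rightarrow> nat \<Rightarrow> nat" where
  "raise m n = (\<lambda>(c, k) i. case i of 0 \<Rightarrow> max (m 0) (n 0) + c
      | Suc j \<Rightarrow> max (m (Suc j)) (n (Suc j)) + min (m j) (n j) - k j)"

text \<open>The bounds on \<open>l (Suc j)\<close> are those on \<open>k j\<close>, namely the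
  interval from \<open>max (m (Suc j)) (n (Suc j))\<close> to \<open>min (m j) (n j)\<close>, and
  reflecting this interval turns one into the other. Only \<open>l 0\<close> has no upper bound; its
  excess over \<open>max (m 0) (n 0)\<close> is the free number \<open>c\<close>.\<close>

lemma bij_betw_raise:
  "bij_betw (raise m n) (UNIV \<times> {k. k \<preceq>i m \<and> k \<preceq>i n}) {l. m \<preceq>i l \<and> n \<preceq>i l}"
proof (rule bij_betw_byWitness[where f' = "\<lambda>l. (l 0 - max (m 0) (n 0),
    \<lambda>j. max (m (Suc j)) (n (Suc j)) + min (m j) (n j) - l (Suc j))"])
  have *: "k j \<le> m j" "k j \<le> n j" if "k \<preceq>i m" "k \<preceq>i n" for k j
    using that by (auto simp: interlaces_def)
  show "\<forall>a\<in>UNIV \<times> {k. k \<preceq>i m \<and> k \<preceq>i n}.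
       (raise m n a 0 - max (m 0) (n 0), \<lambda>j. max (m (Suc j)) (n (Suc j)) + min (m j) (n j) - raise m n a (Suc j)) = a"
    using * by (auto simp: raise_def fun_eq_iff intro!: diff_diff_cancel trans_le_add2)
  have l: "max (m 0) (n 0) \<le> l 0" "l (Suc j) \<le> min (m j) (n j)" if "m \<preceq>i l" "n \<preceq>i l" for l j
    using that by (auto simp: interlaces_def)
  show "\<forall>l\<in>{l. m \<preceq>i l \<and> n \<preceq>i l}. raise m n (l 0 - max (m 0) (n 0),
    \<lambda>j. max (m (Suc j)) (n (Suc j)) + min (m j) (n j) - l (Suc j)) = l"
  proof
    fix l assume "l \<in> {l. m \<preceq>i l \<and> n \<preceq>i l}"
    note L = l[of l] and A = this
    show "raise m n (l 0 - max (m 0) (n 0),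
      \<lambda>j. max (m (Suc j)) (n (Suc j)) + min (m j) (n j) - l (Suc j)) = l"
    proof
      fix i show "raise m n (l 0 - max (m 0) (n 0),
        \<lambda>j. max (m (Suc j)) (n (Suc j)) + min (m j) (n j) - l (Suc j)) i = l i"
        using A L(1) L(2)[of "i - 1"] by (cases i) (auto simp: raise_def)
    qed
  qed
  show "raise m n ` (UNIV \<times> {k. k \<preceq>i m \<and> k \<preceq>i n}) \<subseteq> {l. m \<preceq>i l \<and> n \<preceq>i l}"
  proof clarify
    fix c k assume k: "k \<preceq>i m" "k \<preceq>i n"
    have k': "k j \<le> m j" "k j \<le> n j" "m (Suc j) \<le> k j" "n (Suc j) \<le> k j" for j
      using k by (auto simp: interlaces_def)
    have "m i \<le> raise m n (c, k) i \<and> n i \<le> raise m n (c, k) i \<and>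
          raise m n (c, k) (Suc i) \<le> m i \<and> raise m n (c, k) (Suc i) \<le> n i" for i
      using k'[of i] k'[of "i - 1"] by (cases i) (auto simp: raise_def)
    then show "m \<preceq>i raise m n (c, k) \<and> n \<preceq>i raise m n (c, k)" by (auto simp: interlaces_def)
  qed
  show "(\<lambda>l. (l 0 - max (m 0) (n 0), \<lambda>j. max (m (Suc j)) (n (Suc j)) + min (m j) (n j) - l (Suc j))) `
    {l. m \<preceq>i l \<and> n \<preceq>i l} \<subseteq> UNIV \<times> {k. k \<preceq>i m \<and> k \<preceq>i n}"
  proof (rule image_subsetI)
    fix l assume "l \<in> {l. m \<preceq>i l \<and> n \<preceq>i l}"
    then have l: "m \<preceq>i l" "n \<preceq>i l" by auto
    have l': "l (Suc j) \<le> m j" "l (Suc j) \<le> n j" "m (Suc j) \<le> l (Suc j)" "n (Suc j) \<le> l (Suc j)" for j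
      using l by (auto simp: interlaces_def)
    have "max (m (Suc i)) (n (Suc i)) + min (m i) (n i) - l (Suc i) \<le> min (m i) (n i) \<and>
      max (m (Suc i)) (n (Suc i)) \<le> max (m (Suc i)) (n (Suc i)) + min (m i) (n i) - l (Suc i)" for i
      using l'[of i] by auto
    then show "(l 0 - max (m 0) (n 0), \<lambda>j. max (m (Suc j)) (n (Suc j)) + min (m j) (n j) - l (Suc j))
        \<in> UNIV \<times> {k. k \<preceq>i m \<and> k \<preceq>i n}"
      by (auto simp: interlaces_def)
  qed
qed

text \<open>By the reflection, \<open>raise m n (c, k) (Suc j) + k j\<close> is a maximum at
  \<open>Suc j\<close> plus a minimum at \<open>j\<close>. Summed over \<open>j\<close> and
  regrouped by position, maximum plus minimum is \<open>m j + n j\<close>, and \<open>c\<close> is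
  what position 0 adds.\<close>

lemma psize_raise:
  assumes "fin_supp m" "fin_supp n" "k \<preceq>i m" "k \<preceq>i n"
  shows "psize (raise m n (c, k)) + psize k = psize m + psize n + c"
proof -
  obtain N1 N2 where N: "\<forall>i\<ge>N1. m i = 0" "\<forall>i\<ge>N2. n i = 0"
    using assms by (auto simp: fin_supp_iff)
  define N where "N = max N1 N2"
  have k': "k j \<le> m j" "k j \<le> n j" for j
    using assms by (auto simp: interlaces_def)
  have z: "m i = 0" "n i = 0" "k i = 0" if "i \<ge> N" for i
    using N that k'[of i] by (auto simp: N_def)
  have r: "raise m n (c, k) i = 0" if "i \<ge> Suc N" for i
    using that z by (cases i) (auto simp: raise_def)
  have "psize (raise m n (c, k)) + psize k = (\<Sum>i<Suc N. raise m n (c, k) i) + (\<Sum>i<N. k i)"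
    using psize_eq[of "Suc N" "raise m n (c,k)"] psize_eq[of N k] r z by simp
  also have "\<dots> = max (m 0) (n 0) + c + (\<Sum>j<N. raise m n (c, k) (Suc j) + k j)"
    by (subst sum.lessThan_Suc_shift) (simp add: raise_def sum.distrib)
  also have "(\<Sum>j<N. raise m n (c, k) (Suc j) + k j) = (\<Sum>j<N. max (m (Suc j)) (n (Suc j)) + min (m j) (n j))"
    using k' by (intro sum.cong) (auto simp: raise_def intro!: le_add_diff_inverse2 trans_le_add2)
  also have "max (m 0) (n 0) + c + \<dots> = c + (\<Sum>j<Suc N. max (m j) (n j)) + (\<Sum>j<N. min (m j) (n j))"
    by (subst sum.lessThan_Suc_shift) (simp add: sum.distrib)
  also have "\<dots> = c + (\<Sum>j<N. max (m j) (n j) + min (m j) (n j))"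
    using z[of N] by (simp add: sum.distrib)
  also have "(\<Sum>j<N. max (m j) (n j) + min (m j) (n j)) = (\<Sum>j<N. m j + n j)"
    by (intro sum.cong) auto
  also have "\<dots> = psize m + psize n"
    using psize_eq[of N m] psize_eq[of N n] z by (simp add: sum.distrib)
  finally show ?thesis by simp
qed

text \<open>The functions on \<open>nat\<close> are uncountable, and their counting measure is not
  sigma-finite. The exchange rests on the form of Tonelli's theorem for counting measures, which
  passes through the sum over pairs.\<close>

lemma nn_integral_count_space_swap:
  "(\<integral>\<^sup>+x. \<integral>\<^sup>+y. f x y \<partial>count_space UNIV \<partial>count_space UNIV) =
   (\<integral>\<^sup>+y. \<integral>\<^sup>+x. f x y \<partial>count_space UNIV \<partial>count_space UNIV)"
  using nn_integral_fst_count_space[of "\<lambda>(x, y). f x y"] nn_integral_snd_count_space[of "\<lambda>(x, y). f x y"]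
  by simp

text \<open>In \<open>ennreal\<close> the series has a value for every \<open>b\<close>, infinite
  from 1 on, so the combinatorial identities below hold for all weights and convergence is discussed
  only at their end.\<close>

definition geom :: "ennreal \<Rightarrow> ennreal" where "geom b = (\<Sum>m. b ^ m)"

text \<open>The commutation relation of the operators that add and remove a horizontal strip, read
  off from \<open>raise\<close>: the size \<open>psize l - psize n\<close> becomes
  \<open>c + (psize m - psize k)\<close>, and the sum over \<open>c\<close> gives the factor
  \<open>geom b\<close>.\<close>

lemma local_rule:
  assumes "fin_supp m" "fin_supp n"
  shows "(\<integral>\<^sup>+l. of_bool (m \<preceq>i l \<and> n \<preceq>i l) * b ^ (psize l - psize n) \<partial>count_space UNIV) =
    geom b * (\<integral>\<^sup>+k. of_bool (k \<preceq>i m \<and> k \<preceq>i n) * b ^ (psize m - psize k) \<partial>count_space UNIV)"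
proof -
  let ?K = "{k. k \<preceq>i m \<and> k \<preceq>i n}"
  have "(\<integral>\<^sup>+l. of_bool (m \<preceq>i l \<and> n \<preceq>i l) * b ^ (psize l - psize n) \<partial>count_space UNIV) =
        (\<integral>\<^sup>+l. b ^ (psize l - psize n) \<partial>count_space {l. m \<preceq>i l \<and> n \<preceq>i l})"
    by (subst nn_integral_count_space_indicator) (auto intro!: nn_integral_cong simp: indicator_def mult.commute)
  also have "\<dots> = (\<integral>\<^sup>+p. b ^ (psize (raise m n p) - psize n) \<partial>count_space (UNIV \<times> ?K))"
    by (rule nn_integral_bij_count_space[OF bij_betw_raise, symmetric])
  also have "\<dots> = (\<integral>\<^sup>+p. of_bool (snd p \<in> ?K) * (b ^ fst p * b ^ (psize m - psize (snd p))) \<partial>count_space UNIV)"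
  proof (subst nn_integral_count_space_indicator, simp, rule nn_integral_cong)
    fix p :: "nat \<times> (nat \<Rightarrow> nat)"
    obtain c k where p: "p = (c, k)" by force
    show "b ^ (psize (raise m n p) - psize n) * indicator (UNIV \<times> {k. k \<preceq>i m \<and> k \<preceq>i n}) p =
         of_bool (snd p \<in> ?K) * (b ^ fst p * b ^ (psize m - psize (snd p)))"
    proof (cases "k \<in> ?K")
      case True
      then have "psize (raise m n (c, k)) - psize n = c + (psize m - psize k)"
        using psize_raise[OF assms, of k c] interlaces_psize_le[of k m] assms by auto
      with True show ?thesis by (simp add: p power_add)
    qed (auto simp: p)
  qed
  also have "\<dots> = (\<integral>\<^sup>+c. \<integral>\<^sup>+k. of_bool (k \<in> ?K) * (b ^ c * b ^ (psize m - psize k)) \<partial>count_space UNIV \<partial>count_space UNIV)"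
    by (subst nn_integral_fst_count_space[symmetric]) simp
  also have "\<dots> = (\<integral>\<^sup>+c. b ^ c * (\<integral>\<^sup>+k. of_bool (k \<preceq>i m \<and> k \<preceq>i n) * b ^ (psize m - psize k) \<partial>count_space UNIV) \<partial>count_space UNIV)"
    by (subst nn_integral_cmult[symmetric]) (auto intro!: nn_integral_cong simp: mult_ac)
  also have "\<dots> = geom b * (\<integral>\<^sup>+k. of_bool (k \<preceq>i m \<and> k \<preceq>i n) * b ^ (psize m - psize k) \<partial>count_space UNIV)"
    by (subst nn_integral_multc) (auto simp: geom_def nn_integral_count_space_nat)
  finally show ?thesis .
qed

text \<open>Sums over the chains that descend from \<open>l\<close> to the zero sequence in
  \<open>M\<close> interlacing steps, weighted by \<open>u\<close> to the total size of all members
  except \<open>l\<close>. For a partition \<open>l\<close> this is the Schur function at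
  \<open>1, u, ..., u^(M-1)\<close>. Leaving out the size of \<open>l\<close> lets two chains share
  their head without counting it twice.\<close>

primrec chain_gf :: "ennreal \<Rightarrow> nat \<Rightarrow> (nat \<Rightarrow> nat) \<Rightarrow> ennreal" where
  "chain_gf u 0 l = of_bool (l = (\<lambda>_. 0))"
| "chain_gf u (Suc M) l = (\<integral>\<^sup>+n. of_bool (n \<preceq>i l) * (u ^ psize n * chain_gf u M n) \<partial>count_space UNIV)"

text \<open>On an infinite support \<open>psize\<close> is 0, the default value of an infinite sum,
  so the weights alone do not suppress such terms in the integrals over all sequences. They vanish
  because interlacing preserves finiteness of the support and every chain ends at zero.\<close>

lemma chain_gf_not_fin_supp: "\<not> fin_supp l \<Longrightarrow> chain_gf u M l = 0"
proof (induction M arbitrary: l)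
  case 0 then show ?case by (auto simp: fin_supp_def)
next
  case (Suc M)
  then have "of_bool (n \<preceq>i l) * (u ^ psize n * chain_gf u M n) = 0" for n
    using interlaces_fin_supp[of n l] by auto
  then show ?case by (simp only: chain_gf.simps) simp
qed

lemma nn_integral_count_space_singleton:
  assumes "\<And>x. x \<noteq> a \<Longrightarrow> f x = 0"
  shows "(\<integral>\<^sup>+x. f x \<partial>count_space UNIV) = f a"
  using nn_integral_count_space'[of "{a}" UNIV f] assms by simp

lemma interlaces_zero_iff [simp]: "m \<preceq>i (\<lambda>_. 0) \<longleftrightarrow> m = (\<lambda>_. 0)"
  by (auto simp: interlaces_def fun_eq_iff)

lemma chain_gf_zero [simp]: "chain_gf u M (\<lambda>_. 0) = 1"
proof (induction M)
  case (Suc M)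
  show ?case using Suc by (simp, subst nn_integral_count_space_singleton[where a = "\<lambda>_. 0"]) auto
qed simp

text \<open>A Cauchy identity for skew Schur functions in one variable \<open>b\<close>. With
  \<open>m\<close> the first link below \<open>l\<close>, the local rule trades \<open>l\<close>
  above \<open>m\<close> and \<open>n\<close> for some \<open>k\<close> below both. The weight
  \<open>u ^ psize m\<close> then splits into \<open>u ^ psize k * u ^ (psize m - psize k)\<close>,
  which turns \<open>b\<close> into \<open>b * u\<close> for the rest of the chain; hence the
  induction is over all \<open>b\<close> and \<open>n\<close>.\<close>

lemma chain_gf_skew_Cauchy:
  assumes "fin_supp n"
  shows "(\<integral>\<^sup>+l. of_bool (n \<preceq>i l) * b ^ (psize l - psize n) * chain_gf u M l \<partial>count_space UNIV) =
         (\<Prod>i<M. geom (b * u ^ i)) * chain_gf u M n"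
  using assms
proof (induction M arbitrary: b n)
  case 0
  show ?case by (subst nn_integral_count_space_singleton[where a = "\<lambda>_. 0"]) auto
next
  case (Suc M)
  let ?Z = "chain_gf u M"
  have "(\<integral>\<^sup>+l. of_bool (n \<preceq>i l) * b ^ (psize l - psize n) * chain_gf u (Suc M) l \<partial>count_space UNIV) =
    (\<integral>\<^sup>+l. \<integral>\<^sup>+m. of_bool (m \<preceq>i l \<and> n \<preceq>i l) * b ^ (psize l - psize n) * (u ^ psize m * ?Z m)
       \<partial>count_space UNIV \<partial>count_space UNIV)"
    by (auto simp: nn_integral_cmult[symmetric] mult_ac of_bool_conj intro!: nn_integral_cong)
  also have "\<dots> = (\<integral>\<^sup>+m. \<integral>\<^sup>+l. of_bool (m \<preceq>i l \<and> n \<preceq>i l) * b ^ (psize l - psize n) * (u ^ psize m * ?Z m)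
       \<partial>count_space UNIV \<partial>count_space UNIV)"
    by (rule nn_integral_count_space_swap)
  also have "\<dots> = (\<integral>\<^sup>+m. geom b * (\<integral>\<^sup>+k. of_bool (k \<preceq>i m \<and> k \<preceq>i n) * b ^ (psize m - psize k) \<partial>count_space UNIV)
       * (u ^ psize m * ?Z m) \<partial>count_space UNIV)"
  proof (rule nn_integral_cong)
    fix m
    show "(\<integral>\<^sup>+l. of_bool (m \<preceq>i l \<and> n \<preceq>i l) * b ^ (psize l - psize n) * (u ^ psize m * ?Z m) \<partial>count_space UNIV) =
      geom b * (\<integral>\<^sup>+k. of_bool (k \<preceq>i m \<and> k \<preceq>i n) * b ^ (psize m - psize k) \<partial>count_space UNIV) * (u ^ psize m * ?Z m)"
      using local_rule[of m n b] Suc.prems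
      by (cases "fin_supp m") (simp_all add: nn_integral_multc chain_gf_not_fin_supp)
  qed
  also have "\<dots> = geom b * (\<integral>\<^sup>+m. \<integral>\<^sup>+k. of_bool (k \<preceq>i m \<and> k \<preceq>i n) * b ^ (psize m - psize k) * (u ^ psize m * ?Z m)
        \<partial>count_space UNIV \<partial>count_space UNIV)"
    by (subst nn_integral_cmult[symmetric], simp, rule nn_integral_cong)
       (simp add: nn_integral_cmult mult_ac)
  also have "\<dots> = geom b * (\<integral>\<^sup>+k. \<integral>\<^sup>+m. of_bool (k \<preceq>i m \<and> k \<preceq>i n) * b ^ (psize m - psize k) * (u ^ psize m * ?Z m)
        \<partial>count_space UNIV \<partial>count_space UNIV)"
    by (subst nn_integral_count_space_swap) simp
  also have "\<dots> = geom b * (\<integral>\<^sup>+k. of_bool (k \<preceq>i n) * (u ^ psize k * ((\<Prod>i<M. geom (b * u * u ^ i)) * ?Z k)) \<partial>count_space UNIV)"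
  proof (intro arg_cong[where f = "\<lambda>z. geom b * z"] nn_integral_cong)
    fix k
    show "(\<integral>\<^sup>+m. of_bool (k \<preceq>i m \<and> k \<preceq>i n) * b ^ (psize m - psize k) * (u ^ psize m * ?Z m) \<partial>count_space UNIV) =
        of_bool (k \<preceq>i n) * (u ^ psize k * ((\<Prod>i<M. geom (b * u * u ^ i)) * ?Z k))"
    proof (cases "k \<preceq>i n")
      case True
      then have "fin_supp k" using interlaces_fin_supp Suc.prems by auto
      have *: "of_bool (k \<preceq>i m \<and> k \<preceq>i n) * b ^ (psize m - psize k) * (u ^ psize m * ?Z m) =
            u ^ psize k * (of_bool (k \<preceq>i m) * (b * u) ^ (psize m - psize k) * ?Z m)" for m
      proof (cases "k \<preceq>i m \<and> fin_supp m")
        case T: True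
        then have "psize k \<le> psize m" by (auto intro: interlaces_psize_le)
        then have "u ^ psize m = u ^ psize k * u ^ (psize m - psize k)"
          by (simp add: power_add[symmetric])
        with T True show ?thesis by (simp add: power_mult_distrib mult_ac)
      qed (auto simp: chain_gf_not_fin_supp)
      show ?thesis using True
        by (subst *, subst nn_integral_cmult, simp, subst Suc.IH[OF \<open>fin_supp k\<close>]) simp
    qed simp
  qed
  also have "\<dots> = geom b * ((\<Prod>i<M. geom (b * u * u ^ i)) * chain_gf u (Suc M) n)"
    by (auto simp: nn_integral_cmult[symmetric] mult_ac intro!: nn_integral_cong arg_cong[where f = "\<lambda>z. geom b * z"])
  also have "geom b * ((\<Prod>i<M. geom (b * u * u ^ i)) * chain_gf u (Suc M) n) = (\<Prod>i<Suc M. geom (b * u ^ i)) * chain_gf u (Suc M) n"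
    by (subst prod.lessThan_Suc_shift) (simp add: mult_ac del: chain_gf.simps)
  finally show ?case .
qed

text \<open>Fixing the first link \<open>n\<close> of the first chain leaves a sum over
  \<open>l\<close> to which the skew identity applies with \<open>b = y\<close>. What remains, with
  weight \<open>y ^ psize n * u ^ psize n\<close>, is the same problem for \<open>y * u\<close> and
  one link fewer, so the exponents \<open>i + j\<close> build up row by row.\<close>

lemma chain_gf_Cauchy:
  "(\<integral>\<^sup>+l. y ^ psize l * chain_gf u N l * chain_gf u M l \<partial>count_space UNIV) =
   (\<Prod>j<N. \<Prod>i<M. geom (y * u ^ (i + j)))"
proof (induction N arbitrary: y)
  case 0
  show ?case by (subst nn_integral_count_space_singleton[where a = "\<lambda>_. 0"]) auto
next
  case (Suc N)
  have "(\<integral>\<^sup>+l. y ^ psize l * chain_gf u (Suc N) l * chain_gf u M l \<partial>count_space UNIV) =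
    (\<integral>\<^sup>+l. \<integral>\<^sup>+n. of_bool (n \<preceq>i l) * y ^ psize l * chain_gf u M l * (u ^ psize n * chain_gf u N n)
       \<partial>count_space UNIV \<partial>count_space UNIV)"
    by (auto simp: nn_integral_cmult[symmetric] nn_integral_multc[symmetric] mult_ac intro!: nn_integral_cong)
  also have "\<dots> = (\<integral>\<^sup>+n. \<integral>\<^sup>+l. of_bool (n \<preceq>i l) * y ^ psize l * chain_gf u M l * (u ^ psize n * chain_gf u N n)
       \<partial>count_space UNIV \<partial>count_space UNIV)"
    by (rule nn_integral_count_space_swap)
  also have "\<dots> = (\<integral>\<^sup>+n. (\<Prod>i<M. geom (y * u ^ i)) * ((y * u) ^ psize n * chain_gf u N n * chain_gf u M n) \<partial>count_space UNIV)"
  proof (rule nn_integral_cong)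
    fix n
    show "(\<integral>\<^sup>+l. of_bool (n \<preceq>i l) * y ^ psize l * chain_gf u M l * (u ^ psize n * chain_gf u N n) \<partial>count_space UNIV) =
      (\<Prod>i<M. geom (y * u ^ i)) * ((y * u) ^ psize n * chain_gf u N n * chain_gf u M n)"
    proof (cases "fin_supp n")
      case True
      have *: "of_bool (n \<preceq>i l) * y ^ psize l * chain_gf u M l * (u ^ psize n * chain_gf u N n) =
        (of_bool (n \<preceq>i l) * y ^ (psize l - psize n) * chain_gf u M l) * (y ^ psize n * u ^ psize n * chain_gf u N n)" for l
      proof (cases "n \<preceq>i l")
        case T: True
        then have "psize n \<le> psize l" using True interlaces_fin_supp by (auto intro: interlaces_psize_le)
        then have "y ^ psize l = y ^ psize n * y ^ (psize l - psize n)"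
          by (simp add: power_add[symmetric])
        then show ?thesis by (simp add: mult_ac)
      qed simp
      show ?thesis
        by (subst *, subst nn_integral_multc, simp, subst chain_gf_skew_Cauchy[OF True])
           (simp_all add: power_mult_distrib mult_ac)
    qed (simp add: chain_gf_not_fin_supp)
  qed
  also have "\<dots> = (\<Prod>i<M. geom (y * u ^ i)) * (\<Prod>j<N. \<Prod>i<M. geom (y * u * u ^ (i + j)))"
    by (simp add: nn_integral_cmult Suc.IH)
  also have "\<dots> = (\<Prod>j<Suc N. \<Prod>i<M. geom (y * u ^ (i + j)))"
    by (subst prod.lessThan_Suc_shift) (simp add: mult_ac)
  finally show ?case .
qed

section \<open>Plane partitions as pairs of chains of diagonals\<close>

definition chains :: "nat \<Rightarrow> (nat \<Rightarrow> nat \<Rightarrow> nat) set" where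
  "chains N = {C. (\<forall>d. C (Suc d) \<preceq>i C d) \<and> (\<forall>d\<ge>N. C d = (\<lambda>_. 0))}"

text \<open>The head \<open>C 0\<close> is omitted, as in the weight of \<open>chain_gf\<close>: it
  is the main diagonal, common to both chains, and is counted separately.\<close>

definition tail_size :: "nat \<Rightarrow> (nat \<Rightarrow> nat \<Rightarrow> nat) \<Rightarrow> nat" where
  "tail_size N C = (\<Sum>d<N. psize (C (Suc d)))"

lemma chains_Suc_iff: "C \<in> chains (Suc N) \<longleftrightarrow> C \<circ> Suc \<in> chains N \<and> C 1 \<preceq>i C 0"
proof
  assume "C \<in> chains (Suc N)"
  then show "C \<circ> Suc \<in> chains N \<and> C 1 \<preceq>i C 0" by (auto simp: chains_def)
next
  assume A: "C \<circ> Suc \<in> chains N \<and> C 1 \<preceq>i C 0"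
  have "C (Suc d) \<preceq>i C d" for d using A by (cases d) (auto simp: chains_def)
  moreover have "C d = (\<lambda>_. 0)" if "d \<ge> Suc N" for d using A that by (cases d) (auto simp: chains_def)
  ultimately show "C \<in> chains (Suc N)" by (auto simp: chains_def)
qed

lemma bij_betw_tail:
  "bij_betw (\<lambda>C. C \<circ> Suc) {C \<in> chains (Suc N). C 0 = l} {C \<in> chains N. C 0 \<preceq>i l}"
proof (rule bij_betw_byWitness[where f' = "case_nat l"])
  show "\<forall>C\<in>{C \<in> chains (Suc N). C 0 = l}. case_nat l (C \<circ> Suc) = C"
    by (auto simp: fun_eq_iff split: nat.splits)
  show "\<forall>C\<in>{C \<in> chains N. C 0 \<preceq>i l}. case_nat l C \<circ> Suc = C" by auto
  show "(\<lambda>C. C \<circ> Suc) ` {C \<in> chains (Suc N). C 0 = l} \<subseteq> {C \<in> chains N. C 0 \<preceq>i l}"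
    by (auto simp: chains_Suc_iff)
  have "case_nat l C \<circ> Suc = C" for C :: "nat \<Rightarrow> nat \<Rightarrow> nat" by auto
  then show "case_nat l ` {C \<in> chains N. C 0 \<preceq>i l} \<subseteq> {C \<in> chains (Suc N). C 0 = l}"
    by (auto simp: chains_Suc_iff)
qed

text \<open>Unfolds the recursion: prepending a head to a chain is a bijection, and from then on the
  former head counts towards the size.\<close>

lemma chain_gf_eq:
  "chain_gf u N l = (\<integral>\<^sup>+C. of_bool (C \<in> chains N \<and> C 0 = l) * u ^ tail_size N C \<partial>count_space UNIV)"
proof (induction N arbitrary: l)
  case 0
  have c0: "chains 0 = {\<lambda>_ _. 0}" by (auto simp: chains_def interlaces_def)
  show ?case
    by (subst nn_integral_count_space_singleton[where a = "\<lambda>_ _. 0"]) (auto simp: c0 tail_size_def)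
next
  case (Suc N)
  have "chain_gf u (Suc N) l = (\<integral>\<^sup>+n. \<integral>\<^sup>+C. of_bool (n \<preceq>i l) * u ^ psize n *
      (of_bool (C \<in> chains N \<and> C 0 = n) * u ^ tail_size N C) \<partial>count_space UNIV \<partial>count_space UNIV)"
    by (auto simp: Suc.IH nn_integral_cmult[symmetric] mult.assoc intro!: nn_integral_cong simp del: of_bool_conj)
  also have "\<dots> = (\<integral>\<^sup>+C. \<integral>\<^sup>+n. of_bool (n \<preceq>i l) * u ^ psize n *
      (of_bool (C \<in> chains N \<and> C 0 = n) * u ^ tail_size N C) \<partial>count_space UNIV \<partial>count_space UNIV)"
    by (rule nn_integral_count_space_swap)
  also have "\<dots> = (\<integral>\<^sup>+C. of_bool (C \<in> chains N \<and> C 0 \<preceq>i l) * u ^ (psize (C 0) + tail_size N C) \<partial>count_space UNIV)"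
  proof (rule nn_integral_cong)
    fix C :: "nat \<Rightarrow> nat \<Rightarrow> nat"
    show "(\<integral>\<^sup>+n. of_bool (n \<preceq>i l) * u ^ psize n * (of_bool (C \<in> chains N \<and> C 0 = n) * u ^ tail_size N C) \<partial>count_space UNIV)
      = of_bool (C \<in> chains N \<and> C 0 \<preceq>i l) * u ^ (psize (C 0) + tail_size N C)"
      by (subst nn_integral_count_space_singleton[where a = "C 0"]) (auto simp: power_add)
  qed
  also have "\<dots> = (\<integral>\<^sup>+C. u ^ (psize (C 0) + tail_size N C) \<partial>count_space {C \<in> chains N. C 0 \<preceq>i l})"
    by (subst nn_integral_count_space_indicator) (auto intro!: nn_integral_cong simp: indicator_def mult.commute)
  also have "\<dots> = (\<integral>\<^sup>+C. u ^ (psize ((C \<circ> Suc) 0) + tail_size N (C \<circ> Suc)) \<partial>count_space {C \<in> chains (Suc N). C 0 = l})"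
    by (rule nn_integral_bij_count_space[OF bij_betw_tail, symmetric])
  also have "\<dots> = (\<integral>\<^sup>+C. u ^ tail_size (Suc N) C \<partial>count_space {C \<in> chains (Suc N). C 0 = l})"
    by (intro nn_integral_cong) (simp only: tail_size_def sum.lessThan_Suc_shift, simp)
  also have "\<dots> = (\<integral>\<^sup>+C. of_bool (C \<in> chains (Suc N) \<and> C 0 = l) * u ^ tail_size (Suc N) C \<partial>count_space UNIV)"
    by (subst nn_integral_count_space_indicator) (auto intro!: nn_integral_cong simp: indicator_def mult.commute)
  finally show ?case .
qed

definition pp_size :: "(nat \<Rightarrow> nat \<Rightarrow> nat) \<Rightarrow> nat" where
  "pp_size \<pi> = (\<Sum>(i, j)\<in>{(i, j). \<pi> i j \<noteq> 0}. \<pi> i j)"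

text \<open>\<open>plane_partition \<pi> (pp_size \<pi>)\<close> says that \<open>\<pi>\<close> is a
  plane partition of some number. Allowing only \<open>N\<close> diagonals on each side makes the
  generating function a finite product; the restriction is removed by monotone convergence.\<close>

definition banded_pps :: "nat \<Rightarrow> (nat \<Rightarrow> nat \<Rightarrow> nat) set" where
  "banded_pps N = {\<pi>. plane_partition \<pi> (pp_size \<pi>) \<and> (\<forall>i d. d \<ge> N \<longrightarrow> \<pi> i (i + d) = 0 \<and> \<pi> (i + d) i = 0)}"

text \<open>\<open>C\<close> supplies the main diagonal and everything to its right,
  \<open>C'\<close> the entries strictly below it, so the bijection asks for
  \<open>C 0 = C' 0\<close>.\<close>

definition glue :: "(nat \<Rightarrow> nat \<Rightarrow> nat) \<times> (nat \<Rightarrow> nat \<Rightarrow> nat) \<Rightarrow> nat \<Rightarrow> nat \<Rightarrow> nat" where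
  "glue = (\<lambda>(C, C') i j. if i \<le> j then C (j - i) i else C' (i - j) j)"

lemma chains_fin_supp:
  assumes "C \<in> chains N" shows "fin_supp (C d)"
proof -
  \<comment> \<open>Finiteness travels from the zero diagonal \<open>C N\<close> back to the head,
    hence the count downwards from \<open>N\<close>.\<close>
  have "fin_supp (C (N - k))" for k
  proof (induction k)
    case 0 show ?case using assms by (simp add: chains_def fin_supp_def)
  next
    case (Suc k)
    show ?case
    proof (cases "N - Suc k = N - k")
      case False
      then have "Suc (N - Suc k) = N - k" by simp
      then have "C (N - k) \<preceq>i C (N - Suc k)" using assms unfolding chains_def by (metis (no_types, lifting) mem_Collect_eq)
      then show ?thesis using Suc interlaces_fin_supp by blast
    qed (use Suc in simp)
  qed
  from this[of "N - d"] show ?thesis using assms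
    by (cases "d \<le> N") (auto simp: chains_def fin_supp_def)
qed

lemma glue_support:
  assumes "C \<in> chains N" "C' \<in> chains N"
  shows "finite {(i, j). glue (C, C') i j \<noteq> 0}"
    "pp_size (glue (C, C')) = psize (C 0) + tail_size N C + tail_size N C'"
proof -
  \<comment> \<open>The offset is \<open>d\<close> for \<open>C\<close> but \<open>Suc d\<close> for
    \<open>C'\<close>, so that the main diagonal belongs to \<open>?U\<close> alone and the two
    images are disjoint.\<close>
  let ?U = "SIGMA d:{..<N}. {i. C d i \<noteq> 0}" and ?V = "SIGMA d:{..<N}. {i. C' (Suc d) i \<noteq> 0}"
  let ?f = "\<lambda>(d, i). (i, i + d) :: nat \<times> nat" and ?g = "\<lambda>(d, i). (i + Suc d, i) :: nat \<times> nat"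
  have fin: "finite ?U" "finite ?V"
    using chains_fin_supp[OF assms(1)] chains_fin_supp[OF assms(2)] by (auto simp: fin_supp_def)
  have z: "d < N" if "C d i \<noteq> 0" for d i using assms that by (force simp: chains_def not_less[symmetric])
  have z': "d < N" if "C' (Suc d) i \<noteq> 0" for d i
  proof (rule ccontr)
    assume "\<not> d < N"
    then have "C' (Suc d) = (\<lambda>_. 0)" using assms by (auto simp: chains_def)
    with that show False by simp
  qed
  have S: "{(i, j). glue (C, C') i j \<noteq> 0} = ?f ` ?U \<union> ?g ` ?V"
  proof (intro equalityI subsetI)
    fix p assume "p \<in> {(i, j). glue (C, C') i j \<noteq> 0}"
    then obtain i j where p: "p = (i, j)" "glue (C, C') i j \<noteq> 0" by auto
    show "p \<in> ?f ` ?U \<union> ?g ` ?V"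
    proof (cases "i \<le> j")
      case True
      then have "p = ?f (j - i, i)" "(j - i, i) \<in> ?U" using p z by (auto simp: glue_def)
      then show ?thesis by blast
    next
      case False
      then have "p = ?g (i - j - 1, j)" "(i - j - 1, j) \<in> ?V" using p z' by (auto simp: glue_def Suc_diff_Suc)
      then show ?thesis by blast
    qed
  qed (auto simp: glue_def)
  show "finite {(i, j). glue (C, C') i j \<noteq> 0}" unfolding S using fin by auto
  have inj: "inj_on ?f ?U" "inj_on ?g ?V" by (auto simp: inj_on_def)
  have "pp_size (glue (C, C')) = (\<Sum>p\<in>?f ` ?U. case p of (i, j) \<Rightarrow> glue (C, C') i j) + (\<Sum>p\<in>?g ` ?V. case p of (i, j) \<Rightarrow> glue (C, C') i j)"
    unfolding pp_size_def S by (rule sum.union_disjoint) (use fin in auto)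
  also have "(\<Sum>p\<in>?f ` ?U. case p of (i, j) \<Rightarrow> glue (C, C') i j) = (\<Sum>(d, i)\<in>?U. C d i)"
    by (subst sum.reindex[OF inj(1)]) (auto simp: glue_def intro!: sum.cong)
  also have "\<dots> = (\<Sum>d<N. psize (C d))"
    using chains_fin_supp[OF assms(1)] by (subst sum.Sigma[symmetric]) (auto simp: psize_def fin_supp_def)
  also have "\<dots> = (\<Sum>d<Suc N. psize (C d))" using assms by (simp add: chains_def)
  also have "\<dots> = psize (C 0) + tail_size N C" unfolding tail_size_def by (rule sum.lessThan_Suc_shift)
  also have "(\<Sum>p\<in>?g ` ?V. case p of (i, j) \<Rightarrow> glue (C, C') i j) = (\<Sum>(d, i)\<in>?V. C' (Suc d) i)"
    by (subst sum.reindex[OF inj(2)]) (auto simp: glue_def intro!: sum.cong)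
  also have "\<dots> = tail_size N C'"
    using chains_fin_supp[OF assms(2)] unfolding tail_size_def
    by (subst sum.Sigma[symmetric]) (auto simp: psize_def fin_supp_def)
  finally show "pp_size (glue (C, C')) = psize (C 0) + tail_size N C + tail_size N C'" .
qed

lemma pp_trace_glue: "pp_trace (glue (C, C')) = psize (C 0)"
  by (simp add: pp_trace_def psize_def glue_def)

text \<open>Interlacing of neighbouring diagonals is monotonicity along rows and columns: above the
  main diagonal one of the two inequalities compares neighbours in a row and the other neighbours in
  a column, and below it the roles are exchanged.\<close>

lemma bij_betw_glue:
  "bij_betw glue {(C, C'). C \<in> chains N \<and> C' \<in> chains N \<and> C 0 = C' 0} (banded_pps N)"
proof (rule bij_betw_byWitness[where f' = "\<lambda>\<pi>. (\<lambda>d i. \<pi> i (i + d), \<lambda>d i. \<pi> (i + d) i)"])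
  show "\<forall>p\<in>{(C, C'). C \<in> chains N \<and> C' \<in> chains N \<and> C 0 = C' 0}.
       (\<lambda>d i. glue p i (i + d), \<lambda>d i. glue p (i + d) i) = p"
    by (auto simp: glue_def fun_eq_iff)
  show "\<forall>\<pi>\<in>banded_pps N. glue (\<lambda>d i. \<pi> i (i + d), \<lambda>d i. \<pi> (i + d) i) = \<pi>"
    by (auto simp: glue_def fun_eq_iff)
  show "glue ` {(C, C'). C \<in> chains N \<and> C' \<in> chains N \<and> C 0 = C' 0} \<subseteq> banded_pps N"
  proof clarify
    fix C C' assume C: "C \<in> chains N" "C' \<in> chains N" "C 0 = C' 0"
    have c: "C (Suc d) i \<le> C d i" "C d (Suc i) \<le> C (Suc d) i" for d i
      using C by (auto simp: chains_def interlaces_def)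
    have c': "C' (Suc d) i \<le> C' d i" "C' d (Suc i) \<le> C' (Suc d) i" for d i
      using C by (auto simp: chains_def interlaces_def)
    have "glue (C, C') (Suc i) j \<le> glue (C, C') i j \<and> glue (C, C') i (Suc j) \<le> glue (C, C') i j" for i j
    proof -
      consider "i < j" | "i = j" | "i > j" by linarith
      then show ?thesis
      proof cases
        case 1
        then obtain d where d: "j = i + Suc d" using less_imp_Suc_add by auto
        then have "j - i = Suc d" "j - Suc i = d" "Suc j - i = Suc (Suc d)" by auto
        then show ?thesis using 1 c[of d i] c[of "Suc d" i] by (simp add: glue_def)
      next
        case 2 then show ?thesis using c[of 0 i] c'[of 0 i] C by (simp add: glue_def)
      next
        case 3
        then obtain d where d: "i = j + Suc d" using less_imp_Suc_add by auto
        then have "i - j = Suc d" "i - Suc j = d" "Suc i - j = Suc (Suc d)" by auto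
        then show ?thesis using d c'[of d j] c'[of "Suc d" j] C(3) by (auto simp: glue_def)
      qed
    qed
    moreover have "d \<ge> N \<Longrightarrow> glue (C, C') i (i + d) = 0 \<and> glue (C, C') (i + d) i = 0" for i d
      using C by (auto simp: glue_def chains_def)
    ultimately show "glue (C, C') \<in> banded_pps N"
      using glue_support(1)[OF C(1,2)] by (auto simp: banded_pps_def plane_partition_def pp_size_def)
  qed
  show "(\<lambda>\<pi>. (\<lambda>d i. \<pi> i (i + d), \<lambda>d i. \<pi> (i + d) i)) ` banded_pps N \<subseteq>
    {(C, C'). C \<in> chains N \<and> C' \<in> chains N \<and> C 0 = C' 0}"
    by (auto simp: banded_pps_def plane_partition_def chains_def interlaces_def fun_eq_iff)
qed

text \<open>The main diagonal carries \<open>x\<close> from the trace and \<open>u\<close> from the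
  size, so the Cauchy identity is used with \<open>y = x * u\<close>; this is the 1 in the exponent
  \<open>i + j + 1\<close>. As \<open>N\<close> grows, the exponent \<open>m\<close> is attained by
  exactly \<open>m\<close> pairs, which gives the factor with multiplicity \<open>m\<close>.\<close>

lemma banded_pps_gf:
  "(\<integral>\<^sup>+\<pi>. of_bool (\<pi> \<in> banded_pps N) * (x ^ pp_trace \<pi> * u ^ pp_size \<pi>) \<partial>count_space UNIV) =
   (\<Prod>j<N. \<Prod>i<N. geom (x * u ^ (i + j + 1)))"
proof -
  let ?P = "{(C, C'). C \<in> chains N \<and> C' \<in> chains N \<and> C 0 = C' 0}"
  have "(\<integral>\<^sup>+\<pi>. of_bool (\<pi> \<in> banded_pps N) * (x ^ pp_trace \<pi> * u ^ pp_size \<pi>) \<partial>count_space UNIV) =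
     (\<integral>\<^sup>+\<pi>. x ^ pp_trace \<pi> * u ^ pp_size \<pi> \<partial>count_space (banded_pps N))"
    by (subst nn_integral_count_space_indicator) (auto intro!: nn_integral_cong simp: indicator_def mult.commute)
  also have "\<dots> = (\<integral>\<^sup>+p. x ^ pp_trace (glue p) * u ^ pp_size (glue p) \<partial>count_space ?P)"
    by (rule nn_integral_bij_count_space[OF bij_betw_glue, symmetric])
  also have "\<dots> = (\<integral>\<^sup>+p. of_bool (p \<in> ?P) * (x ^ pp_trace (glue p) * u ^ pp_size (glue p)) \<partial>count_space UNIV)"
    by (subst nn_integral_count_space_indicator) (auto intro!: nn_integral_cong simp: indicator_def mult.commute)
  also have "\<dots> = (\<integral>\<^sup>+C. \<integral>\<^sup>+C'. of_bool ((C, C') \<in> ?P) * (x ^ pp_trace (glue (C, C')) * u ^ pp_size (glue (C, C')))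
       \<partial>count_space UNIV \<partial>count_space UNIV)"
    by (subst nn_integral_fst_count_space[symmetric]) simp
  also have "\<dots> = (\<integral>\<^sup>+C. \<integral>\<^sup>+C'. of_bool (C \<in> chains N) * (x * u) ^ psize (C 0) * u ^ tail_size N C *
      (of_bool (C' \<in> chains N \<and> C' 0 = C 0) * u ^ tail_size N C') \<partial>count_space UNIV \<partial>count_space UNIV)"
    by (intro nn_integral_cong)
       (auto simp: pp_trace_glue glue_support power_mult_distrib power_add mult_ac of_bool_def)
  also have "\<dots> = (\<integral>\<^sup>+C. of_bool (C \<in> chains N) * (x * u) ^ psize (C 0) * u ^ tail_size N C *
      chain_gf u N (C 0) \<partial>count_space UNIV)"
    by (simp add: nn_integral_cmult chain_gf_eq)
  also have "\<dots> = (\<integral>\<^sup>+C. \<integral>\<^sup>+l. of_bool (C \<in> chains N \<and> C 0 = l) * u ^ tail_size N C *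
      ((x * u) ^ psize l * chain_gf u N l) \<partial>count_space UNIV \<partial>count_space UNIV)"
  proof (rule nn_integral_cong)
    fix C :: "nat \<Rightarrow> nat \<Rightarrow> nat"
    show "of_bool (C \<in> chains N) * (x * u) ^ psize (C 0) * u ^ tail_size N C * chain_gf u N (C 0) =
       (\<integral>\<^sup>+l. of_bool (C \<in> chains N \<and> C 0 = l) * u ^ tail_size N C * ((x * u) ^ psize l * chain_gf u N l) \<partial>count_space UNIV)"
      by (subst nn_integral_count_space_singleton[where a = "C 0"]) (auto simp: mult_ac)
  qed
  also have "\<dots> = (\<integral>\<^sup>+l. \<integral>\<^sup>+C. of_bool (C \<in> chains N \<and> C 0 = l) * u ^ tail_size N C *
      ((x * u) ^ psize l * chain_gf u N l) \<partial>count_space UNIV \<partial>count_space UNIV)"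
    by (rule nn_integral_count_space_swap)
  also have "\<dots> = (\<integral>\<^sup>+l. (x * u) ^ psize l * chain_gf u N l * chain_gf u N l \<partial>count_space UNIV)"
    by (subst nn_integral_multc, simp, simp only: chain_gf_eq[symmetric]) (simp add: mult_ac)
  also have "\<dots> = (\<Prod>j<N. \<Prod>i<N. geom (x * u * u ^ (i + j)))" by (rule chain_gf_Cauchy)
  finally show ?thesis by (simp add: mult_ac)
qed

text \<open>Monotone convergence, since a finitely supported array lies in
  \<open>banded_pps N\<close> for all large \<open>N\<close>.\<close>

lemma plane_partitions_gf_LIMSEQ:
  "(\<lambda>N. \<Prod>j<N. \<Prod>i<N. geom (x * u ^ (i + j + 1))) \<longlonglongrightarrow>
   (\<integral>\<^sup>+\<pi>. of_bool (plane_partition \<pi> (pp_size \<pi>)) * (x ^ pp_trace \<pi> * u ^ pp_size \<pi>) \<partial>count_space UNIV)"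
proof -
  have mono: "banded_pps N \<subseteq> banded_pps M" if "N \<le> M" for N M
    using that by (auto simp: banded_pps_def)
  have ex: "\<exists>N. \<pi> \<in> banded_pps N" if pp: "plane_partition \<pi> (pp_size \<pi>)" for \<pi>
  proof -
    have "finite {(i, j). \<pi> i j \<noteq> 0}" using pp by (simp add: plane_partition_def)
    then have "finite ((\<lambda>(i, j). i + j) ` {(i, j). \<pi> i j \<noteq> 0})" by simp
    then obtain N where "(\<lambda>(i, j). i + j) ` {(i, j). \<pi> i j \<noteq> 0} \<subseteq> {..<N}"
      using finite_nat_bounded by blast
    then have N: "\<pi> i j \<noteq> 0 \<Longrightarrow> i + j < N" for i j by force
    have "\<pi> \<in> banded_pps N"
      using pp N[of _ "_ + _"] N[of "_ + _"] by (force simp: banded_pps_def)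
    then show ?thesis ..
  qed
  have "(\<lambda>N. \<integral>\<^sup>+\<pi>. of_bool (\<pi> \<in> banded_pps N) * (x ^ pp_trace \<pi> * u ^ pp_size \<pi>) \<partial>count_space UNIV) \<longlonglongrightarrow>
    (\<integral>\<^sup>+\<pi>. of_bool (plane_partition \<pi> (pp_size \<pi>)) * (x ^ pp_trace \<pi> * u ^ pp_size \<pi>) \<partial>count_space UNIV)"
  proof (rule nn_integral_LIMSEQ)
    show "incseq (\<lambda>N \<pi>. of_bool (\<pi> \<in> banded_pps N) * (x ^ pp_trace \<pi> * u ^ pp_size \<pi>))"
      using mono by (auto simp: incseq_def le_fun_def of_bool_def)
    fix \<pi>
    show "(\<lambda>N. of_bool (\<pi> \<in> banded_pps N) * (x ^ pp_trace \<pi> * u ^ pp_size \<pi>)) \<longlonglongrightarrow>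
       of_bool (plane_partition \<pi> (pp_size \<pi>)) * (x ^ pp_trace \<pi> * u ^ pp_size \<pi>)"
    proof (cases "plane_partition \<pi> (pp_size \<pi>)")
      case True
      then obtain N where "\<pi> \<in> banded_pps N" using ex by blast
      then have "eventually (\<lambda>M. of_bool (\<pi> \<in> banded_pps M) * (x ^ pp_trace \<pi> * u ^ pp_size \<pi>) =
         of_bool (plane_partition \<pi> (pp_size \<pi>)) * (x ^ pp_trace \<pi> * u ^ pp_size \<pi>)) sequentially"
        using mono True unfolding eventually_sequentially by (intro exI[of _ N]) auto
      then show ?thesis by (rule tendsto_eventually)
    qed (simp add: banded_pps_def)
  qed simp
  then show ?thesis by (simp add: banded_pps_gf)
qed

section \<open>The logarithm of the product\<close>

text \<open>The logarithm of the product, after each factor is expanded in powers of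
  \<open>x\<close> and \<open>m * u^(m k)\<close> is summed over \<open>m\<close>. Taking the series
  as the definition fixes the branch and covers real and complex arguments at once.\<close>

definition pp_log :: "'a::{real_normed_field,banach} \<Rightarrow> 'a \<Rightarrow> 'a" where
  "pp_log x u = (\<Sum>k. x ^ Suc k / of_nat (Suc k) * (u ^ Suc k / (1 - u ^ Suc k)\<^sup>2))"

lemma geom_ennreal:
  assumes "0 \<le> b" "b < 1" shows "geom (ennreal b) = ennreal (1 / (1 - b))"
proof -
  have "(\<lambda>m. b ^ m) sums (1 / (1 - b))" using geometric_sums[of b] assms by simp
  then have "(\<lambda>m. ennreal (b ^ m)) sums ennreal (1 / (1 - b))" using assms by (subst sums_ennreal) auto
  then have "(\<lambda>m. ennreal b ^ m) sums ennreal (1 / (1 - b))" using assms by (simp only: ennreal_power)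
  then show ?thesis unfolding geom_def by (rule sums_unique[symmetric])
qed

lemma power_double_sum:
  fixes x u :: real
  shows "(\<Sum>j<N. \<Sum>i<N. (x * u ^ (i + j + 1)) ^ K) = x ^ K * (u ^ K * (\<Sum>i<N. (u ^ K) ^ i)\<^sup>2)"
proof -
  have "(\<Sum>j<N. \<Sum>i<N. (x * u ^ (i + j + 1)) ^ K) = (\<Sum>j<N. \<Sum>i<N. x ^ K * u ^ K * ((u ^ K) ^ i * (u ^ K) ^ j))"
    by (intro sum.cong refl) (simp add: power_mult_distrib power_mult[symmetric] power_add[symmetric] algebra_simps)
  also have "\<dots> = x ^ K * (u ^ K * (\<Sum>i<N. (u ^ K) ^ i)\<^sup>2)"
    by (simp add: power2_eq_square sum_product sum_distrib_left mult_ac)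
  finally show ?thesis .
qed

text \<open>The logarithm of the finite product is the same series with a partial geometric sum in
  \<open>u ^ Suc k\<close> instead of \<open>1 / (1 - u ^ Suc k)\<close>. Tannery's theorem passes
  to the limit under the sum.\<close>

lemma product_LIMSEQ_exp_pp_log:
  fixes x u :: real
  assumes x: "0 < x" "x < 1" and u: "0 < u" "u < 1"
  shows "(\<lambda>N. \<Prod>j<N. \<Prod>i<N. 1 / (1 - x * u ^ (i + j + 1))) \<longlonglongrightarrow> exp (pp_log x u)"
proof -
  have b: "0 < x * u ^ n" "x * u ^ n < 1" for n
  proof -
    show "0 < x * u ^ n" using x u by simp
    have "x * u ^ n \<le> x" using x u by (simp add: mult_left_le power_le_one)
    then show "x * u ^ n < 1" using x by linarith
  qed
  let ?a = "\<lambda>k N. x ^ Suc k / real (Suc k) * (u ^ Suc k * (\<Sum>i<N. (u ^ Suc k) ^ i)\<^sup>2)"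
  have eq: "(\<Prod>j<N. \<Prod>i<N. 1 / (1 - x * u ^ (i + j + 1))) = exp (\<Sum>k. ?a k N)" for N
  proof -
    have ln: "(\<lambda>k. (x * u ^ n) ^ Suc k / real (Suc k)) sums (- ln (1 - x * u ^ n))" for n
    proof -
      have "(\<lambda>k. - ((x * u ^ n) ^ k) / real k) sums ln (1 - x * u ^ n)"
        using ln_series'[of "- (x * u ^ n)"] b[of n] by simp
      then have "(\<lambda>k. - ((x * u ^ n) ^ Suc k) / real (Suc k)) sums ln (1 - x * u ^ n)"
        using sums_Suc_iff[of "\<lambda>k. - ((x * u ^ n) ^ k) / real k" "ln (1 - x * u ^ n)"] by simp
      from sums_minus[OF this] show ?thesis by simp
    qed
    have "(\<lambda>k. \<Sum>j<N. \<Sum>i<N. (x * u ^ (i + j + 1)) ^ Suc k / real (Suc k)) sums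
       (\<Sum>j<N. \<Sum>i<N. - ln (1 - x * u ^ (i + j + 1)))"
      by (intro sums_sum ln)
    moreover have "(\<Sum>j<N. \<Sum>i<N. (x * u ^ (i + j + 1)) ^ Suc k / real (Suc k)) = ?a k N" for k
      using power_double_sum[of x u "Suc k" N] by (simp only: sum_divide_distrib[symmetric]) simp
    ultimately have "(\<Sum>k. ?a k N) = (\<Sum>j<N. \<Sum>i<N. - ln (1 - x * u ^ (i + j + 1)))"
      by (simp add: sums_iff)
    then have "exp (\<Sum>k. ?a k N) = (\<Prod>j<N. \<Prod>i<N. exp (- ln (1 - x * u ^ (i + j + 1))))"
      by (simp add: exp_sum)
    also have "\<dots> = (\<Prod>j<N. \<Prod>i<N. 1 / (1 - x * u ^ (i + j + 1)))"
    proof (intro prod.cong refl)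
      fix i j
      show "exp (- ln (1 - x * u ^ (i + j + 1))) = 1 / (1 - x * u ^ (i + j + 1))"
        using b(2)[of "i + j + 1"] by (simp add: exp_minus inverse_eq_divide)
    qed
    finally show ?thesis by simp
  qed
  have v: "0 < u ^ Suc k" "u ^ Suc k \<le> u" "u ^ Suc k < 1" for k
  proof -
    show "0 < u ^ Suc k" "u ^ Suc k \<le> u" using u by (auto simp: power_le_one mult_left_le)
    then show "u ^ Suc k < 1" using u by linarith
  qed
  \<comment> \<open>The majorant bounds every partial geometric sum in \<open>u ^ Suc k\<close> by
    the full one in \<open>u\<close>, so that it depends on \<open>k\<close> only through
    \<open>x ^ Suc k\<close>.\<close>
  have "(\<lambda>N. \<Sum>k. ?a k N) \<longlonglongrightarrow> (\<Sum>k. x ^ Suc k / real (Suc k) * (u ^ Suc k * (1 / (1 - u ^ Suc k))\<^sup>2))"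
  proof (rule conjunct2[OF conjunct2[OF tannerys_theorem[where M = "\<lambda>k. x ^ Suc k * (1 / (1 - u))\<^sup>2"]]])
    show "(\<lambda>N. ?a k N) \<longlonglongrightarrow> x ^ Suc k / real (Suc k) * (u ^ Suc k * (1 / (1 - u ^ Suc k))\<^sup>2)" for k
      using geometric_sums[of "u ^ Suc k"] v[of k] unfolding sums_def
      by (intro tendsto_intros) (auto simp del: power_Suc)
    show "summable (\<lambda>k. x ^ Suc k * (1 / (1 - u))\<^sup>2)"
      using x by (intro summable_mult2) (simp add: summable_mult summable_geometric)
    have "norm (?a k N) \<le> x ^ Suc k * (1 / (1 - u))\<^sup>2" for k N
    proof -
      have s: "(\<Sum>i<N. (u ^ Suc k) ^ i) \<le> 1 / (1 - u)"
      proof -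
        have "(\<Sum>i<N. (u ^ Suc k) ^ i) \<le> (\<Sum>i<N. u ^ i)" using v u by (intro sum_mono power_mono) (auto simp: less_imp_le)
        also have "\<dots> \<le> 1 / (1 - u)" using u geometric_sums[of u]
          by (subst suminf_geometric[symmetric]) (auto intro!: sum_le_suminf simp: summable_geometric)
        finally show ?thesis .
      qed
      have "norm (?a k N) = x ^ Suc k / real (Suc k) * (u ^ Suc k * (\<Sum>i<N. (u ^ Suc k) ^ i)\<^sup>2)"
        unfolding real_norm_def using x u
        by (intro abs_of_nonneg mult_nonneg_nonneg divide_nonneg_nonneg zero_le_power zero_le_power2) auto
      also have "\<dots> \<le> x ^ Suc k * (1 * (1 / (1 - u))\<^sup>2)"
      proof (intro mult_mono power_mono s)
        show "x ^ Suc k / real (Suc k) \<le> x ^ Suc k" using x by (simp add: field_simps)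
      qed (use x u v in \<open>auto intro!: sum_nonneg simp: less_imp_le simp del: power_Suc\<close>)
      finally show ?thesis by simp
    qed
    then show "\<forall>\<^sub>F (k, N) in at_top \<times>\<^sub>F at_top. norm (?a k N) \<le> x ^ Suc k * (1 / (1 - u))\<^sup>2"
      by (intro always_eventually) auto
  qed auto
  then have "(\<lambda>N. \<Sum>k. ?a k N) \<longlonglongrightarrow> pp_log x u"
    by (simp add: pp_log_def power_divide)
  then show ?thesis unfolding eq by (intro tendsto_exp)
qed

lemma plane_partitions_gf_ennreal:
  fixes x u :: real
  assumes x: "0 < x" "x < 1" and u: "0 < u" "u < 1"
  shows "(\<integral>\<^sup>+\<pi>. of_bool (plane_partition \<pi> (pp_size \<pi>)) * (ennreal x ^ pp_trace \<pi> * ennreal u ^ pp_size \<pi>) \<partial>count_space UNIV)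
    = ennreal (exp (pp_log x u))"
proof (rule LIMSEQ_unique[OF plane_partitions_gf_LIMSEQ])
  have b: "0 < x * u ^ n" "x * u ^ n < 1" for n
  proof -
    show "0 < x * u ^ n" using x u by simp
    have "x * u ^ n \<le> x" using x u by (simp add: mult_left_le power_le_one)
    then show "x * u ^ n < 1" using x by linarith
  qed
  have "(\<Prod>j<N. \<Prod>i<N. geom (ennreal x * ennreal u ^ (i + j + 1))) = ennreal (\<Prod>j<N. \<Prod>i<N. 1 / (1 - x * u ^ (i + j + 1)))" for N
  proof -
    have "geom (ennreal x * ennreal u ^ (i + j + 1)) = ennreal (1 / (1 - x * u ^ (i + j + 1)))" for i j
      using x u b[of "i + j + 1"] by (simp add: ennreal_power ennreal_mult[symmetric] geom_ennreal del: power_Suc)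
    moreover have "0 \<le> 1 / (1 - x * u ^ (i + j + 1))" for i j using b(2)[of "i + j + 1"] by simp
    ultimately show ?thesis by (simp add: prod_ennreal prod_nonneg del: power_Suc)
  qed
  then show "(\<lambda>N. \<Prod>j<N. \<Prod>i<N. geom (ennreal x * ennreal u ^ (i + j + 1))) \<longlonglongrightarrow> ennreal (exp (pp_log x u))"
    using product_LIMSEQ_exp_pp_log[OF assms] by simp
qed

section \<open>From the sum over arrays to the numbers \<open>pp\<close>\<close>

lemma plane_partition_iff: "plane_partition \<pi> n \<longleftrightarrow> plane_partition \<pi> (pp_size \<pi>) \<and> n = pp_size \<pi>"
proof -
  have "plane_partition \<pi> n \<Longrightarrow> pp_size \<pi> = n"
    unfolding plane_partition_def pp_size_def by (elim conjE)
  then show ?thesis by blast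
qed

text \<open>Summation over the fibres of \<open>g\<close>. A fibre may still be infinite at this
  stage, hence \<open>emeasure\<close> and not \<open>card\<close>.\<close>

lemma nn_integral_count_space_group:
  "(\<integral>\<^sup>+z. of_bool (P z) * f (g z) \<partial>count_space UNIV) =
   (\<integral>\<^sup>+p. emeasure (count_space UNIV) {z. P z \<and> g z = p} * f p \<partial>count_space UNIV)"
proof -
  have "(\<integral>\<^sup>+p. emeasure (count_space UNIV) {z. P z \<and> g z = p} * f p \<partial>count_space UNIV) =
    (\<integral>\<^sup>+p. \<integral>\<^sup>+z. indicator {z. P z \<and> g z = p} z * f p \<partial>count_space UNIV \<partial>count_space UNIV)"
    by (simp add: nn_integral_multc)
  also have "\<dots> = (\<integral>\<^sup>+z. \<integral>\<^sup>+p. indicator {z. P z \<and> g z = p} z * f p \<partial>count_space UNIV \<partial>count_space UNIV)"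
    by (rule nn_integral_count_space_swap)
  also have "\<dots> = (\<integral>\<^sup>+z. of_bool (P z) * f (g z) \<partial>count_space UNIV)"
  proof (rule nn_integral_cong)
    fix z
    show "(\<integral>\<^sup>+p. indicator {z. P z \<and> g z = p} z * f p \<partial>count_space UNIV) = of_bool (P z) * f (g z)"
      by (subst nn_integral_count_space_singleton[where a = "g z"]) auto
  qed
  finally show ?thesis by simp
qed

lemma pp_gf_ennreal:
  fixes x u :: real
  assumes x: "0 < x" "x < 1" and u: "0 < u" "u < 1"
  shows "(\<integral>\<^sup>+p. ennreal (real (pp (fst p) (snd p)) * x ^ fst p * u ^ snd p) \<partial>count_space UNIV) = ennreal (exp (pp_log x u))"
proof -
  define S where "S p = {\<pi>. plane_partition \<pi> (snd p) \<and> pp_trace \<pi> = fst p}" for p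
  define w where "w p = ennreal x ^ fst p * ennreal u ^ snd p" for p :: "nat \<times> nat"
  have S: "S p = {\<pi>. plane_partition \<pi> (pp_size \<pi>) \<and> (pp_trace \<pi>, pp_size \<pi>) = p}" for p
    unfolding S_def
  proof (rule Collect_cong)
    fix \<pi>
    show "plane_partition \<pi> (snd p) \<and> pp_trace \<pi> = fst p \<longleftrightarrow>
        plane_partition \<pi> (pp_size \<pi>) \<and> (pp_trace \<pi>, pp_size \<pi>) = p"
      using plane_partition_iff[of \<pi> "snd p"] by (cases p) auto
  qed
  have eq: "(\<integral>\<^sup>+p. emeasure (count_space UNIV) (S p) * w p \<partial>count_space UNIV) = ennreal (exp (pp_log x u))"
    using nn_integral_count_space_group[of "\<lambda>\<pi>. plane_partition \<pi> (pp_size \<pi>)" w "\<lambda>\<pi>. (pp_trace \<pi>, pp_size \<pi>)"]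
      plane_partitions_gf_ennreal[OF assms] unfolding S by (simp add: w_def)
  \<comment> \<open>\<open>pp\<close> is a \<open>card\<close>, which is 0 on infinite sets, so
    finiteness must be known before the two can be identified. It comes from the total: an infinite
    fibre with its positive weight would make the sum infinite.\<close>
  have fin: "finite (S p)" for p
  proof (rule ccontr)
    assume inf: "infinite (S p)"
    have "emeasure (count_space UNIV) (S p) * w p \<le> ennreal (exp (pp_log x u))"
      unfolding eq[symmetric]
      by (rule nn_integral_ge_point[of p UNIV "\<lambda>p. emeasure (count_space UNIV) (S p) * w p"]) simp
    moreover have "w p \<noteq> 0" using x u by (simp add: w_def)
    ultimately show False using inf by (simp add: ennreal_top_mult top_unique)
  qed
  have "emeasure (count_space UNIV) (S p) * w p = ennreal (real (pp (fst p) (snd p)) * x ^ fst p * u ^ snd p)" for p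
    using fin[of p] x u
    by (simp add: pp_def S_def w_def emeasure_count_space ennreal_mult ennreal_power ennreal_of_nat_eq_real_of_nat mult.assoc)
  then show ?thesis using eq by simp
qed

lemma pp_gf_real:
  fixes x u :: real
  assumes x: "0 < x" "x < 1" and u: "0 < u" "u < 1"
  shows "((\<lambda>(k, n). real (pp k n) * x ^ k * u ^ n) has_sum exp (pp_log x u)) UNIV"
proof -
  let ?f = "\<lambda>p. real (pp (fst p) (snd p)) * x ^ fst p * u ^ snd p"
  have "has_bochner_integral (count_space UNIV) ?f (exp (pp_log x u))"
    using x u pp_gf_ennreal[OF assms] by (intro has_bochner_integral_nn_integral) auto
  then have "Infinite_Set_Sum.abs_summable_on ?f UNIV" "infsetsum ?f UNIV = exp (pp_log x u)"
    by (auto simp: Infinite_Set_Sum.abs_summable_on_def infsetsum_def has_bochner_integral_iff)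
  moreover from this have "?f summable_on UNIV"
    using abs_summable_equivalent[of ?f UNIV] by (blast intro: abs_summable_summable)
  ultimately have "(?f has_sum exp (pp_log x u)) UNIV"
    using has_sum_infsum[of ?f UNIV] infsetsum_infsum[of ?f UNIV] by simp
  then show ?thesis by (simp add: case_prod_unfold)
qed

section \<open>Extension of the generating function to complex arguments\<close>

lemma pp_log_summable:
  fixes x u :: complex
  assumes "norm x < 1" "norm u < 1"
  shows "summable (\<lambda>k. norm (x ^ Suc k / of_nat (Suc k) * (u ^ Suc k / (1 - u ^ Suc k)\<^sup>2)))"
    and "norm (x ^ Suc k / of_nat (Suc k) * (u ^ Suc k / (1 - u ^ Suc k)\<^sup>2)) \<le> norm x ^ Suc k * (1 / (1 - norm u))\<^sup>2"
proof -
  show le: "norm (x ^ Suc k / of_nat (Suc k) * (u ^ Suc k / (1 - u ^ Suc k)\<^sup>2)) \<le> norm x ^ Suc k * (1 / (1 - norm u))\<^sup>2" for k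
  proof -
    have v: "norm (u ^ Suc k) \<le> norm u"
      using assms(2) by (simp add: norm_mult norm_power mult_left_le power_le_one)
    have "norm (u ^ Suc k / (1 - u ^ Suc k)\<^sup>2) \<le> 1 / (1 - norm u)\<^sup>2"
      unfolding norm_divide
    proof (rule frac_le)
      show "norm (u ^ Suc k) \<le> 1" using v assms by linarith
      have "1 - norm u \<le> norm (1 - u ^ Suc k)" using v norm_triangle_ineq2[of 1 "u ^ Suc k"] by simp
      then show "(1 - norm u)\<^sup>2 \<le> norm ((1 - u ^ Suc k)\<^sup>2)"
        unfolding norm_power by (intro power_mono) (use assms in auto)
    qed (use assms in auto)
    moreover have "norm (x ^ Suc k / of_nat (Suc k)) \<le> norm x ^ Suc k"
    proof -
      have "a / real (Suc k) \<le> a" if "a \<ge> 0" for a :: real using that by (simp add: field_simps)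
      then show ?thesis unfolding norm_divide norm_power norm_of_nat by simp
    qed
    ultimately show ?thesis unfolding norm_mult power_divide by (intro mult_mono) auto
  qed
  show "summable (\<lambda>k. norm (x ^ Suc k / of_nat (Suc k) * (u ^ Suc k / (1 - u ^ Suc k)\<^sup>2)))"
  proof (rule summable_comparison_test'[where N = 0])
    show "summable (\<lambda>k. norm x ^ Suc k * (1 / (1 - norm u))\<^sup>2)"
      using assms by (intro summable_mult2) (simp add: summable_mult summable_geometric)
  qed (use le in auto)
qed

lemma pp_log_of_real:
  fixes x u :: real assumes "\<bar>x\<bar> < 1" "\<bar>u\<bar> < 1"
  shows "pp_log (complex_of_real x) (complex_of_real u) = complex_of_real (pp_log x u)"
proof -
  let ?f = "\<lambda>k. x ^ Suc k / real (Suc k) * (u ^ Suc k / (1 - u ^ Suc k)\<^sup>2)"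
  have eq: "complex_of_real x ^ Suc k / of_nat (Suc k) * (complex_of_real u ^ Suc k / (1 - complex_of_real u ^ Suc k)\<^sup>2) =
     complex_of_real (?f k)" for k by simp
  have "summable (\<lambda>k. norm (complex_of_real (?f k)))"
    using pp_log_summable(1)[of "complex_of_real x" "complex_of_real u"] assms unfolding eq by simp
  then have "summable ?f" unfolding norm_of_real by (rule summable_rabs_cancel)
  then show ?thesis unfolding pp_log_def eq by (rule suminf_of_real[symmetric])
qed

lemma pp_log_holomorphic_1:
  assumes "norm u < 1" shows "(\<lambda>x. pp_log x u) holomorphic_on ball (0::complex) 1"
proof (rule power_series_holomorphic)
  fix x :: complex assume "x \<in> ball 0 1"
  then have "norm x < 1" by simp
  let ?a = "\<lambda>n. (u ^ n / (1 - u ^ n)\<^sup>2) / of_nat n"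
  have "(\<lambda>k. x ^ Suc k / of_nat (Suc k) * (u ^ Suc k / (1 - u ^ Suc k)\<^sup>2)) sums pp_log x u"
    unfolding pp_log_def
    using pp_log_summable(1)[OF \<open>norm x < 1\<close> assms] by (rule summable_sums[OF summable_norm_cancel])
  then have "(\<lambda>k. ?a (Suc k) * (x - 0) ^ Suc k) sums pp_log x u"
    by (simp add: mult_ac)
  then show "(\<lambda>n. ?a n * (x - 0) ^ n) sums pp_log x u"
    using sums_Suc_iff[of "\<lambda>n. ?a n * (x - 0) ^ n" "pp_log x u"] by simp
qed

lemma pp_log_holomorphic_2:
  assumes "norm x < 1" shows "(\<lambda>u. pp_log x u) holomorphic_on ball (0::complex) 1"
proof (rule holomorphic_uniform_sequence)
  let ?f = "\<lambda>k u. x ^ Suc k / of_nat (Suc k) * (u ^ Suc k / (1 - u ^ Suc k)\<^sup>2)"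
  show "(\<lambda>u. \<Sum>k<n. ?f k u) holomorphic_on ball 0 1" for n
  proof (intro holomorphic_intros)
    fix k and u :: complex assume "u \<in> ball 0 1"
    then have "norm (u ^ Suc k) < 1" unfolding norm_power by (subst power_less_one_iff) auto
    then show "(1 - u ^ Suc k)\<^sup>2 \<noteq> 0" by auto
  qed
  fix u :: complex assume "u \<in> ball 0 1"
  then have u: "norm u < 1" by simp
  define d where "d = (1 - norm u) / 2"
  have d0: "d > 0" using u by (simp add: d_def)
  have d: "norm v \<le> norm u + d" if "v \<in> cball u d" for v
  proof -
    have "norm (v - u) \<le> d" using that by (simp add: dist_norm norm_minus_commute)
    then show ?thesis using norm_triangle_ineq2[of v u] by linarith
  qed
  have ud: "norm u + d < 1" using u by (simp add: d_def field_simps)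
  have "uniform_limit (cball u d) (\<lambda>n v. \<Sum>k<n. ?f k v) (\<lambda>v. \<Sum>k. ?f k v) sequentially"
  proof (rule Weierstrass_m_test)
    show "summable (\<lambda>k. norm x ^ Suc k * (1 / (1 - (norm u + d)))\<^sup>2)"
      using assms by (intro summable_mult2) (simp add: summable_mult summable_geometric)
    fix k v assume v: "v \<in> cball u d"
    then have "norm v < 1" using d[of v] ud by linarith
    then have "norm (?f k v) \<le> norm x ^ Suc k * (1 / (1 - norm v))\<^sup>2"
      using pp_log_summable(2) assms by blast
    also have "\<dots> \<le> norm x ^ Suc k * (1 / (1 - (norm u + d)))\<^sup>2"
      using d[OF v] ud by (intro mult_left_mono power_mono frac_le) auto
    finally show "norm (?f k v) \<le> norm x ^ Suc k * (1 / (1 - (norm u + d)))\<^sup>2" .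
  qed
  moreover have "v \<in> ball 0 1" if "v \<in> cball u d" for v
    using d[OF that] ud by simp
  ultimately show "\<exists>d>0. cball u d \<subseteq> ball 0 1 \<and> uniform_limit (cball u d) (\<lambda>n v. \<Sum>k<n. ?f k v) (pp_log x) sequentially"
    using d0 unfolding pp_log_def[abs_def] by (intro exI[of _ d] conjI subsetI)
qed simp

text \<open>The coefficients are nonnegative, so the real identity at the larger arguments
  \<open>y\<close> and \<open>v\<close> dominates all terms. The maximum with 1/2 keeps both
  positive, as that identity requires.\<close>

lemma pp_abs_summable:
  fixes x u :: complex assumes "norm x < 1" "norm u < 1"
  shows "(\<lambda>(k, n). of_nat (pp k n) * x ^ k * u ^ n) summable_on UNIV"
proof -
  define y v where "y = max (norm x) (1/2)" and "v = max (norm u) (1/2)"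
  have yv: "0 < y" "y < 1" "0 < v" "v < 1" "norm x \<le> y" "norm u \<le> v" using assms by (auto simp: y_def v_def)
  have "(\<lambda>(k, n). real (pp k n) * y ^ k * v ^ n) summable_on UNIV"
    using pp_gf_real[OF yv(1-4)] by (rule has_sum_imp_summable)
  then have "(\<lambda>p. norm (case p of (k, n) \<Rightarrow> of_nat (pp k n) * x ^ k * u ^ n)) summable_on UNIV"
    by (rule Infinite_Sum.abs_summable_on_comparison_test')
       (use yv in \<open>auto simp: norm_mult norm_power intro!: mult_mono power_mono\<close>)
  then show ?thesis by (rule abs_summable_summable)
qed

lemma islimpt_real_segment: "complex_of_real (1/2) islimpt (complex_of_real ` {0<..<1})"
proof -
  have "connected (complex_of_real ` {0<..<1})" by (intro connected_continuous_image continuous_intros) auto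
  moreover have "complex_of_real (1/2) \<in> complex_of_real ` {0<..<1}" by (intro imageI) auto
  moreover have "complex_of_real (1/3) \<in> complex_of_real ` {0<..<1}" by (intro imageI) auto
  moreover have "complex_of_real (1/2) \<noteq> complex_of_real (1/3)" unfolding of_real_eq_iff by simp
  ultimately show ?thesis by (metis connected_imp_perfect singletonD)
qed

text \<open>The identity theorem: the real segment has a limit point inside the disc.\<close>

lemma eq_on_disc_if_eq_on_reals:
  assumes "f holomorphic_on ball 0 1" "g holomorphic_on ball 0 1"
    and "\<And>r. 0 < r \<Longrightarrow> r < 1 \<Longrightarrow> f (complex_of_real r) = g (complex_of_real r)" and "norm z < 1"
  shows "f z = g z"
proof -
  have "f z - g z = 0"
  proof (rule analytic_continuation[where f = "\<lambda>z. f z - g z" and S = "ball 0 1" and U = "complex_of_real ` {0<..<1}" and \<xi> = "complex_of_real (1/2)"])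
    show "(\<lambda>z. f z - g z) holomorphic_on ball 0 1" by (intro holomorphic_intros assms)
    show "complex_of_real (1/2) islimpt complex_of_real ` {0<..<1}" by (rule islimpt_real_segment)
  qed (use assms in auto)
  then show ?thesis by simp
qed

text \<open>Continuation is done in one variable at a time: here in \<open>x\<close> with
  \<open>u\<close> real, and in \<open>pp_gf_complex\<close> in \<open>u\<close> with
  \<open>x\<close> complex.\<close>

lemma pp_gf_semi_complex:
  fixes x :: complex and u :: real
  assumes "norm x < 1" "0 < u" "u < 1"
  shows "(\<Sum>\<^sub>\<infinity>(k, n). of_nat (pp k n) * x ^ k * complex_of_real u ^ n) = exp (pp_log x (complex_of_real u))"
proof (rule eq_on_disc_if_eq_on_reals[OF _ _ _ assms(1)])
  let ?F = "\<lambda>x. \<Sum>\<^sub>\<infinity>(k, n). of_nat (pp k n) * x ^ k * complex_of_real u ^ n"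
  show "?F holomorphic_on ball 0 1"
  proof (rule power_series_holomorphic)
    fix x :: complex assume "x \<in> ball 0 1"
    then have x: "norm x < 1" by simp
    have S: "(\<lambda>(k, n). of_nat (pp k n) * x ^ k * complex_of_real u ^ n) summable_on UNIV \<times> UNIV" if "norm x < 1" for x
      using pp_abs_summable[OF that, of "complex_of_real u"] assms by simp
    have 1: "(\<lambda>n. of_nat (pp k n) * complex_of_real u ^ n) summable_on UNIV" for k
    proof -
      have "(\<lambda>n. of_nat (pp k n) * (1/2) ^ k * complex_of_real u ^ n) summable_on UNIV"
        using summable_on_SigmaD1[OF S[of "1/2"], of k] by simp
      then have "(\<lambda>n. 2 ^ k * (of_nat (pp k n) * (1/2) ^ k * complex_of_real u ^ n)) summable_on UNIV"
        by (rule summable_on_cmult_right)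
      then show ?thesis by (simp add: power_divide)
    qed
    have "((\<lambda>k. (\<Sum>\<^sub>\<infinity>n. of_nat (pp k n) * complex_of_real u ^ n) * x ^ k) has_sum ?F x) UNIV"
    proof (rule has_sum_SigmaD)
      show "((\<lambda>(k, n). of_nat (pp k n) * x ^ k * complex_of_real u ^ n) has_sum ?F x) (UNIV \<times> UNIV)"
        using S[OF x] by (simp add: has_sum_infsum)
      show "((\<lambda>n. case (k, n) of (k, n) \<Rightarrow> of_nat (pp k n) * x ^ k * complex_of_real u ^ n) has_sum
         (\<Sum>\<^sub>\<infinity>n. of_nat (pp k n) * complex_of_real u ^ n) * x ^ k) UNIV" for k
        using has_sum_cmult_left[OF has_sum_infsum[OF 1], of k "x ^ k"] by (simp add: mult_ac)
    qed
    from has_sum_imp_sums[OF this]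
    show "(\<lambda>k. (\<Sum>\<^sub>\<infinity>n. of_nat (pp k n) * complex_of_real u ^ n) * (x - 0) ^ k) sums ?F x" by simp
  qed
  show "(\<lambda>x. exp (pp_log x (complex_of_real u))) holomorphic_on ball 0 1"
    using assms by (intro holomorphic_on_compose_gen[OF pp_log_holomorphic_1 holomorphic_on_exp, unfolded o_def]) auto
  fix r :: real assume r: "0 < r" "r < 1"
  have "((\<lambda>p. complex_of_real (case p of (k, n) \<Rightarrow> real (pp k n) * r ^ k * u ^ n)) has_sum complex_of_real (exp (pp_log r u))) UNIV"
    using pp_gf_real[OF r assms(2,3)] by (rule has_sum_of_real)
  then have "((\<lambda>(k, n). of_nat (pp k n) * complex_of_real r ^ k * complex_of_real u ^ n) has_sum
     exp (pp_log (complex_of_real r) (complex_of_real u))) UNIV"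
    using r assms by (subst pp_log_of_real) (auto simp: case_prod_unfold exp_of_real)
  then show "?F (complex_of_real r) = exp (pp_log (complex_of_real r) (complex_of_real u))"
    by (rule infsumI)
qed

lemma pp_trace_le:
  assumes "plane_partition \<pi> n" shows "pp_trace \<pi> \<le> n"
proof -
  let ?S = "{(i, j). \<pi> i j \<noteq> 0}" and ?D = "{i. \<pi> i i \<noteq> 0}"
  have fin: "finite ?S" and n: "(\<Sum>(i, j)\<in>?S. \<pi> i j) = n" using assms unfolding plane_partition_def by blast+
  have "pp_trace \<pi> = (\<Sum>(i, j)\<in>(\<lambda>i. (i, i)) ` ?D. \<pi> i j)"
    unfolding pp_trace_def by (subst sum.reindex) (auto simp: inj_on_def)
  also have "\<dots> \<le> (\<Sum>(i, j)\<in>?S. \<pi> i j)" by (rule sum_mono2[OF fin]) auto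
  finally show ?thesis using n by simp
qed

text \<open>The largest entry is the corner, and it lies on the diagonal. Together with
  \<open>pp_trace_le\<close> this confines the trace of a nonempty array to the range of summation
  in \<open>pp_poly\<close>.\<close>

lemma pp_trace_eq_0:
  assumes "plane_partition \<pi> n" "pp_trace \<pi> = 0" shows "n = 0"
proof -
  let ?S = "{(i, j). \<pi> i j \<noteq> 0}"
  have fin: "finite ?S" and n: "(\<Sum>(i, j)\<in>?S. \<pi> i j) = n"
    and row: "\<And>i j. \<pi> (Suc i) j \<le> \<pi> i j" and col: "\<And>i j. \<pi> i (Suc j) \<le> \<pi> i j"
    using assms(1) unfolding plane_partition_def by blast+
  have "finite {i. \<pi> i i \<noteq> 0}"
  proof (rule finite_subset)
    show "{i. \<pi> i i \<noteq> 0} \<subseteq> fst ` ?S" by force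
  qed (use fin in simp)
  then have "\<pi> 0 0 = 0" using assms(2) unfolding pp_trace_def by (auto simp: sum_eq_0_iff)
  moreover have "\<pi> i j \<le> \<pi> 0 j" for i j by (induction i) (use row order_trans in blast)+
  moreover have "\<pi> 0 j \<le> \<pi> 0 0" for j by (induction j) (use col order_trans in blast)+
  ultimately have "\<pi> i j = 0" for i j by (metis le_zero_eq)
  then show ?thesis using n by simp
qed

lemma pp_poly_sums:
  assumes "n \<ge> 1" shows "((\<lambda>k. of_nat (pp k n) * x ^ k :: complex) has_sum pp_poly n x) UNIV"
proof -
  have z: "pp k n = 0" if "k \<notin> {1..n}" for k
  proof -
    have "{\<pi>. plane_partition \<pi> n \<and> pp_trace \<pi> = k} = {}"
      using that assms pp_trace_le pp_trace_eq_0 by fastforce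
    then show ?thesis by (simp only: pp_def card.empty)
  qed
  have "((\<lambda>k. of_nat (pp k n) * x ^ k :: complex) has_sum pp_poly n x) {1..n}"
    unfolding pp_poly_def by (rule has_sum_finite) simp
  then show ?thesis by (rule has_sum_cong_neutral[THEN iffD1, rotated -1]) (use z in auto)
qed

text \<open>The coefficients agree with \<open>pp_poly\<close> only from \<open>n = 1\<close> on:
  the constant term of the generating function is 1, for the empty array, whereas
  \<open>pp_poly 0 x\<close> is an empty sum.\<close>

lemma pp_gf_complex:
  fixes x :: complex assumes x: "norm x < 1"
  obtains a where "\<And>n. n \<ge> 1 \<Longrightarrow> a n = pp_poly n x"
    and "\<And>u. norm u < 1 \<Longrightarrow> (\<lambda>n. a n * u ^ n) sums exp (pp_log x u)"
proof -
  define a where "a n = (\<Sum>\<^sub>\<infinity>k. of_nat (pp k n) * x ^ k)" for n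
  let ?F = "\<lambda>u. \<Sum>\<^sub>\<infinity>(k, n). of_nat (pp k n) * x ^ k * u ^ n"
  have sums: "(\<lambda>n. a n * u ^ n) sums ?F u" if u: "norm u < 1" for u
  proof -
    have S: "(\<lambda>(n, k). of_nat (pp k n) * x ^ k * u ^ n) summable_on UNIV \<times> UNIV" if "norm u < 1" for u
      using pp_abs_summable[OF x that] summable_on_swap[of "\<lambda>(k, n). of_nat (pp k n) * x ^ k * u ^ n" UNIV UNIV]
      by (simp add: case_prod_unfold)
    have 1: "(\<lambda>k. of_nat (pp k n) * x ^ k) summable_on UNIV" for n
    proof -
      have "(\<lambda>k. of_nat (pp k n) * x ^ k * (1/2) ^ n) summable_on UNIV"
        using summable_on_SigmaD1[OF S[of "1/2"], of n] by simp
      then have "(\<lambda>k. (of_nat (pp k n) * x ^ k * (1/2) ^ n) * 2 ^ n) summable_on UNIV"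
        by (rule summable_on_cmult_left)
      then show ?thesis by (simp add: power_divide)
    qed
    have "((\<lambda>n. a n * u ^ n) has_sum ?F u) UNIV"
    proof (rule has_sum_SigmaD)
      have "((\<lambda>(k, n). of_nat (pp k n) * x ^ k * u ^ n) has_sum ?F u) (UNIV \<times> UNIV)"
        using pp_abs_summable[OF x u] by (simp add: has_sum_infsum)
      then show "((\<lambda>(n, k). of_nat (pp k n) * x ^ k * u ^ n) has_sum ?F u) (UNIV \<times> UNIV)"
        by (subst (asm) has_sum_swap) (simp add: case_prod_unfold)
      show "((\<lambda>k. case (n, k) of (n, k) \<Rightarrow> of_nat (pp k n) * x ^ k * u ^ n) has_sum a n * u ^ n) UNIV" for n
        using has_sum_cmult_left[OF has_sum_infsum[OF 1], of n "u ^ n"] by (simp add: a_def)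
    qed
    then show ?thesis by (rule has_sum_imp_sums)
  qed
  have "?F u = exp (pp_log x u)" if "norm u < 1" for u
  proof (rule eq_on_disc_if_eq_on_reals[OF _ _ _ that])
    show "?F holomorphic_on ball 0 1"
      by (rule power_series_holomorphic[where a = a]) (use sums in auto)
    show "(\<lambda>u. exp (pp_log x u)) holomorphic_on ball 0 1"
      using x by (intro holomorphic_on_compose_gen[OF pp_log_holomorphic_2 holomorphic_on_exp, unfolded o_def]) auto
  qed (use pp_gf_semi_complex[OF x] in blast)
  moreover have "a n = pp_poly n x" if "n \<ge> 1" for n
    unfolding a_def using pp_poly_sums[OF that] by (rule infsumI)
  ultimately show ?thesis using that sums by auto
qed

section \<open>Coefficient extraction by an integral over the circle\<close>

lemma has_integral_exp_ii:
  assumes "c \<noteq> 0" "a \<le> b"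
  shows "((\<lambda>t. exp (\<i> * of_real (c * t))) has_integral
    (exp (\<i> * of_real (c * b)) - exp (\<i> * of_real (c * a))) / (\<i> * of_real c)) {a..b}"
proof -
  let ?F = "\<lambda>z. exp (\<i> * (of_real c * z)) / (\<i> * of_real c)"
  have "((\<lambda>t. ?F (of_real t)) has_vector_derivative exp (\<i> * of_real (c * t))) (at t within {a..b})" for t
  proof (rule has_vector_derivative_real_field)
    have "(?F has_field_derivative exp (\<i> * (of_real c * of_real t)) * (\<i> * (of_real c * 1)) / (\<i> * of_real c)) (at (of_real t))"
      by (auto intro!: derivative_eq_intros simp: mult_ac)
    then show "(?F has_field_derivative exp (\<i> * of_real (c * t))) (at (of_real t))"
      using assms by simp
  qed
  then have "((\<lambda>t. exp (\<i> * of_real (c * t))) has_integral ?F (of_real b) - ?F (of_real a)) {a..b}"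
    using assms by (intro fundamental_theorem_of_calculus) auto
  then show ?thesis by (simp add: diff_divide_distrib)
qed

text \<open>Cauchy's coefficient formula, obtained by integrating the power series term by term. The
  interval starts at \<open>-pi/2\<close> so that both critical directions, 0 and \<open>pi\<close>,
  are interior.\<close>

lemma pp_poly_integral:
  fixes x :: complex assumes x: "norm x < 1" and \<sigma>: "\<sigma> > 0" and n: "n \<ge> 1"
  shows "((\<lambda>\<theta>. exp (pp_log x (exp (- Complex \<sigma> \<theta>)) + of_nat n * Complex \<sigma> \<theta>))
     has_integral 2 * of_real pi * pp_poly n x) {-pi/2..3*pi/2}"
proof -
  obtain a where a: "\<And>n. n \<ge> 1 \<Longrightarrow> a n = pp_poly n x"
    and sums: "\<And>u. norm u < 1 \<Longrightarrow> (\<lambda>n. a n * u ^ n) sums exp (pp_log x u)"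
    using pp_gf_complex[OF x] by blast
  let ?f = "\<lambda>m \<theta>. a m * exp (of_real ((real n - real m) * \<sigma>)) * exp (\<i> * of_real ((real n - real m) * \<theta>))"
  have C: "Complex \<sigma> \<theta> = of_real \<sigma> + \<i> * of_real \<theta>" for \<theta> by (simp add: complex_eq_iff)
  have nu: "norm (exp (- Complex \<sigma> \<theta>)) < 1" for \<theta> using \<sigma> by simp
  have f_eq: "?f m \<theta> = (a m * exp (- Complex \<sigma> \<theta>) ^ m) * exp (of_nat n * Complex \<sigma> \<theta>)" for m \<theta>
    by (simp add: C exp_of_nat_mult[symmetric] exp_add[symmetric] algebra_simps flip: exp_minus)
  have f_sums: "(\<lambda>m. ?f m \<theta>) sums exp (pp_log x (exp (- Complex \<sigma> \<theta>)) + of_nat n * Complex \<sigma> \<theta>)" for \<theta>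
    unfolding f_eq exp_add by (intro sums_mult2 sums nu)
  have u: "uniform_limit {-pi/2..3*pi/2} (\<lambda>N \<theta>. \<Sum>m<N. ?f m \<theta>) (\<lambda>\<theta>. \<Sum>m. ?f m \<theta>) sequentially"
  proof (rule Weierstrass_m_test)
    \<comment> \<open>Convergence at the larger radius \<open>exp (- \<sigma> / 2)\<close> gives
      absolute convergence on the circle of integration.\<close>
    have "summable (\<lambda>m. norm (a m * complex_of_real (exp (- \<sigma>)) ^ m))"
    proof (rule powser_insidea)
      show "summable (\<lambda>m. a m * complex_of_real (exp (- \<sigma> / 2)) ^ m)"
        using sums[of "complex_of_real (exp (- \<sigma> / 2))"] \<sigma> by (simp add: sums_iff)
    qed (use \<sigma> in simp)
    then show "summable (\<lambda>m. exp (real n * \<sigma>) * norm (a m * complex_of_real (exp (- \<sigma>)) ^ m))"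
      by (rule summable_mult)
    show "norm (?f m \<theta>) \<le> exp (real n * \<sigma>) * norm (a m * complex_of_real (exp (- \<sigma>)) ^ m)" for m \<theta>
      by (simp add: norm_mult norm_power exp_of_nat_mult[symmetric] exp_add[symmetric] algebra_simps flip: exp_diff)
  qed
  have cont: "continuous_on {-pi/2..3*pi/2} (\<lambda>\<theta>. \<Sum>m<N. ?f m \<theta>)" for N
    by (intro continuous_intros)
  obtain I J where I: "\<And>N. ((\<lambda>\<theta>. \<Sum>m<N. ?f m \<theta>) has_integral I N) {-pi/2..3*pi/2}"
    and J: "((\<lambda>\<theta>. \<Sum>m. ?f m \<theta>) has_integral J) {-pi/2..3*pi/2}" and IJ: "I \<longlonglongrightarrow> J"
    using uniform_limit_integral[OF u cont sequentially_bot] by blast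
  have int: "(?f m has_integral (if m = n then 2 * of_real pi * a n else 0)) {-pi/2..3*pi/2}" for m
  proof (cases "m = n")
    case True
    have "((\<lambda>\<theta>::real. a n) has_integral (3*pi/2 - (-pi/2)) *\<^sub>R a n) {-pi/2..3*pi/2}"
      using has_integral_const_real[of "a n" "-pi/2" "3*pi/2"] by simp
    then show ?thesis using True by (simp add: scaleR_conv_of_real)
  next
    case False
    let ?c = "real n - real m"
    have "(?f m has_integral a m * exp (of_real (?c * \<sigma>)) *
       ((exp (\<i> * of_real (?c * (3*pi/2))) - exp (\<i> * of_real (?c * (-pi/2)))) / (\<i> * of_real ?c))) {-pi/2..3*pi/2}"
      using False by (intro has_integral_mult_right has_integral_exp_ii) auto
    moreover have "exp (\<i> * of_real (?c * (3*pi/2))) = exp (\<i> * of_real (?c * (-pi/2)))"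
    proof -
      have "\<i> * of_real (?c * (3*pi/2)) = \<i> * of_real (?c * (-pi/2)) + (2 * of_int (int n - int m) * pi) * \<i>"
        by (simp add: field_simps)
      then show ?thesis by (subst exp_eq, intro exI[of _ "int n - int m"]) simp
    qed
    ultimately show ?thesis using False by simp
  qed
  have "I N = 2 * of_real pi * a n" if "N > n" for N
  proof -
    have "((\<lambda>\<theta>. \<Sum>m<N. ?f m \<theta>) has_integral (\<Sum>m<N. if m = n then 2 * of_real pi * a n else 0)) {-pi/2..3*pi/2}"
      by (intro has_integral_sum int) auto
    then show ?thesis using I[of N] that by (simp add: has_integral_unique)
  qed
  then have "I \<longlonglongrightarrow> 2 * of_real pi * a n"
    by (intro tendsto_eventually) (auto simp: eventually_at_top_dense)
  then have "J = 2 * of_real pi * a n" using IJ LIMSEQ_unique by blast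
  then show ?thesis using J f_sums a[OF n] by (simp add: sums_iff)
qed

section \<open>Expansion of the logarithm near \<open>u = 1\<close> and
  \<open>u = -1\<close>\<close>

definition kern :: "complex \<Rightarrow> complex" where "kern z = exp (- z) / (1 - exp (- z))\<^sup>2"

text \<open>With \<open>u = exp (- w)\<close> all terms involve one function at multiples of
  \<open>w\<close>. \<open>kern z\<close> is \<open>1 / (4 sinh (z/2)^2)\<close>: even, with double
  poles at the multiples of \<open>2 pi i\<close>, and equal to \<open>1/z^2 - 1/12 + O(z^2)\<close>
  at 0.\<close>

lemma pp_log_exp: "pp_log x (exp (- w)) = (\<Sum>k. x ^ Suc k / of_nat (Suc k) * kern (of_nat (Suc k) * w))"
proof -
  have "exp (- w) ^ Suc k = exp (- (of_nat (Suc k) * w))" for k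
    by (subst exp_of_nat_mult[symmetric]) simp
  then show ?thesis unfolding pp_log_def kern_def by simp
qed

lemma kern_eq: "kern z = 1 / (exp z + exp (- z) - 2)"
proof -
  have e: "exp z * exp (- z) = 1" by (simp add: exp_minus)
  have "(1 - exp (- z))\<^sup>2 = exp (- z) * (exp z + exp (- z) - 2)"
    using e by (simp add: power2_eq_square algebra_simps)
  then show ?thesis by (simp add: kern_def)
qed

text \<open>Taylor's formula of degree 5 gives \<open>exp z + exp (- z) - 2 = z^2 q\<close> with
  \<open>q = 1 + z^2/12 + \<rho>\<close> and \<open>\<rho> = O(z^4)\<close>. Multiplying
  \<open>q\<close> by \<open>1 - z^2/12\<close> cancels its term of order \<open>z^2\<close>, and
  what is left is divided by \<open>z^2 q\<close>, where \<open>q\<close> stays away from 0.\<close>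

lemma kern_near_0:
  assumes "z \<noteq> 0" "norm z \<le> 1"
  shows "norm (kern z - 1 / z\<^sup>2 + 1 / 12) \<le> norm z ^ 2 / 5"
proof -
  define D where "D = exp z + exp (- z) - 2 - z\<^sup>2 - z ^ 4 / 12"
  have sum: "(\<Sum>k\<le>5. z ^ k / fact k) + (\<Sum>k\<le>5. (- z) ^ k / fact k) = 2 + z\<^sup>2 + z ^ 4 / 12" for z :: complex
    by (simp add: eval_nat_numeral fact_numeral)
  have ex: "exp \<bar>Re z\<bar> \<le> 3"
  proof -
    have "exp \<bar>Re z\<bar> \<le> exp 1" using assms abs_Re_le_cmod[of z] by simp
    also have "\<dots> \<le> 3" by (rule exp_le)
    finally show ?thesis .
  qed
  have T: "norm (exp y - (\<Sum>k\<le>5. y ^ k / fact k)) \<le> norm z ^ 6 / 40" if "y = z \<or> y = - z" for y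
  proof -
    have "norm (exp y - (\<Sum>k\<le>5. y ^ k / fact k)) \<le> exp \<bar>Re y\<bar> * norm y ^ Suc 5 / fact 5" by (rule Taylor_exp)
    also have "\<dots> \<le> 3 * norm z ^ 6 / 120"
      using that mult_right_mono[OF ex, of "norm z ^ 6"] by (auto simp: fact_numeral)
    finally show ?thesis by simp
  qed
  have "D = (exp z - (\<Sum>k\<le>5. z ^ k / fact k)) + (exp (- z) - (\<Sum>k\<le>5. (- z) ^ k / fact k))"
    using sum[of z] by (simp add: D_def algebra_simps)
  then have "norm D \<le> norm z ^ 6 / 40 + norm z ^ 6 / 40"
    using T[of z] T[of "- z"] by (metis (no_types, lifting) norm_triangle_mono)
  then have D: "norm D \<le> norm z ^ 6 / 20" by simp
  define \<rho> where "\<rho> = D / z\<^sup>2"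
  have \<rho>: "norm \<rho> \<le> norm z ^ 4 / 20"
  proof -
    have "norm \<rho> = norm D / norm z ^ 2" by (simp add: \<rho>_def norm_divide norm_power)
    also have "\<dots> \<le> (norm z ^ 6 / 20) / norm z ^ 2" using D by (intro divide_right_mono) auto
    also have "\<dots> = norm z ^ 4 / 20" using assms by (simp add: field_simps eval_nat_numeral)
    finally show ?thesis .
  qed
  define q where "q = 1 + z\<^sup>2 / 12 + \<rho>"
  have S: "exp z + exp (- z) - 2 = z\<^sup>2 * q"
    using assms by (simp add: q_def \<rho>_def D_def field_simps eval_nat_numeral)
  have z24: "norm z ^ 2 \<le> 1" "norm z ^ 4 \<le> 1" using assms by (auto simp: power_le_one)
  have q: "norm q \<ge> 1 / 2"
  proof -
    have "norm (z\<^sup>2 / 12 + \<rho>) \<le> norm (z\<^sup>2 / 12) + norm \<rho>" by (rule norm_triangle_ineq)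
    also have "\<dots> \<le> 1 / 12 + 1 / 20" using \<rho> z24 by (simp add: norm_divide norm_power)
    finally have "norm (z\<^sup>2 / 12 + \<rho>) \<le> 1 / 2" by simp
    moreover have "norm q \<ge> norm (1::complex) - norm (z\<^sup>2 / 12 + \<rho>)"
      using norm_diff_ineq[of 1 "z\<^sup>2 / 12 + \<rho>"] by (simp add: q_def add.assoc)
    ultimately show ?thesis by simp
  qed
  then have "q \<noteq> 0" by auto
  have "kern z - 1 / z\<^sup>2 + 1 / 12 = (z ^ 4 / 144 - \<rho> * (1 - z\<^sup>2 / 12)) / (z\<^sup>2 * q)"
  proof -
    have "kern z - 1 / z\<^sup>2 + 1 / 12 = (1 - (1 - z\<^sup>2 / 12) * q) / (z\<^sup>2 * q)"
      unfolding kern_eq S using assms \<open>q \<noteq> 0\<close> by (simp add: field_simps)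
    also have "1 - (1 - z\<^sup>2 / 12) * q = z ^ 4 / 144 - \<rho> * (1 - z\<^sup>2 / 12)"
      by (simp add: q_def algebra_simps eval_nat_numeral)
    finally show ?thesis .
  qed
  also have "norm \<dots> \<le> (norm z ^ 4 / 10) / (norm z ^ 2 * (1 / 2))"
    unfolding norm_divide
  proof (rule frac_le)
    have "norm (1 - z\<^sup>2 / 12) \<le> 13 / 12"
      using norm_triangle_ineq4[of 1 "z\<^sup>2 / 12"] z24 by (simp add: norm_divide norm_power)
    then have "norm (\<rho> * (1 - z\<^sup>2 / 12)) \<le> norm z ^ 4 / 20 * (13 / 12)"
      unfolding norm_mult using \<rho> by (intro mult_mono) auto
    then have "norm (z ^ 4 / 144 - \<rho> * (1 - z\<^sup>2 / 12)) \<le> norm z ^ 4 / 144 + norm z ^ 4 / 20 * (13 / 12)"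
      using norm_triangle_ineq4[of "z ^ 4 / 144" "\<rho> * (1 - z\<^sup>2 / 12)"] by (simp add: norm_divide norm_power)
    then show "norm (z ^ 4 / 144 - \<rho> * (1 - z\<^sup>2 / 12)) \<le> norm z ^ 4 / 10"
      using zero_le_power[of "norm z" 4, OF norm_ge_zero] by linarith
    show "norm z ^ 2 * (1 / 2) \<le> norm (z\<^sup>2 * q)"
      unfolding norm_mult norm_power using q by (intro mult_left_mono) auto
  qed (use assms in auto)
  also have "\<dots> = norm z ^ 2 / 5" using assms by (simp add: field_simps eval_nat_numeral)
  finally show ?thesis .
qed

text \<open>The cone avoids the poles at the nonzero multiples of \<open>2 pi i\<close>. Where
  \<open>norm z > 1\<close> it forces \<open>Re z >= 1 / (1 + A)\<close>, so all three terms are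
  bounded and a multiple of \<open>norm z ^ 2\<close> absorbs them; the Laurent expansion covers the
  rest.\<close>

lemma kern_cone:
  assumes "A \<ge> 0"
  obtains C where "C > 0" "\<And>z. Re z > 0 \<Longrightarrow> \<bar>Im z\<bar> \<le> A * Re z \<Longrightarrow> norm (kern z - 1 / z\<^sup>2 + 1 / 12) \<le> C * norm z ^ 2"
proof -
  define \<delta> where "\<delta> = 1 / (1 + A)"
  have \<delta>: "\<delta> > 0" using assms by (simp add: \<delta>_def)
  define B where "B = 1 / (1 - exp (- \<delta>))\<^sup>2 + 2"
  have B: "B > 0" unfolding B_def by (intro add_nonneg_pos) auto
  show ?thesis
  proof
    show "B + 1 > 0" using B by simp
    fix z assume z: "Re z > 0" "\<bar>Im z\<bar> \<le> A * Re z"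
    show "norm (kern z - 1 / z\<^sup>2 + 1 / 12) \<le> (B + 1) * norm z ^ 2"
    proof (cases "norm z \<le> 1")
      case True
      have "norm (kern z - 1 / z\<^sup>2 + 1 / 12) \<le> norm z ^ 2 / 5" using True z by (intro kern_near_0) auto
      also have "\<dots> \<le> (B + 1) * norm z ^ 2" using B mult_nonneg_nonneg[of B "norm z ^ 2"] zero_le_power2[of "norm z"]
        by (simp add: algebra_simps)
      finally show ?thesis .
    next
      case False
      have "norm z \<le> \<bar>Re z\<bar> + \<bar>Im z\<bar>" by (rule cmod_le)
      also have "\<dots> \<le> (1 + A) * Re z" using z by (simp add: algebra_simps)
      finally have "1 \<le> (1 + A) * Re z" using False by simp
      then have Re: "\<delta> \<le> Re z" using assms by (simp add: \<delta>_def divide_le_eq mult.commute)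
      have "norm (kern z) \<le> 1 / (1 - exp (- \<delta>))\<^sup>2"
        unfolding kern_def norm_divide
      proof (rule frac_le)
        show "norm (exp (- z)) \<le> 1" using z by simp
        have "1 - exp (- \<delta>) \<le> 1 - norm (exp (- z))" using Re by simp
        also have "\<dots> \<le> norm (1 - exp (- z))" using norm_triangle_ineq2[of 1 "exp (- z)"] by simp
        finally show "(1 - exp (- \<delta>))\<^sup>2 \<le> norm ((1 - exp (- z))\<^sup>2)"
          unfolding norm_power using \<delta> by (intro power_mono) auto
      qed (use \<delta> in auto)
      moreover have "norm (1 / z\<^sup>2) \<le> 1" using False by (simp add: norm_divide norm_power divide_le_eq one_le_power)
      moreover have "norm (kern z - 1 / z\<^sup>2 + 1 / 12) \<le> norm (kern z) + norm (1 / z\<^sup>2) + norm (1 / 12 :: complex)"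
        by (intro norm_triangle_le norm_triangle_le_diff add_right_mono) (auto intro: norm_triangle_ineq4)
      ultimately have "norm (kern z - 1 / z\<^sup>2 + 1 / 12) \<le> B" unfolding B_def by simp
      also have "B \<le> (B + 1) * 1" by simp
      also have "\<dots> \<le> (B + 1) * norm z ^ 2" using False B by (intro mult_left_mono one_le_power) auto
      finally show ?thesis .
    qed
  qed
qed

lemma Li3_summable:
  fixes x :: "'a::{real_normed_field,banach}"
  assumes "norm x \<le> 1" shows "summable (\<lambda>n. norm (x ^ Suc n / of_nat (Suc n) ^ 3))"
proof (rule summable_comparison_test'[where N = 0])
  show "summable (\<lambda>n. 1 / real (Suc n) ^ 3)"
    using inverse_power_summable[of 3, where 'a = real] by (subst summable_Suc_iff) (simp add: field_simps)
  show "norm (norm (x ^ Suc n / of_nat (Suc n) ^ 3)) \<le> 1 / real (Suc n) ^ 3" for n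
    using assms power_le_one[of "norm x" "Suc n"]
    by (simp add: norm_divide norm_power norm_mult divide_right_mono del: of_nat_Suc)
qed

lemma Ln_one_minus_sums:
  assumes "norm (x::complex) < 1" shows "(\<lambda>k. x ^ Suc k / of_nat (Suc k)) sums (- Ln (1 - x))"
proof -
  have "(\<lambda>k. - (x ^ k) / of_nat k) sums Ln (1 - x)" using Ln_series'[of "- x"] assms by simp
  then have "(\<lambda>k. - (x ^ Suc k) / of_nat (Suc k)) sums Ln (1 - x)"
    using sums_Suc_iff[of "\<lambda>k. - (x ^ k) / of_nat k" "Ln (1 - x)"] by simp
  from sums_minus[OF this] show ?thesis by simp
qed

text \<open>The cone is stable under multiplication by \<open>Suc k\<close>, so the kernel estimate
  applies to every term. The parts \<open>1/z^2\<close> add up to \<open>Li3 x / w^2\<close>, the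
  constants \<open>-1/12\<close> to \<open>Ln (1 - x) / 12\<close>, and the errors to a multiple of
  the sum of \<open>k r^k\<close>, which does not depend on \<open>x\<close>.\<close>

lemma pp_log_cone:
  assumes "A \<ge> 0" "0 \<le> r" "r < 1"
  obtains C where "C > 0" "\<And>x w :: complex. norm x \<le> r \<Longrightarrow> Re w > 0 \<Longrightarrow> \<bar>Im w\<bar> \<le> A * Re w \<Longrightarrow>
    norm (pp_log x (exp (- w)) - (Li3 x / w\<^sup>2 + Ln (1 - x) / 12)) \<le> C * norm w ^ 2"
proof -
  obtain C where C: "C > 0" "\<And>z. Re z > 0 \<Longrightarrow> \<bar>Im z\<bar> \<le> A * Re z \<Longrightarrow> norm (kern z - 1 / z\<^sup>2 + 1 / 12) \<le> C * norm z ^ 2"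
    using kern_cone[OF assms(1)] by blast
  have sm: "summable (\<lambda>k. real (Suc k) * r ^ Suc k)"
  proof -
    have "summable (\<lambda>k. of_nat (Suc k) * r ^ k)" using geometric_deriv_sums[of r] assms by (simp add: sums_iff)
    from summable_mult[OF this, of r] show ?thesis by (simp add: mult_ac)
  qed
  define M where "M = (\<Sum>k. real (Suc k) * r ^ Suc k)"
  have M: "M \<ge> 0" unfolding M_def using assms sm by (intro suminf_nonneg) auto
  show ?thesis
  proof
    show "C * (M + 1) > 0" using C M by simp
    fix x w :: complex assume x: "norm x \<le> r" and w: "Re w > 0" "\<bar>Im w\<bar> \<le> A * Re w"
    have x1: "norm x < 1" using x assms by simp
    have w0: "w \<noteq> 0" using w by auto
    let ?t = "\<lambda>k. x ^ Suc k / of_nat (Suc k)"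
    let ?e = "\<lambda>k. ?t k * (kern (of_nat (Suc k) * w) - 1 / (of_nat (Suc k) * w)\<^sup>2 + 1 / 12)"
    have bd: "norm (?e k) \<le> C * norm w ^ 2 * (real (Suc k) * r ^ Suc k)" for k
    proof -
      have "norm (kern (of_nat (Suc k) * w) - 1 / (of_nat (Suc k) * w)\<^sup>2 + 1 / 12) \<le> C * norm (of_nat (Suc k) * w) ^ 2"
      proof (rule C(2))
        show "Re (of_nat (Suc k) * w) > 0" using w by (simp del: of_nat_Suc)
        have "\<bar>Im (of_nat (Suc k) * w)\<bar> = real (Suc k) * \<bar>Im w\<bar>" by (simp add: abs_mult del: of_nat_Suc)
        also have "\<dots> \<le> real (Suc k) * (A * Re w)" using w by (intro mult_left_mono) auto
        finally show "\<bar>Im (of_nat (Suc k) * w)\<bar> \<le> A * Re (of_nat (Suc k) * w)" by (simp add: algebra_simps)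
      qed
      moreover have "norm (?t k) \<le> r ^ Suc k / real (Suc k)"
        unfolding norm_divide norm_power norm_of_nat using x by (intro divide_right_mono power_mono) auto
      ultimately have "norm (?e k) \<le> (r ^ Suc k / real (Suc k)) * (C * norm (of_nat (Suc k) * w) ^ 2)"
        unfolding norm_mult using assms by (intro mult_mono) auto
      also have "\<dots> = C * norm w ^ 2 * (real (Suc k) * r ^ Suc k)"
        unfolding norm_mult norm_of_nat by (simp add: power_mult_distrib power2_eq_square field_simps del: of_nat_Suc)
      finally show ?thesis .
    qed
    have sme: "summable (\<lambda>k. norm (?e k))"
      by (rule summable_comparison_test'[OF summable_mult[OF sm, of "C * norm w ^ 2"], where N = 0]) (use bd in auto)
    have "(\<lambda>k. x ^ Suc k / of_nat (Suc k) ^ 3) sums Li3 x"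
      unfolding Li3_def using Li3_summable[of x] x1 by (intro summable_sums summable_norm_cancel[where f = "\<lambda>k. x ^ Suc k / of_nat (Suc k) ^ 3"]) auto
    then have "(\<lambda>k. x ^ Suc k / of_nat (Suc k) ^ 3 / w\<^sup>2) sums (Li3 x / w\<^sup>2)" by (rule sums_divide)
    moreover have "(\<lambda>k. - (?t k / 12)) sums (- (- Ln (1 - x) / 12))"
      by (intro sums_minus sums_divide Ln_one_minus_sums x1)
    moreover have "?e sums suminf ?e" by (rule summable_sums[OF summable_norm_cancel[OF sme]])
    ultimately have "(\<lambda>k. ?e k + (x ^ Suc k / of_nat (Suc k) ^ 3 / w\<^sup>2 + - (?t k / 12))) sums (suminf ?e + (Li3 x / w\<^sup>2 + - (- Ln (1 - x) / 12)))"
      by (intro sums_add)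
    moreover have "?e k + (x ^ Suc k / of_nat (Suc k) ^ 3 / w\<^sup>2 + - (?t k / 12)) = ?t k * kern (of_nat (Suc k) * w)" for k
    proof -
      have "x ^ Suc k / of_nat (Suc k) ^ 3 / w\<^sup>2 = ?t k * (1 / (of_nat (Suc k) * w)\<^sup>2)"
        by (simp add: power_mult_distrib power2_eq_square power3_eq_cube del: of_nat_Suc)
      then show ?thesis by (simp only:) (simp add: algebra_simps)
    qed
    ultimately have "pp_log x (exp (- w)) = suminf ?e + (Li3 x / w\<^sup>2 + Ln (1 - x) / 12)"
      unfolding pp_log_exp by (simp add: sums_iff)
    then have "norm (pp_log x (exp (- w)) - (Li3 x / w\<^sup>2 + Ln (1 - x) / 12)) = norm (suminf ?e)" by simp
    also have "\<dots> \<le> (\<Sum>k. norm (?e k))" by (rule summable_norm[OF sme])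
    also have "\<dots> \<le> (\<Sum>k. C * norm w ^ 2 * (real (Suc k) * r ^ Suc k))"
      by (intro suminf_le bd sme summable_mult sm)
    also have "\<dots> = C * norm w ^ 2 * M" unfolding M_def by (rule suminf_mult[OF sm])
    also have "\<dots> \<le> C * (M + 1) * norm w ^ 2" using C by (simp add: algebra_simps)
    finally show "norm (pp_log x (exp (- w)) - (Li3 x / w\<^sup>2 + Ln (1 - x) / 12)) \<le> C * (M + 1) * norm w ^ 2" .
  qed
qed


text \<open>Reduces the point -1 to the point 1. With \<open>g v = v / (1 - v)^2\<close>, odd
  exponents are handled by \<open>g (- v) = 4 g (v^2) - g v\<close>. For even exponents the sign
  disappears, and the difference from that formula is again a series of the same type, in
  \<open>x^2\<close>.\<close>

lemma pp_log_minus: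
  fixes x u :: complex assumes x: "norm x < 1" and u: "norm u < 1"
  shows "pp_log x (- u) = pp_log (x\<^sup>2) (u\<^sup>2) - 2 * pp_log (x\<^sup>2) (u ^ 4) + 4 * pp_log x (u\<^sup>2) - pp_log x u"
proof -
  define g where "g v = v / (1 - v)\<^sup>2" for v :: complex
  have g_minus: "g (- v) = 4 * g (v\<^sup>2) - g v" if "norm v < 1" for v
  proof -
    have ne: "1 - v \<noteq> 0" "1 + v \<noteq> 0" using that by (auto simp: add_eq_0_iff)
    have v2: "1 - v\<^sup>2 = (1 - v) * (1 + v)" by (simp add: power2_eq_square algebra_simps)
    have "4 * v\<^sup>2 - v * (1 + v)\<^sup>2 = - v * (1 - v)\<^sup>2" by (simp add: power2_eq_square algebra_simps)
    moreover have "4 * g (v\<^sup>2) - g v = (4 * v\<^sup>2 - v * (1 + v)\<^sup>2) / ((1 - v) * (1 + v))\<^sup>2"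
      using ne by (simp add: g_def v2 power_mult_distrib divide_simps)
    ultimately show ?thesis using ne by (simp add: g_def power_mult_distrib)
  qed
  have norms: "norm (x\<^sup>2) < 1" "norm (u\<^sup>2) < 1" "norm (u ^ 4) < 1" "norm (- u) < 1"
    using x u by (auto simp: norm_power power_less_one_iff)
  have sums: "(\<lambda>k. x ^ Suc k / of_nat (Suc k) * g (u ^ Suc k)) sums pp_log x u"
    if "norm x < 1" "norm u < 1" for x u
    unfolding pp_log_def g_def using pp_log_summable(1)[OF that] by (rule summable_sums[OF summable_norm_cancel])
  define G where "G j = (x\<^sup>2) ^ Suc j / of_nat (Suc j) * g ((u\<^sup>2) ^ Suc j) - 2 * ((x\<^sup>2) ^ Suc j / of_nat (Suc j) * g ((u ^ 4) ^ Suc j))" for j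
  \<comment> \<open>The correction for the exponent \<open>Suc k\<close>, present only when that
    exponent is even, that is, for odd \<open>k\<close>.\<close>
  define E where "E k = (if even k then 0 else G ((k - 1) div 2))" for k :: nat
  have "G sums (pp_log (x\<^sup>2) (u\<^sup>2) - 2 * pp_log (x\<^sup>2) (u ^ 4))"
    unfolding G_def[abs_def] by (intro sums_diff sums_mult sums norms)
  moreover have "(\<lambda>j. E (2 * j + 1)) = G" by (auto simp: E_def)
  moreover have "(\<lambda>j. E (2 * j + 1)) sums c \<longleftrightarrow> E sums c" for c
  proof (rule sums_mono_reindex)
    show "strict_mono (\<lambda>j::nat. 2 * j + 1)" by (auto simp: strict_mono_def)
    show "E k = 0" if "k \<notin> range (\<lambda>j. 2 * j + 1)" for k
      using that by (auto simp: E_def elim!: oddE)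
  qed
  ultimately have E: "E sums (pp_log (x\<^sup>2) (u\<^sup>2) - 2 * pp_log (x\<^sup>2) (u ^ 4))" by simp
  have "(\<lambda>k. E k + (4 * (x ^ Suc k / of_nat (Suc k) * g ((u\<^sup>2) ^ Suc k)) - x ^ Suc k / of_nat (Suc k) * g (u ^ Suc k))) sums
     ((pp_log (x\<^sup>2) (u\<^sup>2) - 2 * pp_log (x\<^sup>2) (u ^ 4)) + (4 * pp_log x (u\<^sup>2) - pp_log x u))"
    by (intro sums_add sums_diff sums_mult E sums x u norms)
  note s1 = this
  have eqn: "x ^ Suc k / of_nat (Suc k) * g ((- u) ^ Suc k) =
     E k + (4 * (x ^ Suc k / of_nat (Suc k) * g ((u\<^sup>2) ^ Suc k)) - x ^ Suc k / of_nat (Suc k) * g (u ^ Suc k))" for k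
  proof (cases "even k")
    case True
    have "norm (u ^ Suc k) < 1" unfolding norm_power using u by (subst power_less_one_iff) auto
    from g_minus[OF this] have "g ((- u) ^ Suc k) = 4 * g ((u\<^sup>2) ^ Suc k) - g (u ^ Suc k)"
      using True by (simp add: power_mult_distrib power_commutes flip: power_mult power_Suc) (simp add: mult.commute)
    then show ?thesis using True unfolding E_def by (simp only: right_diff_distrib if_True mult.left_commute add_0)
  next
    case False
    then obtain j where k: "k = 2 * j + 1" by (elim oddE)
    have p: "Suc k = 2 * Suc j" using k by simp
    have "(- u) ^ Suc k = (u\<^sup>2) ^ Suc j" "u ^ Suc k = (u\<^sup>2) ^ Suc j" "(u\<^sup>2) ^ Suc k = (u ^ 4) ^ Suc j" "x ^ Suc k = (x\<^sup>2) ^ Suc j"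
      unfolding p power_mult by (simp_all flip: power_mult)
    moreover have "E k = G j" using k by (simp add: E_def)
    moreover have "of_nat (Suc k) = 2 * (of_nat (Suc j) :: complex)" using p by simp
    ultimately show ?thesis unfolding G_def by (simp only:) (simp add: field_simps del: of_nat_Suc power_Suc)
  qed
  have "(\<lambda>k. x ^ Suc k / of_nat (Suc k) * g ((- u) ^ Suc k)) sums pp_log x (- u)"
    by (intro sums x norms)
  from sums_unique2[OF this[unfolded eqn] s1] show ?thesis by (simp add: algebra_simps)
qed

text \<open>Inserts the expansion at 1, at the points \<open>w\<close>, \<open>2w\<close> and
  \<open>4w\<close>, into the parity formula. The terms with \<open>Li3 x\<close> cancel as
  \<open>4/4 - 1 = 0\<close>, and for \<open>x^2\<close> there remains
  \<open>1/4 - 2/16 = 1/8\<close>. The logarithms combine because \<open>1 - x\<close> and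
  \<open>1 + x\<close> have positive real part.\<close>

lemma pp_log_cone_minus:
  assumes "A \<ge> 0" "0 \<le> r" "r < 1"
  obtains C where "C > 0" "\<And>x w :: complex. norm x \<le> r \<Longrightarrow> Re w > 0 \<Longrightarrow> \<bar>Im w\<bar> \<le> A * Re w \<Longrightarrow>
    norm (pp_log x (- exp (- w)) - (Li3 (x\<^sup>2) / (8 * w\<^sup>2) + (Ln (1 - x\<^sup>2) / 24 + Ln ((1 - x) / (1 + x)) / 8))) \<le> C * norm w ^ 2"
proof -
  obtain C where C: "C > 0" "\<And>x w :: complex. norm x \<le> r \<Longrightarrow> Re w > 0 \<Longrightarrow> \<bar>Im w\<bar> \<le> A * Re w \<Longrightarrow>
    norm (pp_log x (exp (- w)) - (Li3 x / w\<^sup>2 + Ln (1 - x) / 12)) \<le> C * norm w ^ 2"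
    using pp_log_cone[OF assms] by blast
  show ?thesis
  proof
    \<comment> \<open>53 = 4 + 2 * 16 + 4 * 4 + 1, from the errors at \<open>2w\<close>,
      \<open>4w\<close>, \<open>2w\<close> and \<open>w\<close> with their coefficients.\<close>
    show "53 * C > 0" using C by simp
    fix x w :: complex assume x: "norm x \<le> r" and w: "Re w > 0" "\<bar>Im w\<bar> \<le> A * Re w"
    have x1: "norm x < 1" using x assms by simp
    have w0: "w \<noteq> 0" using w by auto
    have x2: "norm (x\<^sup>2) \<le> r"
    proof -
      have "norm (x\<^sup>2) = norm x * norm x" by (simp add: norm_mult power2_eq_square)
      also have "\<dots> \<le> r * 1" using x x1 assms by (intro mult_mono) auto
      finally show ?thesis by simp
    qed
    define e where "e y v = pp_log y (exp (- v)) - (Li3 y / v\<^sup>2 + Ln (1 - y) / 12)" for y v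
    have e: "norm (e y (of_nat m * w)) \<le> C * (real m ^ 2 * norm w ^ 2)" if "norm y \<le> r" "m > 0" for y m
    proof -
      have "Re (of_nat m * w) > 0" "\<bar>Im (of_nat m * w)\<bar> \<le> A * Re (of_nat m * w)"
        using w that by (auto simp: abs_mult mult.left_commute)
      from C(2)[OF that(1) this] show ?thesis by (simp add: e_def norm_mult power_mult_distrib)
    qed
    have u: "exp (- (2 * w)) = (exp (- w))\<^sup>2" "exp (- (4 * w)) = (exp (- w)) ^ 4"
      using exp_of_nat_mult[of 2 "- w"] exp_of_nat_mult[of 4 "- w"] by simp_all
    have L: "Ln (1 - x\<^sup>2) = Ln (1 - x) + Ln (1 + x)" "Ln ((1 - x) / (1 + x)) = Ln (1 - x) - Ln (1 + x)"
    proof -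
      have re: "Re (1 - x) > 0" "Re (1 + x) > 0" using x1 abs_Re_le_cmod[of x] by auto
      then have ne: "1 - x \<noteq> 0" "1 + x \<noteq> 0" by (metis less_irrefl zero_complex.sel(1))+
      then have im: "\<bar>Im (Ln (1 - x))\<bar> < pi / 2" "\<bar>Im (Ln (1 + x))\<bar> < pi / 2"
        using re Re_Ln_pos_lt by blast+
      have "1 - x\<^sup>2 = (1 - x) * (1 + x)" by (simp add: power2_eq_square algebra_simps)
      moreover have "Ln ((1 - x) * (1 + x)) = Ln (1 - x) + Ln (1 + x)"
        using ne im by (intro Ln_times_simple) auto
      ultimately show "Ln (1 - x\<^sup>2) = Ln (1 - x) + Ln (1 + x)" by simp
      from ne have "exp (Ln (1 - x) - Ln (1 + x)) = (1 - x) / (1 + x)" by (simp add: exp_diff)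
      then show "Ln ((1 - x) / (1 + x)) = Ln (1 - x) - Ln (1 + x)"
        using im by (intro Ln_unique) auto
    qed
    have "pp_log x (- exp (- w)) - (Li3 (x\<^sup>2) / (8 * w\<^sup>2) + (Ln (1 - x\<^sup>2) / 24 + Ln ((1 - x) / (1 + x)) / 8)) =
       e (x\<^sup>2) (of_nat 2 * w) - 2 * e (x\<^sup>2) (of_nat 4 * w) + 4 * e x (of_nat 2 * w) - e x (of_nat 1 * w)"
      using w w0 pp_log_minus[OF x1, of "exp (- w)"] unfolding e_def L
      by (simp add: u power_mult_distrib) (simp add: field_simps)
    also have "norm \<dots> \<le> norm (e (x\<^sup>2) (of_nat 2 * w)) + 2 * norm (e (x\<^sup>2) (of_nat 4 * w)) + 4 * norm (e x (of_nat 2 * w)) + norm (e x (of_nat 1 * w))"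
      by (intro order_trans[OF norm_triangle_ineq4] add_mono order_trans[OF norm_triangle_ineq] order_refl) (simp_all add: norm_mult)
    also have "\<dots> \<le> 53 * C * norm w ^ 2"
      using e[OF x2, of 2] e[OF x2, of 4] e[OF x, of 2] e[OF x, of 1] by simp
    finally show "norm (pp_log x (- exp (- w)) - (Li3 (x\<^sup>2) / (8 * w\<^sup>2) + (Ln (1 - x\<^sup>2) / 24 + Ln ((1 - x) / (1 + x)) / 8))) \<le> 53 * C * norm w ^ 2" .
  qed
qed

section \<open>Bounds away from the two critical points\<close>

lemma sinh_ge_self: "x \<ge> 0 \<Longrightarrow> x \<le> sinh (x::real)"
proof -
  assume "x \<ge> 0"
  have "sinh 0 - 0 \<le> sinh x - x"
    by (rule DERIV_nonneg_imp_nondecreasing[OF \<open>x \<ge> 0\<close>])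
       (auto intro!: exI derivative_eq_intros simp: cosh_real_ge_1)
  then show ?thesis by simp
qed

text \<open>The denominator is the square of \<open>exp (z/2) - exp (- z/2)\<close>, whose modulus
  is known exactly: its square is \<open>4 sinh^2 + 4 sin^2\<close> at half the real and imaginary
  parts. Then \<open>sinh y >= y\<close>.\<close>

lemma norm_kern_le:
  assumes "Re z > 0"
  shows "norm (kern z) \<le> 1 / ((Re z)\<^sup>2 + 4 * (sin (Im z / 2))\<^sup>2)"
proof -
  let ?a = "Re z" and ?b = "Im z"
  have "norm (exp z + exp (- z) - 2) = 4 * (sinh (?a / 2))\<^sup>2 + 4 * (sin (?b / 2))\<^sup>2"
  proof -
    have e: "exp z + exp (- z) - 2 = (exp (z / 2) - exp (- z / 2))\<^sup>2"
      by (simp add: power2_eq_square algebra_simps exp_add[symmetric])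
    have "norm (exp (z / 2) - exp (- z / 2)) ^ 2 = 4 * (sinh (?a / 2))\<^sup>2 + 4 * (sin (?b / 2))\<^sup>2"
    proof -
      have c: "(cos (?b / 2))\<^sup>2 = 1 - (sin (?b / 2))\<^sup>2" by (simp add: cos_squared_eq)
      have ch: "(cosh (?a / 2))\<^sup>2 = 1 + (sinh (?a / 2))\<^sup>2" by (simp add: cosh_square_eq)
      have "Re (exp (z / 2) - exp (- z / 2)) = 2 * sinh (?a / 2) * cos (?b / 2)"
        by (simp add: Re_exp sinh_def algebra_simps)
      moreover have "Im (exp (z / 2) - exp (- z / 2)) = 2 * cosh (?a / 2) * sin (?b / 2)"
        by (simp add: Im_exp cosh_def algebra_simps)
      ultimately show ?thesis unfolding cmod_power2 by (simp add: power_mult_distrib c ch algebra_simps)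
    qed
    then show ?thesis unfolding e norm_power .
  qed
  moreover have "(?a)\<^sup>2 \<le> 4 * (sinh (?a / 2))\<^sup>2"
  proof -
    have "?a \<le> 2 * sinh (?a / 2)" using sinh_ge_self[of "?a / 2"] assms by simp
    then have "?a\<^sup>2 \<le> (2 * sinh (?a / 2))\<^sup>2" using assms by (intro power_mono) auto
    then show ?thesis by (simp add: power_mult_distrib)
  qed
  moreover have "?a\<^sup>2 > 0" using assms by simp
  ultimately show ?thesis unfolding kern_eq norm_divide
    by (intro frac_le) (auto intro: add_pos_nonneg)
qed

text \<open>Compares \<open>1/k^3\<close> with \<open>1/((k-1) k (k+1))\<close>, which telescopes to
  1/12 when summed from \<open>k = 3\<close>.\<close>

lemma inverse_cubes_tail:
  shows "summable (\<lambda>k. 1 / real (k + 3) ^ 3)" "(\<Sum>k. 1 / real (k + 3) ^ 3) \<le> 1 / 12"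
proof -
  let ?f = "\<lambda>k. 1 / (2 * real (k + 2) * real (k + 3))"
  have "?f \<longlonglongrightarrow> 0" by real_asymp
  from telescope_sums'[OF this] have t: "(\<lambda>k. ?f k - ?f (Suc k)) sums (1 / 12)" by simp
  have le: "1 / real (k + 3) ^ 3 \<le> ?f k - ?f (Suc k)" for k
  proof -
    have "?f k - ?f (Suc k) = 1 / ((real k + 2) * (real k + 3) * (real k + 4))"
      by (simp add: divide_simps) (simp add: algebra_simps)
    also have "\<dots> \<ge> 1 / real (k + 3) ^ 3"
      by (intro divide_left_mono mult_pos_pos zero_less_power) (auto simp: power3_eq_cube algebra_simps)
    finally show ?thesis .
  qed
  show s: "summable (\<lambda>k. 1 / real (k + 3) ^ 3)"
    by (rule summable_comparison_test'[OF sums_summable[OF t], where N = 0]) (use le in auto)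
  show "(\<Sum>k. 1 / real (k + 3) ^ 3) \<le> 1 / 12"
    using suminf_le[OF le s sums_summable[OF t]] t by (simp add: sums_iff)
qed

text \<open>Only the first two terms need the hypothesis on the sine: the first peaks at
  \<open>u = 1\<close>, the second at both \<open>u = 1\<close> and \<open>u = -1\<close>. From the
  third term on the sine is dropped, since the tail of the cubes is already small enough at every
  angle.\<close>

lemma pp_log_minor_arc:
  fixes x :: complex
  assumes x: "norm x < 1" and \<sigma>: "\<sigma> > 0" and \<theta>: "\<bar>sin \<theta>\<bar> \<ge> 12 * \<sigma>"
  shows "norm (pp_log x (exp (- Complex \<sigma> \<theta>))) \<le> 35 / 384 * norm x / \<sigma>\<^sup>2"
proof -
  let ?w = "Complex \<sigma> \<theta>"
  let ?t = "\<lambda>k. x ^ Suc k / of_nat (Suc k) * kern (of_nat (Suc k) * ?w)"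
  have u: "norm (exp (- ?w)) < 1" using \<sigma> by simp
  have s2: "(sin \<theta>)\<^sup>2 \<ge> 144 * \<sigma>\<^sup>2"
    using power_mono[OF \<theta>, of 2] \<sigma> by (simp add: power_mult_distrib)
  have sm: "summable (\<lambda>k. norm (?t k))"
  proof -
    have "exp (- ?w) ^ Suc k = exp (- (of_nat (Suc k) * ?w))" for k
      by (subst exp_of_nat_mult[symmetric]) simp
    then show ?thesis using pp_log_summable(1)[OF x u] unfolding kern_def by simp
  qed
  have t: "norm (?t k) \<le> norm x ^ Suc k / real (Suc k) * (1 / ((real (Suc k) * \<sigma>)\<^sup>2 + 4 * (sin (real (Suc k) * \<theta> / 2))\<^sup>2))" for k
    unfolding norm_mult norm_divide norm_power norm_of_nat
    using norm_kern_le[of "of_nat (Suc k) * ?w"] \<sigma> by (intro mult_left_mono) (auto simp del: of_nat_Suc)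
  have xk: "norm x ^ Suc k \<le> norm x" for k using x by (simp add: mult_left_le power_le_one)
  have 0: "norm (?t 0) \<le> norm x / \<sigma>\<^sup>2 * (1 / 145)"
  proof -
    have "\<bar>sin \<theta>\<bar> \<le> 2 * \<bar>sin (\<theta> / 2)\<bar>"
      using sin_double[of "\<theta> / 2"] abs_cos_le_one[of "\<theta> / 2"] mult_left_mono[of "\<bar>cos (\<theta> / 2)\<bar>" 1 "\<bar>sin (\<theta> / 2)\<bar>"]
      by (simp add: abs_mult)
    from power_mono[OF this, of 2] have "(sin \<theta>)\<^sup>2 \<le> 4 * (sin (\<theta> / 2))\<^sup>2" by (simp add: power_mult_distrib)
    then have "145 * \<sigma>\<^sup>2 \<le> \<sigma>\<^sup>2 + 4 * (sin (\<theta> / 2))\<^sup>2" using s2 by simp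
    then have "1 / (\<sigma>\<^sup>2 + 4 * (sin (\<theta> / 2))\<^sup>2) \<le> 1 / (145 * \<sigma>\<^sup>2)"
      using \<sigma> by (intro divide_left_mono mult_pos_pos) (auto intro: add_pos_nonneg)
    from mult_left_mono[OF this, of "norm x"] show ?thesis using t[of 0] by simp
  qed
  \<comment> \<open>In the second term the sine is taken at \<open>\<theta>\<close> itself:
    \<open>4 \<sigma>^2 + 4 * 144 \<sigma>^2 = 580 \<sigma>^2\<close>, and the coefficient 1/2 of
    the series doubles this.\<close>
  have 1: "norm (?t 1) \<le> norm x / \<sigma>\<^sup>2 * (1 / 1160)"
  proof -
    have "580 * \<sigma>\<^sup>2 \<le> (2 * \<sigma>)\<^sup>2 + 4 * (sin \<theta>)\<^sup>2" using s2 by (simp add: power_mult_distrib)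
    then have "1 / ((2 * \<sigma>)\<^sup>2 + 4 * (sin \<theta>)\<^sup>2) \<le> 1 / (580 * \<sigma>\<^sup>2)"
      using \<sigma> by (intro divide_left_mono mult_pos_pos) (auto intro: add_pos_nonneg)
    then have "norm x ^ Suc 1 / real (Suc 1) * (1 / ((2 * \<sigma>)\<^sup>2 + 4 * (sin \<theta>)\<^sup>2)) \<le> norm x / real (Suc 1) * (1 / (580 * \<sigma>\<^sup>2))"
      using xk[of 1] by (intro mult_mono divide_right_mono) auto
    then show ?thesis using t[of 1] by simp
  qed
  have 2: "norm (?t (k + 2)) \<le> norm x / \<sigma>\<^sup>2 * (1 / real (k + 3) ^ 3)" for k
  proof -
    have "norm (?t (k + 2)) \<le> norm x ^ Suc (k + 2) / real (Suc (k + 2)) * (1 / ((real (Suc (k + 2)) * \<sigma>)\<^sup>2 + 4 * (sin (real (Suc (k + 2)) * \<theta> / 2))\<^sup>2))"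
      by (rule t)
    also have "\<dots> \<le> norm x / real (Suc (k + 2)) * (1 / ((real (Suc (k + 2)) * \<sigma>)\<^sup>2))"
      using \<sigma> by (intro mult_mono divide_right_mono divide_left_mono xk mult_pos_pos add_pos_nonneg) (auto simp: add_pos_nonneg)
    also have "\<dots> = norm x / \<sigma>\<^sup>2 * (1 / real (k + 3) ^ 3)"
      by (simp add: power_mult_distrib power2_eq_square power3_eq_cube field_simps)
    finally show ?thesis .
  qed
  have "norm (pp_log x (exp (- ?w))) \<le> (\<Sum>k. norm (?t k))"
    unfolding pp_log_exp by (rule summable_norm[OF sm])
  also have "\<dots> = (\<Sum>k. norm (?t (k + 2))) + (\<Sum>k<2. norm (?t k))"
    by (rule suminf_split_initial_segment[OF sm])
  also have "(\<Sum>k<2. norm (?t k)) = norm (?t 0) + norm (?t 1)" by (simp add: numeral_2_eq_2)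
  also have "(\<Sum>k. norm (?t (k + 2))) \<le> (\<Sum>k. norm x / \<sigma>\<^sup>2 * (1 / real (k + 3) ^ 3))"
    using sm by (intro suminf_le 2 summable_mult inverse_cubes_tail(1)) (subst summable_iff_shift)
  also have "\<dots> = norm x / \<sigma>\<^sup>2 * (\<Sum>k. 1 / real (k + 3) ^ 3)" by (rule suminf_mult[OF inverse_cubes_tail(1)])
  also have "\<dots> \<le> norm x / \<sigma>\<^sup>2 * (1 / 12)" by (intro mult_left_mono inverse_cubes_tail(2)) auto
  finally have "norm (pp_log x (exp (- ?w))) \<le> norm x / \<sigma>\<^sup>2 * (1 / 12) + (norm x / \<sigma>\<^sup>2 * (1 / 145) + norm x / \<sigma>\<^sup>2 * (1 / 1160))"
    using 0 1 by linarith
  \<comment> \<open>1/12 + 1/145 + 1/1160 lies just below 35/384, which is 35/76 of the constant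
    38/192 in the lower bound for \<open>Re (L_phase 1 x) ^ 3\<close>.\<close>
  also have "\<dots> \<le> norm x / \<sigma>\<^sup>2 * (35 / 384)"
    unfolding distrib_left[symmetric] by (intro mult_left_mono) auto
  finally show ?thesis by simp
qed

text \<open>5/24 = 1/8 + 1/12, the second term and the tail of the cubes.\<close>

lemma norm_Li3_minus_self:
  fixes x :: complex assumes "norm x \<le> 1"
  shows "norm (Li3 x - x) \<le> 5 / 24 * norm x"
proof -
  let ?t = "\<lambda>k. x ^ Suc k / of_nat (Suc k) ^ 3"
  have sm: "summable (\<lambda>k. norm (?t k))" by (rule Li3_summable[OF assms])
  have xk: "norm x ^ Suc k \<le> norm x" for k using assms by (simp add: mult_left_le power_le_one)
  have 2: "norm (?t (k + 2)) \<le> norm x * (1 / real (k + 3) ^ 3)" for k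
    unfolding norm_divide norm_power norm_of_nat using xk[of "k + 2"]
    by (simp add: divide_right_mono algebra_simps)
  have "Li3 x - x = (\<Sum>k. ?t (k + 1))"
    unfolding Li3_def using suminf_split_initial_segment[OF summable_norm_cancel[OF sm], of 1] by simp
  then have "norm (Li3 x - x) \<le> (\<Sum>k. norm (?t (k + 1)))"
    using summable_norm[of "\<lambda>k. ?t (k + 1)"] sm summable_iff_shift[of "\<lambda>k. norm (?t k)" 1] by simp
  also have "\<dots> = (\<Sum>k. norm (?t (k + 2))) + norm (?t 1)"
    using suminf_split_initial_segment[of "\<lambda>k. norm (?t (k + 1))" 1] sm summable_iff_shift[of "\<lambda>k. norm (?t k)" 1]
    by simp
  also have "norm (?t 1) \<le> norm x * (1 / 8)"
    using xk[of 1] by (simp add: norm_divide norm_mult power2_eq_square)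
  also have "(\<Sum>k. norm (?t (k + 2))) \<le> (\<Sum>k. norm x * (1 / real (k + 3) ^ 3))"
    using sm by (intro suminf_le 2 summable_mult inverse_cubes_tail(1)) (subst summable_iff_shift)
  also have "\<dots> = norm x * (\<Sum>k. 1 / real (k + 3) ^ 3)" by (rule suminf_mult[OF inverse_cubes_tail(1)])
  also have "\<dots> \<le> norm x * (1 / 12)" by (intro mult_left_mono inverse_cubes_tail(2)) auto
  finally show "norm (Li3 x - x) \<le> 5 / 24 * norm x" by simp
qed

lemma norm_Li3_ge:
  fixes x :: complex assumes "norm x \<le> 1"
  shows "norm (Li3 x) \<ge> 19 / 24 * norm x" "norm (Li3 x) \<le> 29 / 24 * norm x"
  using norm_Li3_minus_self[OF assms]
    norm_triangle_ineq2[of x "Li3 x"] norm_triangle_ineq2[of "Li3 x" x] by (auto simp: norm_minus_commute)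

section \<open>The saddle point integral\<close>

lemma norm_exp_diff_le:
  assumes "Re x \<le> M" "Re y \<le> M"
  shows "norm (exp x - exp y) \<le> exp M * norm (x - y)"
proof (rule field_differentiable_bound[where S = "{z. Re z \<le> M}" and f' = exp])
  show "convex {z. Re z \<le> M}" by (rule convex_halfspace_Re_le)
qed (use assms in \<open>auto intro!: DERIV_subset[OF DERIV_exp]\<close>)

text \<open>The odd part of any primitive is again a primitive, as the integrand is even. Oddness
  lets one limit serve both ends of an integral.\<close>

lemma gauss_primitive:
  obtains F :: "complex \<Rightarrow> complex" where "\<And>z. (F has_field_derivative exp (- z\<^sup>2)) (at z)" "\<And>z. F (- z) = - F z"
proof -
  have "(\<lambda>z::complex. exp (- z\<^sup>2)) holomorphic_on UNIV" by (intro holomorphic_intros)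
  then have "\<exists>G::complex \<Rightarrow> complex. \<forall>z. (G has_field_derivative exp (- z\<^sup>2)) (at z)"
  proof (rule holomorphic_convex_primitive'[OF convex_UNIV open_UNIV])
    fix g :: "complex \<Rightarrow> complex"
    assume "\<And>x. x \<in> UNIV \<Longrightarrow> (g has_field_derivative exp (- x\<^sup>2)) (at x within UNIV)"
    then show "\<exists>G::complex \<Rightarrow> complex. \<forall>z. (G has_field_derivative exp (- z\<^sup>2)) (at z)"
      by (intro exI[of _ g] allI) simp
  qed
  then obtain G :: "complex \<Rightarrow> complex" where G: "(G has_field_derivative exp (- z\<^sup>2)) (at z)" for z by blast
  have "((\<lambda>z. (G z - G (- z)) / 2) has_field_derivative exp (- z\<^sup>2)) (at z)" for z
    by (auto intro!: derivative_eq_intros DERIV_chain2[OF G] G)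
  then show ?thesis by (rule that) (simp add: field_simps)
qed

lemma gauss_integral_at_top:
  "((\<lambda>y. integral {0..y} (\<lambda>t. exp (- t\<^sup>2))) \<longlongrightarrow> sqrt pi / 2) at_top"
proof -
  let ?f = "\<lambda>x. indicator {0..} x *\<^sub>R exp (- x\<^sup>2) :: real"
  have i: "integrable lborel ?f" "integral\<^sup>L lborel ?f = sqrt pi / 2"
    using gaussian_moment_0 unfolding has_bochner_integral_iff by blast+
  have "((\<lambda>y. \<integral>x. indicator {..y} x *\<^sub>R ?f x \<partial>lborel) \<longlongrightarrow> sqrt pi / 2) at_top"
    unfolding i(2)[symmetric] by (rule tendsto_integral_at_top[OF sets_lborel i(1)])
  moreover have "(\<integral>x. indicator {..y} x *\<^sub>R ?f x \<partial>lborel) = integral {0..y} (\<lambda>t. exp (- t\<^sup>2))" for y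
  proof -
    have "(\<integral>x. indicator {..y} x *\<^sub>R ?f x \<partial>lborel) = (LINT x:{0..y}|lborel. exp (- x\<^sup>2))"
      unfolding set_lebesgue_integral_def by (intro Bochner_Integration.integral_cong) (auto simp: indicator_def)
    also have "\<dots> = integral {0..y} (\<lambda>t. exp (- t\<^sup>2))"
      by (intro set_borel_integral_eq_integral borel_integrable_atLeastAtMost') (intro continuous_intros)
    finally show ?thesis .
  qed
  ultimately show ?thesis by simp
qed

lemma gauss_integral_tail:
  assumes "R > 0" shows "\<bar>integral {0..R} (\<lambda>t. exp (- t\<^sup>2)) - sqrt pi / 2\<bar> \<le> 1 / R"
proof -
  let ?\<phi> = "\<lambda>y. integral {0..y} (\<lambda>t. exp (- t\<^sup>2)) :: real"
  have "\<bar>?\<phi> S - ?\<phi> R\<bar> \<le> 1 / R" if "S \<ge> R" for S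
  proof -
    have int: "(\<lambda>t. exp (- t\<^sup>2) :: real) integrable_on {a..b}" for a b
      by (intro integrable_continuous_real continuous_intros)
    have split: "?\<phi> S - ?\<phi> R = integral {R..S} (\<lambda>t. exp (- t\<^sup>2))"
      using Henstock_Kurzweil_Integration.integral_combine[OF _ that int, of 0] assms by simp
    have h: "((\<lambda>t. 1 / t\<^sup>2) has_integral (- 1 / S - (- 1 / R))) {R..S}"
      using that assms
      by (intro fundamental_theorem_of_calculus)
         (auto intro!: derivative_eq_intros simp: has_real_derivative_iff_has_vector_derivative[symmetric] power2_eq_square)
    have e: "exp (- t\<^sup>2) \<le> 1 / t\<^sup>2" if "t \<in> {R..S}" for t
    proof -
      have "t\<^sup>2 \<le> exp (t\<^sup>2)" using exp_ge_add_one_self[of "t\<^sup>2"] by linarith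
      then show ?thesis using that assms by (simp add: exp_minus field_simps)
    qed
    have "integral {R..S} (\<lambda>t. exp (- t\<^sup>2)) \<le> - 1 / S - (- 1 / R)"
      by (rule has_integral_le[OF integrable_integral[OF int] h e])
    moreover have "integral {R..S} (\<lambda>t. exp (- t\<^sup>2) :: real) \<ge> 0" by (intro integral_nonneg int) auto
    moreover have "1 / S \<ge> 0" using that assms by simp
    ultimately show ?thesis using split unfolding abs_le_iff by linarith
  qed
  then have "eventually (\<lambda>S. \<bar>?\<phi> S - ?\<phi> R\<bar> \<le> 1 / R) at_top"
    by (auto intro: eventually_at_top_linorderI)
  moreover have "((\<lambda>S. \<bar>?\<phi> S - ?\<phi> R\<bar>) \<longlongrightarrow> \<bar>sqrt pi / 2 - ?\<phi> R\<bar>) at_top"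
    by (intro tendsto_intros gauss_integral_at_top)
  ultimately have "\<bar>sqrt pi / 2 - ?\<phi> R\<bar> \<le> 1 / R" by (intro tendsto_upperbound[where F = at_top]) auto
  then show ?thesis by (simp add: abs_minus_commute)
qed

text \<open>The path runs along the real axis to \<open>Re z\<close> and then vertically to
  \<open>z\<close>. On the vertical piece \<open>Re (y^2) >= Re (z^2)\<close>, so the integrand is
  at most \<open>exp (- Re (z^2))\<close>.\<close>

lemma gauss_primitive_bound:
  fixes F :: "complex \<Rightarrow> complex"
  assumes F: "\<And>z. (F has_field_derivative exp (- z\<^sup>2)) (at z)" "\<And>z. F (- z) = - F z"
    and z: "Re z > 0" "Re (z\<^sup>2) > 0"
  shows "norm (F z - complex_of_real (sqrt pi / 2)) \<le> norm z / Re (z\<^sup>2) + 1 / Re z"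
proof -
  let ?R = "Re z"
  have F0: "F 0 = 0" using F(2)[of 0] by simp
  have "((\<lambda>t. exp (- (complex_of_real t)\<^sup>2)) has_integral F (of_real ?R) - F (of_real 0)) {0..?R}"
    using z by (intro fundamental_theorem_of_calculus has_vector_derivative_real_field F) auto
  moreover have "((\<lambda>t. complex_of_real (exp (- t\<^sup>2))) has_integral complex_of_real (integral {0..?R} (\<lambda>t. exp (- t\<^sup>2)))) {0..?R}"
    by (intro has_integral_of_real integrable_integral integrable_continuous_real continuous_intros)
  ultimately have FR: "F (of_real ?R) = complex_of_real (integral {0..?R} (\<lambda>t. exp (- t\<^sup>2)))"
    using F0 by (simp add: exp_of_real[symmetric] has_integral_unique)
  have "norm (F z - F (of_real ?R)) \<le> exp (- Re (z\<^sup>2)) * norm (z - of_real ?R)"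
  proof (rule field_differentiable_bound[where S = "closed_segment (of_real ?R) z" and f' = "\<lambda>z. exp (- z\<^sup>2)"])
    show "(F has_field_derivative exp (- y\<^sup>2)) (at y within closed_segment (of_real ?R) z)" for y
      using F(1) by (rule DERIV_subset) simp
    fix y assume "y \<in> closed_segment (of_real ?R) z"
    then have y: "Re y = Re z" "Im y \<in> closed_segment 0 (Im z)" by (auto simp: closed_segment_same_Re)
    then have "\<bar>Im y\<bar> \<le> \<bar>Im z\<bar>" by (auto simp: closed_segment_eq_real_ivl split: if_splits)
    then have "(Im y)\<^sup>2 \<le> (Im z)\<^sup>2" by (simp add: abs_le_square_iff)
    then show "norm (exp (- y\<^sup>2)) \<le> exp (- Re (z\<^sup>2))" using y by (simp add: power2_eq_square)
  qed auto
  also have "norm (z - of_real ?R) \<le> norm z" using abs_Im_le_cmod[of z] by (simp add: cmod_eq_Im)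
  also have "exp (- Re (z\<^sup>2)) \<le> 1 / Re (z\<^sup>2)"
  proof -
    have "Re (z\<^sup>2) \<le> exp (Re (z\<^sup>2))" using exp_ge_add_one_self[of "Re (z\<^sup>2)"] by linarith
    then show ?thesis using z by (simp add: exp_minus field_simps)
  qed
  finally have 1: "norm (F z - F (of_real ?R)) \<le> 1 / Re (z\<^sup>2) * norm z" using z by (simp add: mult_right_mono)
  have 2: "norm (F (of_real ?R) - complex_of_real (sqrt pi / 2)) \<le> 1 / ?R"
    using gauss_integral_tail[OF z(1)] unfolding FR of_real_diff[symmetric] norm_of_real .
  show ?thesis using norm_triangle_ineq[of "F z - F (of_real ?R)" "F (of_real ?R) - complex_of_real (sqrt pi / 2)"] 1 2 by simp
qed

text \<open>The substitution by \<open>\<kappa>\<close> sends the ends to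
  \<open>\<kappa> (q - \<tau>)\<close> and \<open>- \<kappa> (\<tau> - p)\<close>. There the odd
  primitive is close to \<open>sqrt pi / 2\<close> and \<open>- sqrt pi / 2\<close>, with an error
  governed by the distance \<open>s\<close> of the ends from the centre.\<close>

lemma complex_gaussian_integral:
  fixes \<kappa> :: complex
  assumes \<kappa>: "Re \<kappa> > 0" "Re (\<kappa>\<^sup>2) > 0" and s: "s > 0" "p \<le> \<tau> - s" "\<tau> + s \<le> q"
  shows "norm (integral {p..q} (\<lambda>t. exp (- \<kappa>\<^sup>2 * (of_real (t - \<tau>))\<^sup>2)) - complex_of_real (sqrt pi) / \<kappa>) \<le> 4 / (s * Re (\<kappa>\<^sup>2))"
proof -
  obtain F :: "complex \<Rightarrow> complex" where F: "\<And>z. (F has_field_derivative exp (- z\<^sup>2)) (at z)" "\<And>z. F (- z) = - F z"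
    using gauss_primitive by blast
  have \<kappa>0: "\<kappa> \<noteq> 0" using \<kappa> by auto
  have "((\<lambda>t. exp (- \<kappa>\<^sup>2 * (of_real (t - \<tau>))\<^sup>2)) has_integral
      F (\<kappa> * (of_real q - of_real \<tau>)) / \<kappa> - F (\<kappa> * (of_real p - of_real \<tau>)) / \<kappa>) {p..q}"
  proof (rule fundamental_theorem_of_calculus)
    show "((\<lambda>t. F (\<kappa> * (of_real t - of_real \<tau>)) / \<kappa>) has_vector_derivative exp (- \<kappa>\<^sup>2 * (of_real (t - \<tau>))\<^sup>2)) (at t within {p..q})" for t
    proof (rule has_vector_derivative_real_field)
      show "((\<lambda>z. F (\<kappa> * (z - of_real \<tau>)) / \<kappa>) has_field_derivative exp (- \<kappa>\<^sup>2 * (of_real (t - \<tau>))\<^sup>2)) (at (of_real t))"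
        using \<kappa>0 by (auto intro!: derivative_eq_intros DERIV_chain2[OF F(1)] simp: power_mult_distrib)
    qed
  qed (use s in auto)
  then have "integral {p..q} (\<lambda>t. exp (- \<kappa>\<^sup>2 * (of_real (t - \<tau>))\<^sup>2)) =
     F (\<kappa> * (of_real q - of_real \<tau>)) / \<kappa> - F (\<kappa> * (of_real p - of_real \<tau>)) / \<kappa>" by (rule integral_unique)
  also have "F (\<kappa> * (of_real p - of_real \<tau>)) = - F (\<kappa> * of_real (\<tau> - p))"
    using F(2)[of "\<kappa> * of_real (\<tau> - p)"] by (simp add: algebra_simps)
  also have "F (\<kappa> * (of_real q - of_real \<tau>)) / \<kappa> - - F (\<kappa> * of_real (\<tau> - p)) / \<kappa> - complex_of_real (sqrt pi) / \<kappa> =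
    ((F (\<kappa> * of_real (q - \<tau>)) - complex_of_real (sqrt pi / 2)) + (F (\<kappa> * of_real (\<tau> - p)) - complex_of_real (sqrt pi / 2))) / \<kappa>"
    using \<kappa>0 by (simp add: field_simps)
  also have "norm \<dots> \<le> (2 * norm \<kappa> / (s * Re (\<kappa>\<^sup>2)) + 2 * norm \<kappa> / (s * Re (\<kappa>\<^sup>2))) / norm \<kappa>"
    unfolding norm_divide
  proof (intro divide_right_mono order_trans[OF norm_triangle_ineq] add_mono)
    have b: "norm (F (\<kappa> * of_real S) - complex_of_real (sqrt pi / 2)) \<le> 2 * norm \<kappa> / (s * Re (\<kappa>\<^sup>2))" if "S \<ge> s" for S
    proof -
      have S: "S > 0" using that s by simp
      have R2: "Re ((\<kappa> * of_real S)\<^sup>2) = S\<^sup>2 * Re (\<kappa>\<^sup>2)"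
        by (simp add: power2_eq_square algebra_simps)
      have "norm (F (\<kappa> * of_real S) - complex_of_real (sqrt pi / 2)) \<le> norm (\<kappa> * of_real S) / Re ((\<kappa> * of_real S)\<^sup>2) + 1 / Re (\<kappa> * of_real S)"
        using \<kappa> S by (intro gauss_primitive_bound F) (auto simp: R2 simp del: power2_eq_square)
      also have "\<dots> = (1 / S) * (norm \<kappa> / Re (\<kappa>\<^sup>2) + 1 / Re \<kappa>)"
        unfolding R2 using S \<kappa> by (simp add: norm_mult power2_eq_square[of S] field_simps)
      also have "\<dots> \<le> (1 / s) * (norm \<kappa> / Re (\<kappa>\<^sup>2) + norm \<kappa> / Re (\<kappa>\<^sup>2))"
      proof (intro mult_mono add_mono)
        show "1 / S \<le> 1 / s" using that s by (simp add: frac_le)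
        have "Re (\<kappa>\<^sup>2) \<le> Re \<kappa> * Re \<kappa>" by (simp add: power2_eq_square)
        also have "\<dots> \<le> norm \<kappa> * Re \<kappa>" using \<kappa> complex_Re_le_cmod by (intro mult_right_mono) auto
        finally show "1 / Re \<kappa> \<le> norm \<kappa> / Re (\<kappa>\<^sup>2)" using \<kappa> by (simp add: field_simps)
      qed (use \<kappa> s in auto)
      finally show ?thesis by (simp add: field_simps)
    qed
    show "norm (F (\<kappa> * of_real (q - \<tau>)) - complex_of_real (sqrt pi / 2)) \<le> 2 * norm \<kappa> / (s * Re (\<kappa>\<^sup>2))"
      "norm (F (\<kappa> * of_real (\<tau> - p)) - complex_of_real (sqrt pi / 2)) \<le> 2 * norm \<kappa> / (s * Re (\<kappa>\<^sup>2))"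
      using s by (intro b; simp)+
  qed auto
  also have "\<dots> = 4 / (s * Re (\<kappa>\<^sup>2))" using \<kappa>0 by (simp add: field_simps)
  finally show ?thesis .
qed

text \<open>The right-hand side is a multiple of the derivative of the arctangent, so the cubic
  error terms integrate to a bound that is independent of the interval.\<close>

lemma cube_times_exp_le:
  fixes y :: real assumes "y \<ge> 0"
  shows "y ^ 3 * exp (- y\<^sup>2) \<le> 4 / (1 + y\<^sup>2)"
proof -
  define v where "v = y\<^sup>2"
  have v: "v \<ge> 0" by (simp add: v_def)
  have "1 + v / 2 + (v / 2)\<^sup>2 / 2 \<le> exp (v / 2)" using v by (intro exp_lower_Taylor_quadratic) auto
  then have "(1 + v / 2 + (v / 2)\<^sup>2 / 2)\<^sup>2 \<le> (exp (v / 2))\<^sup>2" using v by (intro power_mono) auto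
  also have "\<dots> = exp v" by (simp add: exp_double[symmetric])
  finally have e: "4 * (1 + v / 2 + (v / 2)\<^sup>2 / 2)\<^sup>2 \<le> 4 * exp v" by simp
  have "y ^ 3 \<le> (v + v\<^sup>2) / 2"
  proof -
    have "0 \<le> (y - y\<^sup>2)\<^sup>2" by simp
    then have "2 * y ^ 3 \<le> y\<^sup>2 + y ^ 4" by (simp add: power2_eq_square algebra_simps eval_nat_numeral)
    then show ?thesis by (simp add: v_def flip: power_mult)
  qed
  then have "y ^ 3 * (1 + v) \<le> (v + v\<^sup>2) / 2 * (1 + v)" using v by (intro mult_right_mono) auto
  also have "\<dots> \<le> 4 * (1 + v / 2 + (v / 2)\<^sup>2 / 2)\<^sup>2"
  proof -
    have "4 * (1 + v / 2 + (v / 2)\<^sup>2 / 2)\<^sup>2 - (v + v\<^sup>2) / 2 * (1 + v) = 4 + 7 / 2 * v + v\<^sup>2 + v ^ 4 / 16"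
      by (simp add: power2_eq_square field_simps eval_nat_numeral)
    moreover have "\<dots> \<ge> 0" using v by simp
    ultimately show ?thesis by linarith
  qed
  also note e
  finally have "y ^ 3 * (1 + y\<^sup>2) \<le> 4 * exp (y\<^sup>2)" by (simp add: v_def)
  moreover have "1 + y\<^sup>2 > 0" by (simp add: add_pos_nonneg)
  ultimately show ?thesis by (simp add: exp_minus field_simps)
qed

text \<open>The cofactor of \<open>(b - a)^2\<close> in \<open>a^3/(2 b^2) + b - 3a/2\<close>, where \<open>a = 1 + i\<tau>\<close> is the saddle point and
  \<open>b = 1 + it\<close>.\<close>

definition saddle_kern :: "real \<Rightarrow> real \<Rightarrow> complex" where
  "saddle_kern \<tau> t = (2 * Complex 1 t + Complex 1 \<tau>) / (2 * (Complex 1 t)\<^sup>2)"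

section \<open>The saddle kernel and the integral over one arc\<close>

lemma Complex_1_nz [simp]: "Complex 1 t \<noteq> 0" by (simp add: complex_eq_iff)

lemma norm_Complex_1_ge: "norm (Complex 1 t) \<ge> 1"
  using complex_Re_le_cmod[of "Complex 1 t"] by simp

text \<open>As a function of \<open>b\<close>, the phase minus its saddle value has a double zero at
  \<open>b = a\<close>; the minus sign is the square of \<open>b - a = i (t - \<tau>)\<close>. Being
  exact, the identity replaces a Taylor expansion that would hold only near the saddle.\<close>

lemma saddle_phase:
  "(Complex 1 \<tau>) ^ 3 / (2 * (Complex 1 t)\<^sup>2) + Complex 1 t =
     3 / 2 * Complex 1 \<tau> - of_real (t - \<tau>) ^ 2 * saddle_kern \<tau> t"
proof -
  let ?a = "Complex 1 \<tau>" and ?b = "Complex 1 t"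
  have d: "of_real (t - \<tau>) ^ 2 = - (?b - ?a)\<^sup>2"
    by (simp add: complex_eq_iff power2_eq_square)
  show ?thesis unfolding d saddle_kern_def
    by (simp add: field_simps) (simp add: algebra_simps eval_nat_numeral)
qed

text \<open>The numerator decides the sign: it is positive for every \<open>t\<close> exactly when
  \<open>\<tau>^2 < 3\<close>, and for \<open>\<tau>^2 = 3\<close> it vanishes only at the conjugate
  saddle \<open>t = - \<tau>\<close>.\<close>

lemma Re_saddle_kern:
  "Re (saddle_kern \<tau> t) = ((t + \<tau>)\<^sup>2 + 3 - \<tau>\<^sup>2) / (2 * (1 + t\<^sup>2)\<^sup>2)"
proof -
  have "saddle_kern \<tau> t = (2 * Complex 1 t + Complex 1 \<tau>) * (Complex 1 (- t))\<^sup>2 / (2 * (1 + of_real t ^ 2)\<^sup>2)"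
  proof -
    have "Complex 1 t * Complex 1 (- t) = 1 + of_real t ^ 2" by (simp add: complex_eq_iff power2_eq_square)
    then have "(1 + of_real t ^ 2)\<^sup>2 = (Complex 1 t)\<^sup>2 * (Complex 1 (- t))\<^sup>2" by (metis power_mult_distrib)
    then show ?thesis by (simp add: saddle_kern_def)
  qed
  also have "2 * (1 + complex_of_real t ^ 2)\<^sup>2 = complex_of_real (2 * (1 + t\<^sup>2)\<^sup>2)" by simp
  also have "Re ((2 * Complex 1 t + Complex 1 \<tau>) * (Complex 1 (- t))\<^sup>2 / complex_of_real (2 * (1 + t\<^sup>2)\<^sup>2)) =
     Re ((2 * Complex 1 t + Complex 1 \<tau>) * (Complex 1 (- t))\<^sup>2) / (2 * (1 + t\<^sup>2)\<^sup>2)" by (rule Re_divide_of_real)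
  also have "Re ((2 * Complex 1 t + Complex 1 \<tau>) * (Complex 1 (- t))\<^sup>2) = (t + \<tau>)\<^sup>2 + 3 - \<tau>\<^sup>2"
    by (simp add: power2_eq_square algebra_simps)
  finally show ?thesis .
qed

text \<open>Allows the kernel to be frozen at the saddle, at the price of a cubic term in the
  exponent. The factor \<open>t - \<tau>\<close> splits off algebraically, and the cofactor is
  bounded because \<open>norm (Complex 1 t) >= 1\<close>.\<close>

lemma saddle_kern_diff: "norm (saddle_kern \<tau> t - saddle_kern \<tau> \<tau>) \<le> 2 * \<bar>t - \<tau>\<bar>"
proof -
  let ?a = "Complex 1 \<tau>" and ?b = "Complex 1 t"
  have "saddle_kern \<tau> t - saddle_kern \<tau> \<tau> = (?a - ?b) * (1 / (2 * ?b\<^sup>2) + 3 / (2 * ?a * ?b))"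
    unfolding saddle_kern_def by (simp add: field_simps) (simp add: algebra_simps eval_nat_numeral)
  also have "norm \<dots> = \<bar>t - \<tau>\<bar> * norm (1 / (2 * ?b\<^sup>2) + 3 / (2 * ?a * ?b))"
    by (simp add: norm_mult cmod_eq_Im abs_minus_commute)
  finally have eq: "norm (saddle_kern \<tau> t - saddle_kern \<tau> \<tau>) = \<bar>t - \<tau>\<bar> * norm (1 / (2 * ?b\<^sup>2) + 3 / (2 * ?a * ?b))" .
  have "norm (1 / (2 * ?b\<^sup>2) + 3 / (2 * ?a * ?b)) \<le> 1 / 2 + 3 / 2"
  proof (intro order_trans[OF norm_triangle_ineq] add_mono)
    have "norm ?b ^ 2 \<ge> 1" using norm_Complex_1_ge by (intro one_le_power)
    then show "norm (1 / (2 * ?b\<^sup>2)) \<le> 1 / 2"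
      unfolding norm_divide norm_mult norm_power by (intro frac_le) auto
    have "1 * 1 \<le> norm ?a * norm ?b" using norm_Complex_1_ge by (intro mult_mono) auto
    then show "norm (3 / (2 * ?a * ?b)) \<le> 3 / 2"
      unfolding norm_divide norm_mult by (intro frac_le) auto
  qed
  from mult_left_mono[OF this, of "\<bar>t - \<tau>\<bar>"] show ?thesis unfolding eq by simp
qed

lemma saddle_kern_self: "saddle_kern \<tau> \<tau> = 3 / (2 * Complex 1 \<tau>)"
  unfolding saddle_kern_def by (simp add: field_simps power2_eq_square)


lemma arctan_integral_le:
  fixes \<mu> :: real assumes "\<mu> > 0" "p \<le> q"
  shows "(\<lambda>t. 1 / (1 + (\<mu> * (t - \<tau>))\<^sup>2)) integrable_on {p..q}"
    "integral {p..q} (\<lambda>t. 1 / (1 + (\<mu> * (t - \<tau>))\<^sup>2)) \<le> pi / \<mu>"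
proof -
  have "((\<lambda>t. 1 / (1 + (\<mu> * (t - \<tau>))\<^sup>2)) has_integral (arctan (\<mu> * (q - \<tau>)) / \<mu> - arctan (\<mu> * (p - \<tau>)) / \<mu>)) {p..q}"
    using assms
    by (intro fundamental_theorem_of_calculus)
       (auto intro!: derivative_eq_intros simp: has_real_derivative_iff_has_vector_derivative[symmetric] inverse_eq_divide)
  moreover have "arctan (\<mu> * (q - \<tau>)) / \<mu> - arctan (\<mu> * (p - \<tau>)) / \<mu> \<le> pi / \<mu>"
    unfolding diff_divide_distrib[symmetric]
    using assms arctan_bounded[of "\<mu> * (q - \<tau>)"] arctan_bounded[of "\<mu> * (p - \<tau>)"] by (intro divide_right_mono) auto
  ultimately show "(\<lambda>t. 1 / (1 + (\<mu> * (t - \<tau>))\<^sup>2)) integrable_on {p..q}"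
    "integral {p..q} (\<lambda>t. 1 / (1 + (\<mu> * (t - \<tau>))\<^sup>2)) \<le> pi / \<mu>"
    by (auto simp: integral_unique)
qed

text \<open>Laplace's method with explicit constants. Freezing the kernel costs at most
  \<open>2 \<nu> |t - \<tau>|^3 exp (- c \<nu> (t - \<tau>)^2)\<close>, whose integral is of order
  \<open>1/\<nu>\<close>; the Gaussian that remains is known up to its tails. The main term has
  order \<open>1 / sqrt \<nu>\<close>.\<close>

lemma saddle_arc:
  fixes \<phi> :: "real \<Rightarrow> complex"
  assumes \<tau>: "\<bar>\<tau>\<bar> \<le> 2" and s: "s > 0" "p \<le> \<tau> - s" "\<tau> + s \<le> q"
    and c: "c > 0" "\<And>t. t \<in> {p..q} \<Longrightarrow> c \<le> Re (saddle_kern \<tau> t)"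
    and \<nu>: "\<nu> > 0" and \<phi>: "continuous_on {p..q} \<phi>" "\<And>t. t \<in> {p..q} \<Longrightarrow> norm (\<phi> t - 1) \<le> E / \<nu>"
  shows "norm (integral {p..q} (\<lambda>t. exp (- of_real (\<nu> * (t - \<tau>)\<^sup>2) * saddle_kern \<tau> t) * \<phi> t)
     - csqrt (2 * of_real pi * Complex 1 \<tau> / 3) / of_real (sqrt \<nu>)) \<le> (E * (q - p) + 8 * pi / c\<^sup>2 + 14 / s) / \<nu>"
proof -
  let ?a = "Complex 1 \<tau>"
  let ?f = "\<lambda>t. exp (- of_real (\<nu> * (t - \<tau>)\<^sup>2) * saddle_kern \<tau> t)"
  \<comment> \<open>\<open>y\<close> is a principal root, and \<open>\<kappa>\<close> is a positive
    multiple of \<open>1/y\<close>, so that \<open>sqrt pi / \<kappa> = y / sqrt \<nu>\<close> holds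
    without a choice of branch.\<close>
  define y where "y = csqrt (2 * of_real pi * ?a / 3)"
  have y2: "y\<^sup>2 = 2 * of_real pi * ?a / 3" by (simp add: y_def)
  have "Re (y\<^sup>2) = 2 * pi / 3" unfolding y2 by simp
  moreover have "Re (y\<^sup>2) = (Re y)\<^sup>2 - (Im y)\<^sup>2" by (simp add: power2_eq_square)
  ultimately have "(Re y)\<^sup>2 > 0" using pi_gt_zero zero_le_power2[of "Im y"] by linarith
  then have "Re y \<noteq> 0" by auto
  moreover have "Re y \<ge> 0" unfolding y_def by (rule Re_csqrt)
  ultimately have y: "Re y > 0" by simp
  then have y0: "y \<noteq> 0" by auto
  define \<kappa> where "\<kappa> = of_real (sqrt (\<nu> * pi)) / y"
  have \<kappa>2: "\<kappa>\<^sup>2 = of_real \<nu> * saddle_kern \<tau> \<tau>"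
  proof -
    have "\<kappa>\<^sup>2 = of_real (\<nu> * pi) / y\<^sup>2" using \<nu> by (simp add: \<kappa>_def power_divide flip: of_real_power)
    also have "\<dots> = of_real \<nu> * saddle_kern \<tau> \<tau>" unfolding y2 saddle_kern_self by (simp add: field_simps)
    finally show ?thesis .
  qed
  \<comment> \<open>The real part is \<open>3 / (2 (1 + \<tau>^2))\<close>, and
    \<open>\<tau>^2 <= 4\<close>. The bound 3/10 turns the constant 4 of the Gaussian tails into
    40/3, rounded up to 14.\<close>
  have Re0: "Re (saddle_kern \<tau> \<tau>) \<ge> 3 / 10"
  proof -
    have t2: "\<tau>\<^sup>2 \<le> 4" using power_mono[OF \<tau>, of 2] by simp
    have p: "1 + \<tau>\<^sup>2 > 0" by (simp add: add_pos_nonneg)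
    have "Re (saddle_kern \<tau> \<tau>) = 3 * (1 + \<tau>\<^sup>2) / (2 * (1 + \<tau>\<^sup>2)\<^sup>2)"
      unfolding Re_saddle_kern by (simp add: power2_eq_square algebra_simps)
    also have "\<dots> = 3 / (2 * (1 + \<tau>\<^sup>2))"
    proof -
      have "3 * P / (2 * P\<^sup>2) = 3 / (2 * P)" if "P > 0" for P :: real using that by (simp add: power2_eq_square)
      from this[OF p] show ?thesis .
    qed
    also have "\<dots> \<ge> 3 / 10" using t2 p by (intro divide_left_mono) auto
    finally show ?thesis .
  qed
  have Re\<kappa>2: "Re (\<kappa>\<^sup>2) \<ge> \<nu> * (3 / 10)" unfolding \<kappa>2 using Re0 \<nu> by simp
  have Re\<kappa>: "Re \<kappa> > 0"
  proof -
    have "Re \<kappa> = sqrt (\<nu> * pi) * Re (1 / y)" by (simp add: \<kappa>_def Re_divide)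
    moreover have "Re (1 / y) > 0" unfolding Re_divide using y by (auto intro!: divide_pos_pos add_pos_nonneg)
    ultimately show ?thesis using \<nu> by simp
  qed
  have \<nu>3: "\<nu> * (3 / 10) > 0" using \<nu> by simp
  have main: "norm (integral {p..q} (\<lambda>t. exp (- \<kappa>\<^sup>2 * (of_real (t - \<tau>))\<^sup>2)) - complex_of_real (sqrt pi) / \<kappa>) \<le> 14 / s / \<nu>"
  proof -
    have "norm (integral {p..q} (\<lambda>t. exp (- \<kappa>\<^sup>2 * (of_real (t - \<tau>))\<^sup>2)) - complex_of_real (sqrt pi) / \<kappa>) \<le> 4 / (s * Re (\<kappa>\<^sup>2))"
      using Re\<kappa>2 \<nu>3 by (intro complex_gaussian_integral Re\<kappa> s) linarith
    also have "\<dots> \<le> 4 / (s * (\<nu> * (3 / 10)))"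
      using Re\<kappa>2 \<nu>3 s by (intro divide_left_mono mult_left_mono mult_pos_pos) auto
    also have "\<dots> \<le> 14 / s / \<nu>" using s \<nu> by (simp add: field_simps)
    finally show ?thesis .
  qed
  have main_eq: "complex_of_real (sqrt pi) / \<kappa> = y / of_real (sqrt \<nu>)"
    using \<nu> y0 by (simp add: \<kappa>_def real_sqrt_mult field_simps)
  have pq: "p \<le> q" "\<tau> \<in> {p..q}" using s by auto
  \<comment> \<open>In the variable \<open>\<mu> |t - \<tau>|\<close> the decay is
    \<open>exp (- y^2)\<close>, and the cubic error becomes \<open>y^3 exp (- y^2)\<close>.\<close>
  define \<mu> where "\<mu> = sqrt (c * \<nu>)"
  have \<mu>: "\<mu> > 0" "\<mu>\<^sup>2 = c * \<nu>" using c \<nu> by (auto simp: \<mu>_def)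
  let ?B = "\<lambda>t. E / \<nu> + 8 / (c * \<mu>) * (1 / (1 + (\<mu> * (t - \<tau>))\<^sup>2))"
  have cont: "continuous_on {p..q} ?f" unfolding saddle_kern_def by (intro continuous_intros) auto
  have cont2: "continuous_on {p..q} (\<lambda>t. exp (- \<kappa>\<^sup>2 * (of_real (t - \<tau>))\<^sup>2))" by (intro continuous_intros)
  have bound: "norm (?f t * \<phi> t - exp (- \<kappa>\<^sup>2 * (of_real (t - \<tau>))\<^sup>2)) \<le> ?B t" if t: "t \<in> {p..q}" for t
  proof -
    define v where "v = (t - \<tau>)\<^sup>2"
    have v: "v \<ge> 0" by (simp add: v_def)
    let ?M = "- (c * \<nu> * v)"
    have R1: "Re (- of_real (\<nu> * v) * saddle_kern \<tau> t) \<le> ?M"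
      using mult_left_mono[OF c(2)[OF t], of "\<nu> * v"] \<nu> v by (simp add: algebra_simps)
    have R2: "Re (- of_real (\<nu> * v) * saddle_kern \<tau> \<tau>) \<le> ?M"
      using mult_left_mono[OF c(2)[OF pq(2)], of "\<nu> * v"] \<nu> v by (simp add: algebra_simps)
    have ek: "exp (- \<kappa>\<^sup>2 * (of_real (t - \<tau>))\<^sup>2) = exp (- of_real (\<nu> * v) * saddle_kern \<tau> \<tau>)"
      unfolding \<kappa>2 v_def by (simp add: algebra_simps)
    have ft: "?f t = exp (- of_real (\<nu> * v) * saddle_kern \<tau> t)" by (simp add: v_def)
    have "norm (?f t - exp (- of_real (\<nu> * v) * saddle_kern \<tau> \<tau>)) \<le>
        exp ?M * norm (- of_real (\<nu> * v) * saddle_kern \<tau> t - - of_real (\<nu> * v) * saddle_kern \<tau> \<tau>)"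
      unfolding ft by (rule norm_exp_diff_le[OF R1 R2])
    also have "norm (- of_real (\<nu> * v) * saddle_kern \<tau> t - - of_real (\<nu> * v) * saddle_kern \<tau> \<tau>) = \<nu> * v * norm (saddle_kern \<tau> t - saddle_kern \<tau> \<tau>)"
    proof -
      have "- of_real (\<nu> * v) * saddle_kern \<tau> t - - of_real (\<nu> * v) * saddle_kern \<tau> \<tau> = of_real (- (\<nu> * v)) * (saddle_kern \<tau> t - saddle_kern \<tau> \<tau>)"
        by (simp add: algebra_simps)
      then show ?thesis using \<nu> v by (simp only: norm_mult norm_of_real) simp
    qed
    also have "exp ?M * \<dots> \<le> exp ?M * (\<nu> * v * (2 * \<bar>t - \<tau>\<bar>))"
      using \<nu> v by (intro mult_left_mono saddle_kern_diff) auto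
    also have "\<dots> = 2 / (c * \<mu>) * ((\<mu> * \<bar>t - \<tau>\<bar>) ^ 3 * exp (- (\<mu> * \<bar>t - \<tau>\<bar>)\<^sup>2))"
    proof -
      have e1: "(\<mu> * \<bar>t - \<tau>\<bar>)\<^sup>2 = c * \<nu> * v" unfolding power_mult_distrib \<mu> v_def by simp
      have "(\<mu> * \<bar>t - \<tau>\<bar>) ^ 3 = (c * \<nu> * v) * (\<mu> * \<bar>t - \<tau>\<bar>)"
        unfolding e1[symmetric] by (simp add: power2_eq_square power3_eq_cube)
      then show ?thesis unfolding e1 using c \<mu> by (simp add: field_simps)
    qed
    also have "\<dots> \<le> 2 / (c * \<mu>) * (4 / (1 + (\<mu> * \<bar>t - \<tau>\<bar>)\<^sup>2))"
      using c \<mu> by (intro mult_left_mono cube_times_exp_le) auto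
    also have "\<dots> = 8 / (c * \<mu>) * (1 / (1 + (\<mu> * (t - \<tau>))\<^sup>2))" by (simp add: power_mult_distrib)
    finally have 1: "norm (?f t - exp (- of_real (\<nu> * v) * saddle_kern \<tau> \<tau>)) \<le> 8 / (c * \<mu>) * (1 / (1 + (\<mu> * (t - \<tau>))\<^sup>2))" .
    have "norm (?f t) \<le> 1"
    proof -
      have "c * \<nu> * v \<ge> 0" using c \<nu> v by simp
      then show ?thesis unfolding ft norm_exp_eq_Re using R1 by (simp only: exp_le_one_iff)
    qed
    then have 2: "norm (?f t * (\<phi> t - 1)) \<le> 1 * (E / \<nu>)"
      unfolding norm_mult using \<phi>(2)[OF t] by (intro mult_mono) auto
    have "?f t * \<phi> t - exp (- \<kappa>\<^sup>2 * (of_real (t - \<tau>))\<^sup>2) = ?f t * (\<phi> t - 1) + (?f t - exp (- of_real (\<nu> * v) * saddle_kern \<tau> \<tau>))"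
      unfolding ek by (simp add: algebra_simps)
    then show ?thesis using norm_triangle_ineq[of "?f t * (\<phi> t - 1)" "?f t - exp (- of_real (\<nu> * v) * saddle_kern \<tau> \<tau>)"] 1 2
      by simp
  qed
  have intB: "?B integrable_on {p..q}"
    by (intro integrable_add integrable_on_mult_right arctan_integral_le \<mu> pq) (auto intro: integrable_const_ivl)
  have "integral {p..q} (\<lambda>t. ?f t * \<phi> t) - integral {p..q} (\<lambda>t. exp (- \<kappa>\<^sup>2 * (of_real (t - \<tau>))\<^sup>2)) =
     integral {p..q} (\<lambda>t. ?f t * \<phi> t - exp (- \<kappa>\<^sup>2 * (of_real (t - \<tau>))\<^sup>2))"
    using cont cont2 \<phi>(1) by (intro Henstock_Kurzweil_Integration.integral_diff[symmetric] integrable_continuous_real continuous_on_mult) auto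
  also have "norm \<dots> \<le> integral {p..q} ?B"
    by (rule integral_norm_bound_integral[OF _ intB bound])
       (intro integrable_continuous_real continuous_on_diff continuous_on_mult cont cont2 \<phi>(1))
  also have "\<dots> = E / \<nu> * (q - p) + 8 / (c * \<mu>) * integral {p..q} (\<lambda>t. 1 / (1 + (\<mu> * (t - \<tau>))\<^sup>2))"
  proof (rule integral_unique)
    have "((\<lambda>t. E / \<nu>) has_integral E / \<nu> * (q - p)) {p..q}"
      using has_integral_const_real[of "E / \<nu>" p q] pq by (simp add: mult.commute)
    then show "(?B has_integral E / \<nu> * (q - p) + 8 / (c * \<mu>) * integral {p..q} (\<lambda>t. 1 / (1 + (\<mu> * (t - \<tau>))\<^sup>2))) {p..q}"
      by (intro has_integral_add has_integral_mult_right integrable_integral arctan_integral_le \<mu> pq)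
  qed
  also have "\<dots> \<le> E / \<nu> * (q - p) + 8 / (c * \<mu>) * (pi / \<mu>)"
    using c \<mu> pq by (intro add_left_mono mult_left_mono arctan_integral_le) auto
  also have "8 / (c * \<mu>) * (pi / \<mu>) = 8 * pi / c\<^sup>2 / \<nu>"
  proof -
    have "8 / (c * \<mu>) * (pi / \<mu>) = 8 * pi / (c * \<mu>\<^sup>2)" by (simp add: power2_eq_square)
    also have "\<dots> = 8 * pi / c\<^sup>2 / \<nu>" unfolding \<mu> by (simp add: power2_eq_square mult_ac)
    finally show ?thesis .
  qed
  finally have 1: "norm (integral {p..q} (\<lambda>t. ?f t * \<phi> t) - integral {p..q} (\<lambda>t. exp (- \<kappa>\<^sup>2 * (of_real (t - \<tau>))\<^sup>2))) \<le> E / \<nu> * (q - p) + 8 * pi / c\<^sup>2 / \<nu>" .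
  have "norm (integral {p..q} (\<lambda>t. ?f t * \<phi> t) - y / of_real (sqrt \<nu>)) \<le> E / \<nu> * (q - p) + 8 * pi / c\<^sup>2 / \<nu> + 14 / s / \<nu>"
    using norm_triangle_ineq[of "integral {p..q} (\<lambda>t. ?f t * \<phi> t) - integral {p..q} (\<lambda>t. exp (- \<kappa>\<^sup>2 * (of_real (t - \<tau>))\<^sup>2))"
      "integral {p..q} (\<lambda>t. exp (- \<kappa>\<^sup>2 * (of_real (t - \<tau>))\<^sup>2)) - y / of_real (sqrt \<nu>)"] 1 main[unfolded main_eq]
    by simp
  then show ?thesis unfolding y_def by (simp add: add_divide_distrib)
qed


text \<open>Factors the saddle value out of the exact phase. The remainder \<open>d t\<close> has
  modulus at most 1 since \<open>E <= \<nu>\<close>, so its exponential differs from 1 by at most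
  \<open>e\<close> times its modulus; this is the factor 3.\<close>

lemma saddle_arc_integral:
  fixes T :: "real \<Rightarrow> complex"
  assumes \<tau>: "\<bar>\<tau>\<bar> \<le> 2" and s: "s > 0" "p \<le> \<tau> - s" "\<tau> + s \<le> q"
    and c: "c > 0" "\<And>t. t \<in> {p..q} \<Longrightarrow> c \<le> Re (saddle_kern \<tau> t)"
    and \<nu>: "\<nu> > 0" "E \<le> \<nu>" and T: "continuous_on {p..q} T"
    "\<And>t. t \<in> {p..q} \<Longrightarrow> norm (T t - (of_real \<nu> * ((Complex 1 \<tau>) ^ 3 / (2 * (Complex 1 t)\<^sup>2)) + K)) \<le> E / \<nu>"
  shows "norm (integral {p..q} (\<lambda>t. exp (T t + of_real \<nu> * Complex 1 t))
      - exp (K + 3 / 2 * of_real \<nu> * Complex 1 \<tau>) * (csqrt (2 * of_real pi * Complex 1 \<tau> / 3) / of_real (sqrt \<nu>)))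
    \<le> norm (exp (K + 3 / 2 * of_real \<nu> * Complex 1 \<tau>)) * ((3 * E * (q - p) + 8 * pi / c\<^sup>2 + 14 / s) / \<nu>)"
proof -
  define d where "d t = T t - (of_real \<nu> * ((Complex 1 \<tau>) ^ 3 / (2 * (Complex 1 t)\<^sup>2)) + K)" for t
  let ?m = "exp (K + 3 / 2 * of_real \<nu> * Complex 1 \<tau>)"
  let ?g = "\<lambda>t. exp (- of_real (\<nu> * (t - \<tau>)\<^sup>2) * saddle_kern \<tau> t) * exp (d t)"
  have C: "Complex 1 t = 1 + \<i> * of_real t" for t by (simp add: complex_eq_iff)
  have nz: "1 + \<i> * of_real t \<noteq> 0" for t using Complex_1_nz[of t] unfolding C .
  have cd: "continuous_on {p..q} d"
    unfolding d_def[abs_def] C using nz by (intro continuous_intros T(1)) auto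
  have ed: "norm (exp (d t) - 1) \<le> (3 * E) / \<nu>" if t: "t \<in> {p..q}" for t
  proof -
    have n: "norm (d t) \<le> E / \<nu>" unfolding d_def by (rule T(2)[OF t])
    also have "\<dots> \<le> 1" using \<nu> by simp
    finally have "norm (d t) \<le> 1" .
    then have "Re (d t) \<le> 1" using complex_Re_le_cmod[of "d t"] by linarith
    then have "norm (exp (d t) - exp 0) \<le> exp 1 * norm (d t - 0)" by (intro norm_exp_diff_le) auto
    also have "\<dots> \<le> 3 * (E / \<nu>)" using n exp_le by (intro mult_mono) auto
    finally show ?thesis by simp
  qed
  have eq: "exp (T t + of_real \<nu> * Complex 1 t) = ?m * ?g t" for t
  proof -
    have "T t + of_real \<nu> * Complex 1 t = d t + K + of_real \<nu> * ((Complex 1 \<tau>) ^ 3 / (2 * (Complex 1 t)\<^sup>2) + Complex 1 t)"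
      by (simp add: d_def algebra_simps)
    also have "\<dots> = (K + 3 / 2 * of_real \<nu> * Complex 1 \<tau>) + (- of_real (\<nu> * (t - \<tau>)\<^sup>2) * saddle_kern \<tau> t + d t)"
      unfolding saddle_phase by (simp add: algebra_simps)
    finally show ?thesis by (simp only: exp_add)
  qed
  have "integral {p..q} (\<lambda>t. exp (T t + of_real \<nu> * Complex 1 t)) = ?m * integral {p..q} ?g"
    unfolding eq by (rule integral_mult_right)
  then have "integral {p..q} (\<lambda>t. exp (T t + of_real \<nu> * Complex 1 t))
      - ?m * (csqrt (2 * of_real pi * Complex 1 \<tau> / 3) / of_real (sqrt \<nu>)) =
    ?m * (integral {p..q} ?g - csqrt (2 * of_real pi * Complex 1 \<tau> / 3) / of_real (sqrt \<nu>))"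
    by (simp add: algebra_simps)
  also have "norm \<dots> \<le> norm ?m * ((3 * E * (q - p) + 8 * pi / c\<^sup>2 + 14 / s) / \<nu>)"
    unfolding norm_mult
    by (intro mult_left_mono saddle_arc[OF \<tau> s c \<nu>(1) _ ed] continuous_on_exp cd) auto
  finally show ?thesis .
qed

section \<open>The trilogarithm and the level set\<close>

text \<open>The argument of a principal cube root is at most \<open>pi/3\<close> in modulus, and
  \<open>cos (pi/3) = 1/2\<close>. The bound is attained only on the negative real axis.\<close>

lemma cube_root_props:
  fixes z :: complex assumes "z \<noteq> 0"
  defines "w \<equiv> z powr (1/3)"
  shows "w ^ 3 = z" "norm w ^ 3 = norm z" "norm w \<le> 2 * Re w" "Re w > 0" "z \<notin> \<real>\<^sub>\<le>\<^sub>0 \<Longrightarrow> norm w < 2 * Re w"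
proof -
  have w: "w = exp (Ln z / 3)" using assms by (simp add: powr_def)
  show w3: "w ^ 3 = z" unfolding w using assms by (simp add: exp_of_nat_mult[symmetric])
  show "norm w ^ 3 = norm z" unfolding w3[symmetric] by (simp add: norm_power)
  have w0: "norm w > 0" unfolding w by simp
  let ?t = "Im (Ln z) / 3"
  have Re: "Re w = norm w * cos \<bar>?t\<bar>" unfolding w cos_abs_real by (simp add: Re_exp)
  have t: "\<bar>?t\<bar> \<le> pi / 3" using Im_Ln_le_pi[OF assms(1)] mpi_less_Im_Ln[OF assms(1)] by simp
  then have "cos \<bar>?t\<bar> \<ge> cos (pi / 3)" by (intro cos_monotone_0_pi_le) auto
  then show le: "norm w \<le> 2 * Re w" unfolding Re cos_60 using w0 by simp
  then show "Re w > 0" using w0 by linarith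
  show "norm w < 2 * Re w" if "z \<notin> \<real>\<^sub>\<le>\<^sub>0"
  proof -
    have "Im (Ln z) \<noteq> pi"
      using that Im_Ln_eq_pi[OF assms(1)] by (auto simp: complex_nonpos_Reals_iff)
    then have "\<bar>?t\<bar> < pi / 3" using Im_Ln_le_pi[OF assms(1)] mpi_less_Im_Ln[OF assms(1)] by simp
    then have "cos \<bar>?t\<bar> > cos (pi / 3)" by (intro cos_monotone_0_pi) auto
    then show ?thesis unfolding Re cos_60 using w0 by simp
  qed
qed

lemma powr_third_neg:
  assumes "y > 0"
  shows "complex_of_real (- y) powr (1/3) = of_real (y powr (1/3)) * exp (\<i> * of_real (pi / 3))"
proof -
  have "Ln (complex_of_real (- y)) = of_real (ln y) + \<i> * of_real pi"
    using assms by (intro Ln_unique) (auto simp: exp_add exp_of_real)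
  then have "complex_of_real (- y) powr (1/3) = exp (of_real (ln y / 3) + \<i> * of_real (pi / 3))"
    using assms by (simp add: powr_def add_divide_distrib)
  also have "\<dots> = of_real (y powr (1/3)) * exp (\<i> * of_real (pi / 3))"
    using assms by (simp add: exp_add powr_def exp_of_real[symmetric])
  finally show ?thesis .
qed

section \<open>Analyticity and non-real values of the trilogarithm\<close>

lemma Li3_of_real: "\<bar>x\<bar> \<le> 1 \<Longrightarrow> Li3 (complex_of_real x) = complex_of_real (Li3 x)"
  using suminf_of_real[of "\<lambda>n. x ^ Suc n / of_nat (Suc n) ^ 3", where 'a = complex]
    summable_norm_cancel[OF Li3_summable[of x]] by (simp add: Li3_def)

lemma Li3_sums:
  fixes x :: "'a::{real_normed_field,banach}"
  assumes "norm x \<le> 1" shows "(\<lambda>n. x ^ Suc n / of_nat (Suc n) ^ 3) sums Li3 x"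
  unfolding Li3_def by (rule summable_sums[OF summable_norm_cancel[OF Li3_summable[OF assms]]])

lemma Li3_holomorphic: "Li3 holomorphic_on ball (0::complex) 1"
proof (rule power_series_holomorphic)
  fix x :: complex assume "x \<in> ball 0 1"
  then have "(\<lambda>n. 1 / of_nat (Suc n) ^ 3 * (x - 0) ^ Suc n) sums Li3 x" using Li3_sums[of x] by simp
  then show "(\<lambda>n. 1 / of_nat n ^ 3 * (x - 0) ^ n) sums Li3 x"
    using sums_Suc_iff[of "\<lambda>n. 1 / of_nat n ^ 3 * (x - 0) ^ n" "Li3 x"] by simp
qed

lemma continuous_on_Li3_complex: "continuous_on (ball (0::complex) 1) Li3"
  by (rule holomorphic_on_imp_continuous_on[OF Li3_holomorphic])

lemma continuous_on_Li3_real: "continuous_on {-1<..<1::real} Li3"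
proof -
  have "continuous_on {-1<..<1} (\<lambda>x. Re (Li3 (complex_of_real x)))"
    by (intro continuous_on_Re continuous_on_compose2[OF continuous_on_Li3_complex] continuous_intros) auto
  then show ?thesis by (rule continuous_on_cong[THEN iffD1, rotated -1]) (auto simp: Li3_of_real)
qed

text \<open>The imaginary part of each polylogarithm increases along rays in the upper half disc, because
  \<open>t d/dt Li_(s+1)(t x) = Li_s(t x)\<close> and \<open>Im Li_0(x) = Im x / |1 - x|^2\<close>.\<close>

lemma Im_polylog_pos:
  fixes x :: complex assumes x: "norm x < 1" "Im x > 0" and t: "0 \<le> t" "t \<le> 1"
  shows "(\<Sum>n. Im (x ^ Suc n) / real (Suc n) ^ s * t ^ n) > 0"
  using t
proof (induction s arbitrary: t)
  case 0
  have nx: "norm (of_real t * x) < 1"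
  proof -
    have "norm (of_real t * x) = t * norm x" using 0 by (simp add: norm_mult)
    also have "\<dots> \<le> 1 * norm x" using 0 by (intro mult_right_mono) auto
    finally show ?thesis using x by simp
  qed
  have "(\<lambda>n. x * (of_real t * x) ^ n) sums (x * (1 / (1 - of_real t * x)))"
    by (intro sums_mult geometric_sums nx)
  then have "(\<lambda>n. Im (x * (of_real t * x) ^ n)) sums Im (x * (1 / (1 - of_real t * x)))" by (rule sums_Im)
  moreover have "Im (x * (of_real t * x) ^ n) = Im (x ^ Suc n) / real (Suc n) ^ 0 * t ^ n" for n
  proof -
    have "x * (of_real t * x) ^ n = of_real (t ^ n) * x ^ Suc n" by (simp add: power_mult_distrib)
    then show ?thesis by (simp only:) simp
  qed
  ultimately have "(\<Sum>n. Im (x ^ Suc n) / real (Suc n) ^ 0 * t ^ n) = Im (x / (1 - of_real t * x))" by (simp add: sums_iff)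
  also have "\<dots> = Im x / norm (1 - of_real t * x) ^ 2"
    by (simp add: Im_divide cmod_power2 algebra_simps)
  also have "\<dots> > 0"
  proof -
    have "1 - of_real t * x \<noteq> 0" using nx by auto
    then show ?thesis using x by simp
  qed
  finally show ?case .
next
  case (Suc s)
  let ?c = "\<lambda>n. Im (x ^ n) / real n ^ Suc s"
  \<comment> \<open>A radius beyond 1 at which the series still converges, so that differentiation
    term by term is valid up to and including \<open>t = 1\<close>.\<close>
  define K where "K = (1 + 1 / norm x) / 2"
  have nx0: "norm x > 0" using x by auto
  have K: "1 < K" "norm x * K < 1"
    using x nx0 by (auto simp: K_def field_simps)
  have sumK: "summable (\<lambda>n. ?c n * K ^ n)"
  proof (rule summable_comparison_test'[where N = 1])
    show "summable (\<lambda>n. (norm x * K) ^ n)" using K nx0 by (intro summable_geometric) auto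
    fix n :: nat assume n: "n \<ge> 1"
    have "\<bar>Im (x ^ n)\<bar> / real n ^ Suc s \<le> norm x ^ n / 1"
      using abs_Im_le_cmod[of "x ^ n"] n by (intro frac_le) (auto simp: norm_power simp del: power_Suc intro!: one_le_power)
    then show "norm (?c n * K ^ n) \<le> (norm x * K) ^ n"
      using K mult_right_mono[of "\<bar>Im (x ^ n)\<bar> / real n ^ Suc s" "norm x ^ n" "K ^ n"]
      by (simp add: abs_mult power_mult_distrib del: power_Suc)
  qed
  define F where "F t = (\<Sum>n. ?c n * t ^ n)" for t
  have dF: "(F has_real_derivative (\<Sum>n. Im (x ^ Suc n) / real (Suc n) ^ s * t ^ n)) (at t)" if "0 \<le> t" "t \<le> 1" for t
  proof -
    have "DERIV F t :> (\<Sum>n. diffs ?c n * t ^ n)"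
      unfolding F_def[abs_def] using sumK K that by (intro termdiffs_strong[of _ K]) auto
    moreover have "diffs ?c n = Im (x ^ Suc n) / real (Suc n) ^ s" for n by (simp add: diffs_def del: of_nat_Suc)
    ultimately show ?thesis by simp
  qed
  \<comment> \<open>The series of the statement is \<open>F t / t\<close>. At \<open>t = 0\<close>,
    where it equals \<open>Im x\<close>, it is treated apart.\<close>
  have F_t: "F t = t * (\<Sum>n. Im (x ^ Suc n) / real (Suc n) ^ Suc s * t ^ n)" if "0 \<le> t" "t \<le> 1" for t
  proof -
    have sm: "summable (\<lambda>n. ?c n * t ^ n)"
      using powser_inside[OF sumK, of t] K that by simp
    then have sm': "summable (\<lambda>n. ?c (Suc n) * t ^ Suc n)" by (subst summable_Suc_iff)
    have "F t = (\<Sum>n. ?c (Suc n) * t ^ Suc n)"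
      unfolding F_def using suminf_split_head[OF sm] by simp
    also have "\<dots> = (\<Sum>n. t * (?c (Suc n) * t ^ n))" by (simp add: mult_ac)
    also have "\<dots> = t * (\<Sum>n. ?c (Suc n) * t ^ n)"
    proof (cases "t = 0")
      case False
      have "summable (\<lambda>n. 1 / t * (?c (Suc n) * t ^ Suc n))" by (intro summable_mult sm')
      then have "summable (\<lambda>n. ?c (Suc n) * t ^ n)" using False by (simp add: mult_ac)
      then show ?thesis by (rule suminf_mult)
    qed simp
    finally show ?thesis .
  qed
  show ?case
  proof (cases "t = 0")
    case True
    have "(\<Sum>n. Im (x ^ Suc n) / real (Suc n) ^ Suc s * 0 ^ n) = Im x"
      by (subst powser_zero) simp
    then show ?thesis using True x by simp
  next
    case False
    have "F 0 < F t"
    proof (rule DERIV_pos_imp_increasing[where f = F])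
      fix y assume "0 \<le> y" "y \<le> t"
      then have "0 \<le> y" "y \<le> 1" using Suc.prems by auto
      then show "\<exists>D. DERIV F y :> D \<and> D > 0" using dF[of y] Suc.IH[of y] by blast
    qed (use Suc.prems False in auto)
    then show ?thesis using F_t[of t] F_t[of 0] Suc.prems False by (simp add: zero_less_mult_iff)
  qed
qed

lemma Im_Li3_pos:
  fixes x :: complex assumes x: "norm x < 1" "Im x > 0" shows "Im (Li3 x) > 0"
proof -
  have "(\<lambda>n. Im (x ^ Suc n / of_nat (Suc n) ^ 3)) sums Im (Li3 x)"
    using x by (intro sums_Im Li3_sums) auto
  moreover have "Im (x ^ Suc n / of_nat (Suc n) ^ 3) = Im (x ^ Suc n) / real (Suc n) ^ 3 * 1 ^ n" for n
  proof -
    have "x ^ Suc n / of_nat (Suc n) ^ 3 = x ^ Suc n / of_real (real (Suc n) ^ 3)" by simp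
    then show ?thesis by (simp only: Im_divide_of_real) simp
  qed
  ultimately have "Im (Li3 x) = (\<Sum>n. Im (x ^ Suc n) / real (Suc n) ^ 3 * 1 ^ n)" by (simp add: sums_iff)
  then show ?thesis using Im_polylog_pos[OF x, of 1 3] by simp
qed

lemma Li3_cnj: "norm x \<le> 1 \<Longrightarrow> Li3 (cnj x) = cnj (Li3 x)"
proof -
  assume x: "norm x \<le> 1"
  have "(\<lambda>n. cnj (x ^ Suc n / of_nat (Suc n) ^ 3)) sums cnj (Li3 x)" using Li3_sums[OF x] by (subst sums_cnj)
  then have "(\<lambda>n. cnj x ^ Suc n / of_nat (Suc n) ^ 3) sums cnj (Li3 x)" by simp
  moreover have "(\<lambda>n. cnj x ^ Suc n / of_nat (Suc n) ^ 3) sums Li3 (cnj x)" using x by (intro Li3_sums) simp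
  ultimately show ?thesis by (rule sums_unique2[symmetric])
qed

text \<open>\<open>Im (Li3 x)\<close> has the sign of \<open>Im x\<close>, in the lower half disc by
  conjugation. This keeps the cube root off its branch cut, which gives both the continuity of the
  phases and the strict bound on their arguments.\<close>

lemma Li3_not_nonpos:
  fixes x :: complex assumes x: "norm x < 1" "Im x \<noteq> 0" shows "2 * Li3 x \<notin> \<real>\<^sub>\<le>\<^sub>0"
proof -
  have "Im (Li3 x) \<noteq> 0"
  proof (cases "Im x > 0")
    case False
    then have "Im (Li3 (cnj x)) > 0" using x by (intro Im_Li3_pos) auto
    then show ?thesis using Li3_cnj[of x] x by simp
  qed (use Im_Li3_pos x in force)
  then show ?thesis by (auto simp: complex_nonpos_Reals_iff)
qed

section \<open>The two phases on the level set\<close>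

lemma Li3_nz: fixes x :: complex assumes "norm x \<le> 1" "x \<noteq> 0" shows "2 * Li3 x \<noteq> 0"
  using norm_Li3_ge(1)[OF assms(1)] assms(2) by auto

text \<open>The constant 38/192 is \<open>2 * 19/24\<close> divided by 8: with
  \<open>L = L_phase 1 x\<close>, \<open>8 (Re L)^3 >= |L|^3 = 2 |Li3 x|\<close>, and
  \<open>|Li3 x| >= 19/24 |x|\<close>.\<close>

lemma Re_L_phase_1_ge:
  assumes "0 < norm x" "norm x < 1"
  shows "norm (L_phase 1 x) \<le> 2 * Re (L_phase 1 x)" "Re (L_phase 1 x) > 0"
    "L_phase 1 x ^ 3 = 2 * Li3 x" "norm (L_phase 1 x) ^ 3 = 2 * norm (Li3 x)"
    "38 / 192 * norm x \<le> Re (L_phase 1 x) ^ 3"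
proof -
  have nz: "2 * Li3 x \<noteq> 0" using assms by (intro Li3_nz) auto
  have L: "L_phase 1 x = (2 * Li3 x) powr (1/3)" by (simp add: L_phase_def)
  note c = cube_root_props[OF nz, folded L]
  show 1: "norm (L_phase 1 x) \<le> 2 * Re (L_phase 1 x)" "Re (L_phase 1 x) > 0" "L_phase 1 x ^ 3 = 2 * Li3 x"
    using c by auto
  show 2: "norm (L_phase 1 x) ^ 3 = 2 * norm (Li3 x)" using c(2) by (simp add: norm_mult)
  have "2 * (19 / 24 * norm x) \<le> norm (L_phase 1 x) ^ 3" unfolding 2 using norm_Li3_ge(1)[of x] assms by simp
  also have "\<dots> \<le> (2 * Re (L_phase 1 x)) ^ 3" by (intro power_mono 1) auto
  finally show "38 / 192 * norm x \<le> Re (L_phase 1 x) ^ 3" by (simp add: power_mult_distrib)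
qed

lemma L_phase_2_props:
  assumes "0 < norm x" "norm x < 1"
  shows "norm (L_phase 2 x) \<le> 2 * Re (L_phase 2 x)" "Re (L_phase 2 x) > 0"
    "L_phase 2 x ^ 3 = Li3 (x\<^sup>2) / 4" "8 * norm (L_phase 2 x) ^ 3 = 2 * norm (Li3 (x\<^sup>2))"
proof -
  have n2: "norm (x\<^sup>2) < 1" "x\<^sup>2 \<noteq> 0" using assms by (auto simp: norm_power power_less_one_iff)
  have nz: "2 * Li3 (x\<^sup>2) \<noteq> 0" using n2 by (intro Li3_nz) auto
  have L: "(2 * Li3 (x\<^sup>2)) powr (1/3) = 2 * L_phase 2 x" by (simp add: L_phase_def)
  note c = cube_root_props[OF nz, unfolded L]
  show 1: "norm (L_phase 2 x) \<le> 2 * Re (L_phase 2 x)" "Re (L_phase 2 x) > 0"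
    using c by (auto simp: norm_mult)
  show "L_phase 2 x ^ 3 = Li3 (x\<^sup>2) / 4" using c(1) by (simp add: power_mult_distrib field_simps)
  show "8 * norm (L_phase 2 x) ^ 3 = 2 * norm (Li3 (x\<^sup>2))" using c(2) by (simp add: norm_mult power_mult_distrib)
qed

lemma Li3_square_lt:
  fixes x :: complex assumes "0 < norm x" "norm x < 1" shows "norm (Li3 (x\<^sup>2)) < 8 * norm (Li3 x)"
proof -
  have n2: "norm (x\<^sup>2) < norm x"
    using assms by (simp add: norm_mult power2_eq_square)
  have "norm (Li3 (x\<^sup>2)) \<le> 29 / 24 * norm (x\<^sup>2)" using n2 assms by (intro norm_Li3_ge) auto
  also have "\<dots> < 8 * (19 / 24 * norm x)" using n2 assms by linarith
  also have "\<dots> \<le> 8 * norm (Li3 x)" using norm_Li3_ge(1)[of x] assms by simp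
  finally show ?thesis .
qed

text \<open>For imaginary \<open>x\<close> the number \<open>Li3 (x^2)\<close> is negative, so
  \<open>L_2\<close> has the extreme argument \<open>pi/3\<close> and
  \<open>Re L_2 = |L_2| / 2\<close>. As \<open>Re L_1 >= |L_1| / 2\<close>, equal real parts would
  give \<open>|L_1| <= |L_2|\<close>, which \<open>Li3_square_lt\<close> excludes.\<close>

lemma level_set_not_imaginary:
  assumes "x \<in> level_set" "Im x \<noteq> 0" shows "Im (x\<^sup>2) \<noteq> 0"
proof
  assume "Im (x\<^sup>2) = 0"
  then have Re: "Re x = 0" using assms by (simp add: power2_eq_square)
  have x: "0 < norm x" "norm x < 1" "Re (L_phase 1 x) = Re (L_phase 2 x)" using assms by (auto simp: level_set_def)
  let ?y = "Im x"
  have y1: "\<bar>?y\<bar> < 1" using x abs_Im_le_cmod[of x] by linarith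
  have x2: "x\<^sup>2 = complex_of_real (- ?y\<^sup>2)" using Re by (simp add: complex_eq_iff power2_eq_square)
  have y2: "?y\<^sup>2 < 1" using y1 by (simp add: abs_square_less_1)
  define z where "z = 2 * Li3 (x\<^sup>2)"
  have z: "z = complex_of_real (2 * Li3 (- ?y\<^sup>2))" unfolding z_def x2 using y2 by (subst Li3_of_real) auto
  have neg: "Li3 (- ?y\<^sup>2) < 0"
  proof -
    have "norm (Li3 (x\<^sup>2) - x\<^sup>2) \<le> 5 / 24 * norm (x\<^sup>2)"
      using x by (intro norm_Li3_minus_self) (auto simp: norm_power power_le_one)
    moreover have "Li3 (x\<^sup>2) - x\<^sup>2 = complex_of_real (Li3 (- ?y\<^sup>2) + ?y\<^sup>2)"
      unfolding x2 using y2 by (subst Li3_of_real) auto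
    moreover have "norm (x\<^sup>2) = ?y\<^sup>2" unfolding x2 norm_of_real by simp
    ultimately have "\<bar>Li3 (- ?y\<^sup>2) + ?y\<^sup>2\<bar> \<le> 5 / 24 * ?y\<^sup>2" by (simp only: norm_of_real)
    moreover have "?y\<^sup>2 > 0" using assms by simp
    ultimately show ?thesis by linarith
  qed
  define Y where "Y = - (2 * Li3 (- ?y\<^sup>2))"
  have "z = complex_of_real (- Y)" "Y > 0" using neg by (auto simp: z Y_def)
  then have "z powr (1/3) = of_real (Y powr (1/3)) * exp (\<i> * of_real (pi / 3))" by (simp only: powr_third_neg)
  moreover have "z powr (1/3) = 2 * L_phase 2 x" by (simp add: z_def L_phase_def)
  ultimately have "2 * L_phase 2 x = of_real (Y powr (1/3)) * exp (\<i> * of_real (pi / 3))" by simp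
  then have "Re (2 * L_phase 2 x) = Y powr (1/3) * cos (pi / 3)" "norm (2 * L_phase 2 x) = Y powr (1/3)"
    by (simp_all add: Re_exp norm_mult)
  then have "2 * Re (L_phase 2 x) = norm (L_phase 2 x)" by (simp add: cos_60 norm_mult)
  then have "norm (L_phase 1 x) \<le> norm (L_phase 2 x)" using Re_L_phase_1_ge(1)[OF x(1,2)] x(3) by simp
  then have "norm (L_phase 1 x) ^ 3 \<le> norm (L_phase 2 x) ^ 3" by (intro power_mono) auto
  then have "8 * norm (Li3 x) \<le> norm (Li3 (x\<^sup>2))"
    using Re_L_phase_1_ge(4)[OF x(1,2)] L_phase_2_props(4)[OF x(1,2)] by linarith
  then show False using Li3_square_lt[OF x(1,2)] by simp
qed


section \<open>The real point of the level set\<close>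

lemma power_diff_le:
  fixes r s :: real assumes "0 \<le> r" "r \<le> s" "s \<le> 1"
  shows "s ^ n - r ^ n \<le> real n * (s - r)"
proof (induction n)
  case (Suc n)
  have "s ^ Suc n - r ^ Suc n = s * (s ^ n - r ^ n) + r ^ n * (s - r)" by (simp add: algebra_simps)
  also have "s * (s ^ n - r ^ n) \<le> 1 * (s ^ n - r ^ n)"
    using assms by (intro mult_right_mono) (auto intro: power_mono)
  also have "r ^ n * (s - r) \<le> 1 * (s - r)" using assms by (intro mult_right_mono) (auto intro: power_le_one)
  finally show ?case using Suc by (simp add: algebra_simps)
qed simp

text \<open>Division by the square makes the two sides of \<open>- Li3 (- r) = Li3 (r^2)\<close>
  monotone in opposite directions. The quotient here is \<open>1/r - 1/8 + r/27 - ...\<close>: on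
  the unit interval the first term falls with slope below -1, while the rest rises with slope at
  most 1/2.\<close>

lemma minus_Li3_minus_decreasing:
  fixes r s :: real assumes "0 < r" "r < s" "s < 1"
  shows "- Li3 (- s) / s\<^sup>2 < - Li3 (- r) / r\<^sup>2"
proof -
  let ?b = "\<lambda>n. (-1) ^ n / real (Suc n) ^ 3"
  have N: "(\<lambda>n. ?b n * x ^ Suc n) sums (- Li3 (- x))" if "0 < x" "x < 1" for x
  proof -
    have "(\<lambda>n. - ((- x) ^ Suc n / real (Suc n) ^ 3)) sums (- Li3 (- x))" using that by (intro sums_minus Li3_sums) auto
    moreover have "- ((- x) ^ Suc n / real (Suc n) ^ 3) = ?b n * x ^ Suc n" for n
      by (subst power_minus) simp
    ultimately show ?thesis by (simp only:)
  qed
  have T: "(\<lambda>n. ?b (n + 2) * x ^ (n + 1)) sums (- Li3 (- x) / x\<^sup>2 - 1 / x + 1 / 8)" if "0 < x" "x < 1" for x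
  proof -
    have "(\<lambda>n. ?b (n + 2) * x ^ Suc (n + 2)) sums (- Li3 (- x) - (\<Sum>n<2. ?b n * x ^ Suc n))"
      by (rule sums_split_initial_segment[OF N[OF that]])
    then have "(\<lambda>n. ?b (n + 2) * x ^ Suc (n + 2) / x\<^sup>2) sums ((- Li3 (- x) - (\<Sum>n<2. ?b n * x ^ Suc n)) / x\<^sup>2)"
      by (rule sums_divide)
    moreover have "(- Li3 (- x) - (\<Sum>n<2. ?b n * x ^ Suc n)) / x\<^sup>2 = - Li3 (- x) / x\<^sup>2 - 1 / x + 1 / 8"
      using that by (simp add: numeral_2_eq_2 field_simps)
    moreover have "?b (n + 2) * x ^ Suc (n + 2) / x\<^sup>2 = ?b (n + 2) * x ^ (n + 1)" for n
      using that by (simp add: power_add power2_eq_square)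
    ultimately show ?thesis by (simp only:)
  qed
  \<comment> \<open>A telescoping majorant of \<open>(n+1)/(n+3)^3\<close>; its sum 1/2 bounds the
    slope of the series without its first two terms.\<close>
  have tel: "(\<lambda>n. 1 / real (n + 2) - 1 / real (Suc n + 2)) sums (1 / real (0 + 2) - 0)"
    by (rule telescope_sums') real_asymp
  have D: "(\<lambda>n. ?b (n + 2) * (s ^ (n + 1) - r ^ (n + 1))) sums
      ((- Li3 (- s) / s\<^sup>2 - 1 / s + 1 / 8) - (- Li3 (- r) / r\<^sup>2 - 1 / r + 1 / 8))"
    using sums_diff[OF T[of s] T[of r]] assms by (simp add: right_diff_distrib)
  have "(- Li3 (- s) / s\<^sup>2 - 1 / s + 1 / 8) - (- Li3 (- r) / r\<^sup>2 - 1 / r + 1 / 8) \<le> (1 / real (0 + 2) - 0) * (s - r)"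
  proof (rule sums_le[OF _ D sums_mult2[OF tel, of "s - r"]])
    fix n
    have "?b (n + 2) * (s ^ (n + 1) - r ^ (n + 1)) \<le> \<bar>?b (n + 2)\<bar> * \<bar>s ^ (n + 1) - r ^ (n + 1)\<bar>"
      by (metis abs_ge_self abs_mult)
    also have "\<bar>s ^ (n + 1) - r ^ (n + 1)\<bar> = s ^ (n + 1) - r ^ (n + 1)"
      using assms by (intro abs_of_nonneg) (auto intro!: power_mono simp del: power_Suc)
    also have "\<bar>?b (n + 2)\<bar> = 1 / real (n + 3) ^ 3" by (simp add: abs_divide power_abs eval_nat_numeral)
    also have "1 / real (n + 3) ^ 3 * (s ^ (n + 1) - r ^ (n + 1)) \<le> 1 / real (n + 3) ^ 3 * (real (n + 1) * (s - r))"
      using assms by (intro mult_left_mono power_diff_le) auto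
    also have "\<dots> = (real (n + 1) / real (n + 3) ^ 3) * (s - r)" by simp
    also have "\<dots> \<le> (1 / real (n + 2) - 1 / real (Suc n + 2)) * (s - r)"
    proof (rule mult_right_mono)
      have "real (n + 1) / real (n + 3) ^ 3 \<le> real (n + 3) / real (n + 3) ^ 3" by (intro divide_right_mono) auto
      also have "\<dots> = 1 / (real (n + 3) * real (n + 3))" by (simp add: power3_eq_cube)
      also have "\<dots> \<le> 1 / (real (n + 2) * real (n + 3))" by (intro divide_left_mono mult_right_mono) auto
      also have "\<dots> = 1 / real (n + 2) - 1 / real (Suc n + 2)" by (simp add: field_simps)
      finally show "real (n + 1) / real (n + 3) ^ 3 \<le> 1 / real (n + 2) - 1 / real (Suc n + 2)" .
    qed (use assms in simp)
    finally show "?b (n + 2) * (s ^ (n + 1) - r ^ (n + 1)) \<le> (1 / real (n + 2) - 1 / real (Suc n + 2)) * (s - r)" .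
  qed
  also have "\<dots> < 1 / r - 1 / s"
  proof -
    have "1 / r - 1 / s = (s - r) * (1 / (r * s))" using assms by (simp add: field_simps)
    moreover have "1 / (r * s) > 1"
    proof -
      have "r * s < 1 * s" using assms by (intro mult_strict_right_mono) auto
      then have "r * s < 1" using assms by linarith
      then show ?thesis using assms by (simp add: less_divide_eq)
    qed
    ultimately have "1 / r - 1 / s > (s - r) * 1" using assms mult_strict_left_mono[of 1 "1 / (r * s)" "s - r"] by linarith
    then show ?thesis using assms by (simp del: One_nat_def)
  qed
  finally show ?thesis by simp
qed

lemma Li3_square_increasing:
  fixes r s :: real assumes "0 < r" "r \<le> s" "s < 1"
  shows "Li3 (r\<^sup>2) / r\<^sup>2 \<le> Li3 (s\<^sup>2) / s\<^sup>2"
proof -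
  have S: "(\<lambda>n. (x\<^sup>2) ^ n / real (Suc n) ^ 3) sums (Li3 (x\<^sup>2) / x\<^sup>2)" if "0 < x" "x < 1" for x :: real
  proof -
    have "(\<lambda>n. (x\<^sup>2) ^ Suc n / real (Suc n) ^ 3 / x\<^sup>2) sums (Li3 (x\<^sup>2) / x\<^sup>2)"
      using that by (intro sums_divide Li3_sums) (auto simp: power_le_one)
    then show ?thesis using that by simp
  qed
  show ?thesis
    by (rule sums_le[OF _ S S]) (use assms in \<open>auto intro!: divide_right_mono power_mono\<close>)
qed

lemma Li3_real_signs:
  fixes x :: real assumes "\<bar>x\<bar> < 1" "x \<noteq> 0"
  shows "\<bar>Li3 x - x\<bar> \<le> 5 / 24 * \<bar>x\<bar>" "x < 0 \<Longrightarrow> Li3 x < 0" "x > 0 \<Longrightarrow> Li3 x > 0"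
proof -
  show *: "\<bar>Li3 x - x\<bar> \<le> 5 / 24 * \<bar>x\<bar>"
  proof -
    have "norm (complex_of_real (Li3 x - x)) \<le> 5 / 24 * norm (complex_of_real x)"
      using norm_Li3_minus_self[of "complex_of_real x"] assms by (simp add: Li3_of_real)
    then show ?thesis unfolding norm_of_real .
  qed
  show "x < 0 \<Longrightarrow> Li3 x < 0" "x > 0 \<Longrightarrow> Li3 x > 0" using * by linarith+
qed

lemma L_phase_real_neg:
  fixes x :: real assumes "-1 < x" "x < 0"
  shows "L_phase 1 (of_real x) = of_real ((2 * \<bar>Li3 x\<bar>) powr (1/3)) * exp (\<i> * of_real (pi / 3))"
    "L_phase 2 (of_real x) = of_real ((2 * Li3 (x\<^sup>2)) powr (1/3) / 2)"
    "Re (L_phase 1 (of_real x)) = (2 * \<bar>Li3 x\<bar>) powr (1/3) / 2"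
proof -
  have neg: "Li3 x < 0" using assms Li3_real_signs(2)[of x] by simp
  have "2 * Li3 (complex_of_real x) = complex_of_real (- (2 * \<bar>Li3 x\<bar>))"
    using assms neg by (subst Li3_of_real) auto
  then show 1: "L_phase 1 (of_real x) = of_real ((2 * \<bar>Li3 x\<bar>) powr (1/3)) * exp (\<i> * of_real (pi / 3))"
    unfolding L_phase_def power_one_right using neg by (simp only: powr_third_neg) simp
  have x2: "x\<^sup>2 < 1" "x\<^sup>2 > 0" using assms by (auto simp: abs_square_less_1)
  then have pos: "Li3 (x\<^sup>2) > 0" using Li3_real_signs(3)[of "x\<^sup>2"] by simp
  have "2 * Li3 (complex_of_real x ^ 2) = complex_of_real (2 * Li3 (x\<^sup>2))"
    unfolding of_real_power[symmetric] using x2 by (subst Li3_of_real) auto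
  moreover have "complex_of_real (2 * Li3 (x\<^sup>2)) powr of_real (1/3) = of_real ((2 * Li3 (x\<^sup>2)) powr (1/3))"
    using pos by (intro powr_of_real) auto
  ultimately show "L_phase 2 (of_real x) = of_real ((2 * Li3 (x\<^sup>2)) powr (1/3) / 2)"
    unfolding L_phase_def by simp
  show "Re (L_phase 1 (of_real x)) = (2 * \<bar>Li3 x\<bar>) powr (1/3) / 2"
    unfolding 1 by (simp add: Re_exp cos_60)
qed

lemma powr_inj_iff_third: "0 \<le> (a::real) \<Longrightarrow> 0 \<le> b \<Longrightarrow> a powr (1/3) = b powr (1/3) \<longleftrightarrow> a = b"
proof -
  assume "0 \<le> a" "0 \<le> b"
  then have "(a powr (1/3)) powr 3 = a" "(b powr (1/3)) powr 3 = b" by (simp_all add: powr_powr)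
  then show ?thesis by metis
qed

text \<open>For negative \<open>x\<close> the factor \<open>cos (pi/3) = 1/2\<close> in
  \<open>Re L_1\<close> cancels against the factor 1/2 in \<open>L_2\<close>. For positive
  \<open>x\<close> the phase \<open>L_1\<close> is real and positive, and it exceeds
  \<open>|L_2|\<close>.\<close>

lemma level_set_real_iff:
  fixes x :: real
  shows "complex_of_real x \<in> level_set \<longleftrightarrow> - 1 < x \<and> x < 0 \<and> - Li3 x = Li3 (x\<^sup>2)"
proof (cases "0 < \<bar>x\<bar> \<and> \<bar>x\<bar> < 1")
  case True
  show ?thesis
  proof (cases "x < 0")
    case neg: True
    then have x: "-1 < x" "x < 0" using True by auto
    have x2: "x\<^sup>2 < 1" "x\<^sup>2 > 0" using x by (auto simp: abs_square_less_1)
    have s: "Li3 x < 0" "Li3 (x\<^sup>2) > 0" using x x2 Li3_real_signs(2)[of x] Li3_real_signs(3)[of "x\<^sup>2"] by auto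
    have R2: "Re (L_phase 2 (of_real x)) = (2 * Li3 (x\<^sup>2)) powr (1/3) / 2"
      unfolding L_phase_real_neg(2)[OF x] Re_complex_of_real ..
    have "complex_of_real x \<in> level_set \<longleftrightarrow> Re (L_phase 1 (of_real x)) = Re (L_phase 2 (of_real x))"
      using True by (simp add: level_set_def)
    also have "\<dots> \<longleftrightarrow> (2 * \<bar>Li3 x\<bar>) powr (1/3) = (2 * Li3 (x\<^sup>2)) powr (1/3)"
      unfolding R2 L_phase_real_neg(3)[OF x] by simp
    also have "\<dots> \<longleftrightarrow> 2 * \<bar>Li3 x\<bar> = 2 * Li3 (x\<^sup>2)"
      using s by (intro powr_inj_iff_third) auto
    finally show ?thesis using s x by auto
  next
    case False
    have n: "0 < norm (complex_of_real x)" "norm (complex_of_real x) < 1" using True by auto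
    have pos: "Li3 x > 0" using False True Li3_real_signs(3)[of x] by simp
    have "complex_of_real (2 * Li3 x) powr of_real (1/3) = of_real ((2 * Li3 x) powr (1/3))"
      using pos by (intro powr_of_real) auto
    moreover have "2 * Li3 (complex_of_real x) = complex_of_real (2 * Li3 x)" using True by (simp add: Li3_of_real)
    ultimately have "L_phase 1 (of_real x) = of_real ((2 * Li3 x) powr (1/3))" by (simp add: L_phase_def)
    then have R: "Re (L_phase 1 (of_real x)) = norm (L_phase 1 (of_real x))" by simp
    have "complex_of_real x \<notin> level_set"
    proof
      assume "complex_of_real x \<in> level_set"
      then have "norm (L_phase 1 (complex_of_real x)) \<le> norm (L_phase 2 (complex_of_real x))"
        using R complex_Re_le_cmod[of "L_phase 2 (complex_of_real x)"] by (simp add: level_set_def)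
      then have "norm (L_phase 1 (complex_of_real x)) ^ 3 \<le> norm (L_phase 2 (complex_of_real x)) ^ 3" by (intro power_mono) auto
      then show False using Li3_square_lt[OF n] Re_L_phase_1_ge(4)[OF n] L_phase_2_props(4)[OF n] by linarith
    qed
    then show ?thesis using False by simp
  qed
qed (auto simp: level_set_def)

text \<open>\<open>x_star\<close> is a definite description, so it is usable only after existence,
  by the intermediate value theorem, and uniqueness, by the opposite monotonicity. The same
  comparison gives the strict inequality to the right of \<open>x_star\<close>, which makes the arc
  at \<open>u = -1\<close> negligible there.\<close>

lemma x_star_props:
  shows "-1 < x_star" "x_star < 0" "complex_of_real x_star \<in> level_set"
    "\<And>x. complex_of_real x \<in> level_set \<Longrightarrow> x = x_star"
    "\<And>x. x_star < x \<Longrightarrow> x < 0 \<Longrightarrow> Li3 (x\<^sup>2) < \<bar>Li3 x\<bar>"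
proof -
  let ?g = "\<lambda>r::real. - Li3 (- r) - Li3 (r\<^sup>2)"
  have sq: "(r::real)\<^sup>2 < 1" if "0 < r" "r < 1" for r using that by (simp add: abs_square_less_1)
  have "\<exists>r. 1/2 \<le> r \<and> r \<le> 9/10 \<and> ?g r = 0"
  proof (rule IVT2')
    \<comment> \<open>The general bound with 5/24 is too weak at 9/10; two terms of the series and
      the tail of the cubes decide the sign.\<close>
    have "\<bar>Li3 (-(9/10)::real) - (-(9/10) + (9/10)\<^sup>2 / 8)\<bar> \<le> (9/10) ^ 3 * (1 / 12)"
    proof -
      let ?t = "\<lambda>n. (-(9/10)::real) ^ Suc n / real (Suc n) ^ 3"
      have "(\<lambda>n. ?t (n + 2)) sums (Li3 (-(9/10)) - (\<Sum>n<2. ?t n))"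
        by (intro sums_split_initial_segment Li3_sums) simp
      then have "Li3 (-(9/10)::real) - (\<Sum>n<2. ?t n) = (\<Sum>n. ?t (n + 2))" by (simp add: sums_iff)
      then have eq: "Li3 (-(9/10)::real) - (-(9/10) + (9/10)\<^sup>2 / 8) = (\<Sum>n. ?t (n + 2))"
        by (simp add: numeral_2_eq_2)
      have le: "norm (?t (n + 2)) \<le> (9/10) ^ 3 * (1 / real (n + 3) ^ 3)" for n
      proof -
        have "norm (?t (n + 2)) = (9/10) ^ (n + 3) / real (n + 3) ^ 3"
          by (simp add: power_abs abs_mult eval_nat_numeral abs_divide)
        also have "(9/10::real) ^ (n + 3) \<le> (9/10) ^ 3" by (rule power_decreasing) auto
        finally show ?thesis by (simp add: divide_right_mono)
      qed
      have "norm (\<Sum>n. ?t (n + 2)) \<le> (\<Sum>n. (9/10) ^ 3 * (1 / real (n + 3) ^ 3))"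
        by (rule norm_suminf_le[OF le summable_mult[OF inverse_cubes_tail(1)]])
      also have "\<dots> = (9/10) ^ 3 * (\<Sum>n. 1 / real (n + 3) ^ 3)" by (rule suminf_mult[OF inverse_cubes_tail(1)])
      also have "\<dots> \<le> (9/10) ^ 3 * (1 / 12)" by (intro mult_left_mono inverse_cubes_tail(2)) auto
      finally show ?thesis unfolding eq by simp
    qed
    then have "- Li3 (-(9/10)::real) \<le> (9/10) ^ 3 * (1 / 12) - (-(9/10) + (9/10)\<^sup>2 / 8)"
      unfolding abs_le_iff by linarith
    then have "- Li3 (-(9/10)::real) \<le> 0.8595" by (simp add: power2_eq_square power3_eq_cube)
    moreover have "Li3 ((9/10)\<^sup>2 :: real) \<ge> 0.89"
    proof -
      have "(\<Sum>n<2. ((9/10)\<^sup>2) ^ Suc n / real (Suc n) ^ 3) \<le> Li3 ((9/10)\<^sup>2 :: real)"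
        unfolding Li3_def by (intro sum_le_suminf summable_norm_cancel[OF Li3_summable]) (auto simp: power2_eq_square)
      then show ?thesis by (simp add: numeral_2_eq_2 power2_eq_square)
    qed
    ultimately show "?g (9/10) \<le> 0" by simp
    have "\<bar>Li3 (-(1/2)::real) - -(1/2)\<bar> \<le> 5 / 24 * \<bar>-(1/2)\<bar>" "\<bar>Li3 (1/4::real) - 1/4\<bar> \<le> 5 / 24 * \<bar>1/4\<bar>"
      by (rule Li3_real_signs(1); simp)+
    then have "Li3 (-(1/2)::real) \<le> - (1/4)" "Li3 (1/4::real) \<le> 1/4 + 5/96" unfolding abs_le_iff by linarith+
    then have "Li3 (-(1/2)::real) \<le> - (19/48)" using \<open>\<bar>Li3 (-(1/2)::real) - -(1/2)\<bar> \<le> 5 / 24 * \<bar>-(1/2)\<bar>\<close> unfolding abs_le_iff by linarith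
    then show "0 \<le> ?g (1/2)" using \<open>Li3 (1/4::real) \<le> 1/4 + 5/96\<close> by (simp add: power2_eq_square)
    have "continuous_on {1/2..9/10} ?g"
    proof (intro continuous_intros continuous_on_compose2[OF continuous_on_Li3_real])
      show "(\<lambda>r. r\<^sup>2) ` {1/2..9/10} \<subseteq> {-1<..<1::real}"
      proof (rule image_subsetI)
        fix r :: real assume "r \<in> {1/2..9/10}"
        then have "r\<^sup>2 < 1" by (intro sq) auto
        moreover have "r\<^sup>2 \<ge> 0" by simp
        ultimately show "r\<^sup>2 \<in> {-1<..<1}" unfolding greaterThanLessThan_iff by linarith
      qed
    qed auto
    then show "continuous_on {1/2..9/10} ?g" .
  qed simp
  then obtain r :: real where r: "1/2 \<le> r" "r \<le> 9/10" "- Li3 (- r) = Li3 (r\<^sup>2)" by auto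
  have in_r: "complex_of_real (- r) \<in> level_set" unfolding level_set_real_iff using r by simp
  \<comment> \<open>At a crossing point \<open>s\<close> the two quotients agree; to its left the
    increasing one is no larger and the decreasing one is strictly larger.\<close>
  have cmp: "Li3 (t\<^sup>2) < - Li3 (- t)" if "0 < t" "t < s" "s < 1" "- Li3 (- s) = Li3 (s\<^sup>2)" for s t :: real
  proof -
    have "Li3 (t\<^sup>2) / t\<^sup>2 \<le> Li3 (s\<^sup>2) / s\<^sup>2" using that by (intro Li3_square_increasing) auto
    also have "\<dots> = - Li3 (- s) / s\<^sup>2" using that by simp
    also have "\<dots> < - Li3 (- t) / t\<^sup>2" using that by (intro minus_Li3_minus_decreasing) auto
    finally have "Li3 (t\<^sup>2) / t\<^sup>2 < - Li3 (- t) / t\<^sup>2" .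
    then show ?thesis using that by (subst (asm) divide_less_cancel) auto
  qed
  have uniq: "x = - r" if "complex_of_real x \<in> level_set" for x
  proof -
    have x: "-1 < x" "x < 0" "- Li3 x = Li3 (x\<^sup>2)" using that unfolding level_set_real_iff by auto
    show ?thesis
    proof (rule ccontr)
      assume "x \<noteq> - r"
      then consider "- x < r" | "r < - x" by linarith
      then show False
      proof cases
        case 1 then show False using cmp[of "- x" r] r x by simp
      next
        case 2 then show False using cmp[of r "- x"] r x by simp
      qed
    qed
  qed
  have xs: "x_star = - r" unfolding x_star_def using in_r uniq by (rule the_equality)
  show "-1 < x_star" "x_star < 0" "complex_of_real x_star \<in> level_set" using xs r in_r by auto
  show "x = x_star" if "complex_of_real x \<in> level_set" for x using uniq[OF that] xs by simp
  show "Li3 (x\<^sup>2) < \<bar>Li3 x\<bar>" if "x_star < x" "x < 0" for x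
    using cmp[of "- x" r] r that xs by simp
qed

section \<open>Contributions of the arcs\<close>

lemma pp_log_continuous:
  fixes x :: complex assumes "norm x < 1" "\<sigma> > 0"
  shows "continuous_on S (\<lambda>\<theta>. pp_log x (exp (- Complex \<sigma> \<theta>)))"
    "continuous_on S (\<lambda>\<theta>. pp_log x (- exp (- Complex \<sigma> \<theta>)))"
proof -
  have c: "continuous_on (ball 0 1) (pp_log x)"
    using pp_log_holomorphic_2[OF assms(1)] by (rule holomorphic_on_imp_continuous_on)
  show "continuous_on S (\<lambda>\<theta>. pp_log x (exp (- Complex \<sigma> \<theta>)))"
    "continuous_on S (\<lambda>\<theta>. pp_log x (- exp (- Complex \<sigma> \<theta>)))"
    using assms(2) by (auto intro!: continuous_on_compose2[OF c] continuous_intros)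
qed

lemma sin_ge_half: "0 \<le> d \<Longrightarrow> d \<le> 1 \<Longrightarrow> d / 2 \<le> sin (d::real)"
proof -
  assume d: "0 \<le> d" "d \<le> 1"
  have "sin 0 - 0 / 2 \<le> sin d - d / 2"
  proof (rule DERIV_nonneg_imp_nondecreasing[OF d(1)])
    fix y assume y: "0 \<le> y" "y \<le> d"
    have "cos (pi / 3) \<le> cos y" using y d pi_gt3 by (intro cos_monotone_0_pi_le) auto
    then have "cos y - 1 / 2 \<ge> 0" by (simp add: cos_60)
    moreover have "((\<lambda>y. sin y - y / 2) has_real_derivative cos y - 1 / 2) (at y)"
      by (auto intro!: derivative_eq_intros)
    ultimately show "\<exists>D. ((\<lambda>y. sin y - y / 2) has_real_derivative D) (at y) \<and> 0 \<le> D" by blast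
  qed
  then show ?thesis by simp
qed

lemma abs_sin_ge_off_major_arcs:
  assumes d: "0 \<le> d" "d \<le> 1"
    and \<theta>: "\<theta> \<in> {-pi/2..-d} \<union> {d..pi - d} \<union> {pi + d..3*pi/2}"
  shows "d / 2 \<le> \<bar>sin \<theta>\<bar>"
proof -
  have mono: "d / 2 \<le> sin y" if "d \<le> y" "y \<le> pi / 2" for y
    using sin_ge_half[OF d] sin_monotone_2pi_le[of d y] that d pi_gt3 by linarith
  consider "d \<le> - \<theta>" "- \<theta> \<le> pi / 2" | "d \<le> \<theta>" "\<theta> \<le> pi / 2" | "d \<le> pi - \<theta>" "pi - \<theta> \<le> pi / 2" | "d \<le> \<theta> - pi" "\<theta> - pi \<le> pi / 2"
    using \<theta> by fastforce
  then show ?thesis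
  proof cases
    case 1 then show ?thesis using mono[of "- \<theta>"] by simp
  next
    case 2 then show ?thesis using mono[of \<theta>] by simp
  next
    case 3 then show ?thesis using mono[of "pi - \<theta>"] by simp
  next
    case 4 then show ?thesis using mono[of "\<theta> - pi"] by (simp add: sin_diff)
  qed
qed

text \<open>The half-width is \<open>24 \<sigma>\<close> because \<open>sin d >= d/2\<close> for
  \<open>d <= 1\<close> turns it into the \<open>12 \<sigma>\<close> of the minor arc bound. The arc
  around \<open>pi\<close> is moved to 0, where \<open>u\<close> becomes \<open>-u\<close> and
  \<open>exp (n i pi)\<close> gives the sign.\<close>

lemma circle_split:
  fixes x :: complex
  assumes x: "norm x < 1" and \<sigma>: "\<sigma> > 0" "24 * \<sigma> \<le> 1" and n: "n \<ge> 1"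
  obtains R where
    "2 * of_real pi * pp_poly n x =
       integral {- (24 * \<sigma>)..24 * \<sigma>} (\<lambda>\<theta>. exp (pp_log x (exp (- Complex \<sigma> \<theta>)) + of_nat n * Complex \<sigma> \<theta>))
     + (-1) ^ n * integral {- (24 * \<sigma>)..24 * \<sigma>} (\<lambda>\<theta>. exp (pp_log x (- exp (- Complex \<sigma> \<theta>)) + of_nat n * Complex \<sigma> \<theta>)) + R"
    "norm R \<le> 2 * pi * exp (35 / 384 * norm x / \<sigma>\<^sup>2 + real n * \<sigma>)"
proof -
  define d where "d = 24 * \<sigma>"
  have d: "0 \<le> d" "d \<le> 1" "d / 2 = 12 * \<sigma>" using \<sigma> by (auto simp: d_def)
  let ?f = "\<lambda>\<theta>. exp (pp_log x (exp (- Complex \<sigma> \<theta>)) + of_nat n * Complex \<sigma> \<theta>)"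
  let ?g = "\<lambda>\<theta>. exp (pp_log x (- exp (- Complex \<sigma> \<theta>)) + of_nat n * Complex \<sigma> \<theta>)"
  have cf: "continuous_on S ?f" "continuous_on S ?g" for S
    by (intro continuous_intros pp_log_continuous x \<sigma>)+
  then have int: "?f integrable_on {a..b}" for a b by (intro integrable_continuous_real)
  let ?I = "\<lambda>a b. integral {a..b} ?f"
  have "2 * of_real pi * pp_poly n x = ?I (-pi/2) (3*pi/2)"
    using pp_poly_integral[OF x \<sigma>(1) n] by (simp add: integral_unique)
  also have "\<dots> = ?I (-pi/2) (-d) + (?I (-d) d + (?I d (pi - d) + (?I (pi - d) (pi + d) + ?I (pi + d) (3*pi/2))))"
    using d pi_gt3 by (simp add: Henstock_Kurzweil_Integration.integral_combine int)
  also have "?I (pi - d) (pi + d) = (-1) ^ n * integral {-d..d} ?g"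
  proof -
    have "(?f has_integral ?I (pi - d) (pi + d)) (cbox (pi - d) (pi + d))" using int by (simp add: integrable_integral)
    from has_integral_affinity[OF this, of 1 pi]
    have "((\<lambda>\<theta>. ?f (\<theta> + pi)) has_integral ?I (pi - d) (pi + d)) ((\<lambda>x. x - pi) ` {pi - d..pi + d})" by simp
    also have "(\<lambda>x. x - pi) ` {pi - d..pi + d} = {-d..d}"
      using image_affinity_atLeastAtMost[of 1 "- pi" "pi - d" "pi + d"] d by simp
    finally have h: "((\<lambda>\<theta>. ?f (\<theta> + pi)) has_integral ?I (pi - d) (pi + d)) {-d..d}" .
    have fg: "?f (\<theta> + pi) = (-1) ^ n * ?g \<theta>" for \<theta>
    proof -
      have C: "Complex \<sigma> (\<theta> + pi) = Complex \<sigma> \<theta> + \<i> * of_real pi" by (simp add: complex_eq_iff)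
      have e1: "exp (- Complex \<sigma> (\<theta> + pi)) = - exp (- Complex \<sigma> \<theta>)"
        unfolding C by (simp add: exp_diff)
      have "exp (of_nat n * (\<i> * of_real pi)) = (-1) ^ n"
        by (subst exp_of_nat_mult) simp
      then show ?thesis unfolding e1 unfolding C by (simp add: exp_add distrib_left mult_ac)
    qed
    show ?thesis using integral_unique[OF h] unfolding fg integral_mult_right by simp
  qed
  finally have eq: "2 * of_real pi * pp_poly n x = ?I (-d) d + (-1) ^ n * integral {-d..d} ?g +
     (?I (-pi/2) (-d) + ?I d (pi - d) + ?I (pi + d) (3*pi/2))" by (simp add: algebra_simps)
  let ?B = "exp (35 / 384 * norm x / \<sigma>\<^sup>2 + real n * \<sigma>)"
  have b: "norm (?f \<theta>) \<le> ?B" if "\<theta> \<in> {-pi/2..-d} \<union> {d..pi - d} \<union> {pi + d..3*pi/2}" for \<theta>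
  proof -
    have "12 * \<sigma> \<le> \<bar>sin \<theta>\<bar>" using abs_sin_ge_off_major_arcs[OF d(1,2) that] d(3) by simp
    from pp_log_minor_arc[OF x \<sigma>(1) this]
    have "Re (pp_log x (exp (- Complex \<sigma> \<theta>))) \<le> 35 / 384 * norm x / \<sigma>\<^sup>2"
      using complex_Re_le_cmod order_trans by blast
    then show ?thesis by (simp add: norm_exp_eq_Re)
  qed
  have "norm (?I (-pi/2) (-d) + ?I d (pi - d) + ?I (pi + d) (3*pi/2)) \<le>
      ?B * (-d - (-pi/2)) + ?B * (pi - d - d) + ?B * (3*pi/2 - (pi + d))"
    using d pi_gt3 by (intro order_trans[OF norm_triangle_ineq] add_mono integral_bound cf b) auto
  also have "\<dots> = ?B * (2 * pi - 4 * d)" by (simp add: algebra_simps)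
  also have "\<dots> \<le> ?B * (2 * pi)" using d by (intro mult_left_mono) auto
  finally have "norm (?I (-pi/2) (-d) + ?I d (pi - d) + ?I (pi + d) (3*pi/2)) \<le> 2 * pi * ?B" by (simp add: mult.commute)
  with eq show ?thesis unfolding d_def by (rule that)
qed

lemma csqrt_of_real_square_mult: "\<rho> > 0 \<Longrightarrow> csqrt (of_real (\<rho>\<^sup>2) * z) = of_real \<rho> * csqrt z"
  using csqrt_principal[of z]
  by (intro csqrt_unique) (auto simp: power_mult_distrib zero_less_mult_iff)

lemma cmod_csqrt_eq: "norm (csqrt z) = sqrt (norm z)"
  by (metis abs_norm_cancel norm_power power2_csqrt real_sqrt_abs)

text \<open>Under \<open>\<theta> = \<sigma> t\<close> the relations
  \<open>n \<sigma> = \<nu>\<close> and \<open>\<sigma>^2 \<nu> = (Re L)^3\<close> turn the exponent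
  into \<open>\<nu>\<close> times the normalised phase with \<open>a = L / Re L\<close>. The factor
  \<open>Y\<close> has modulus at least \<open>1 / sqrt \<nu>\<close>, so an absolute error of order
  \<open>1/\<nu>\<close> is a relative error of order \<open>1 / sqrt \<nu>\<close>, that is
  \<open>n^(-1/3)\<close>. The ends \<open>p\<close> and \<open>q\<close> are free because one
  application uses only half an arc.\<close>

lemma arc_contribution:
  fixes L K :: complex and G :: "real \<Rightarrow> complex" and n :: nat
  defines "\<sigma> \<equiv> Re L * real n powr (-1/3)" and "\<nu> \<equiv> Re L * real n powr (2/3)" and "\<tau> \<equiv> Im L / Re L"
  assumes L: "Re L > 0" "\<bar>Im L\<bar> \<le> 2 * Re L" and n: "n \<ge> 1"
    and s: "s > 0" "p \<le> \<tau> - s" "\<tau> + s \<le> q"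
    and c: "c > 0" "\<And>t. t \<in> {p..q} \<Longrightarrow> c \<le> Re (saddle_kern \<tau> t)"
    and G: "continuous_on UNIV G" "E \<le> \<nu>"
      "\<And>t. t \<in> {p..q} \<Longrightarrow> norm (G (\<sigma> * t) - (L ^ 3 / 2 / (of_real \<sigma> * Complex 1 t)\<^sup>2 + K)) \<le> E / \<nu>"
  obtains e where
    "integral {\<sigma> * p..\<sigma> * q} (\<lambda>\<theta>. exp (G \<theta> + of_nat n * Complex \<sigma> \<theta>)) =
       2 * of_real pi * (exp K * csqrt (L / of_real (6 * pi * real n powr (4/3))) * exp (3/2 * of_real (real n powr (2/3)) * L) * (1 + e))"
    "norm e \<le> (3 * E * (q - p) + 8 * pi / c\<^sup>2 + 14 / s) / sqrt \<nu>"
proof -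
  let ?a = "Complex 1 \<tau>" and ?m = "real n"
  have n0: "?m > 0" using n by simp
  have \<sigma>: "\<sigma> > 0" and \<nu>: "\<nu> > 0" using L n0 by (auto simp: \<sigma>_def \<nu>_def)
  have La: "L = of_real (Re L) * ?a" using L by (simp add: complex_eq_iff \<tau>_def)
  have n\<sigma>: "?m * \<sigma> = \<nu>"
  proof -
    have "?m * ?m powr (-1/3) = ?m powr (2/3)" using powr_mult_base[of ?m "-1/3"] n0 by simp
    then show ?thesis by (simp add: \<sigma>_def \<nu>_def mult_ac)
  qed
  have \<sigma>2\<nu>: "\<sigma>\<^sup>2 * \<nu> = Re L ^ 3"
  proof -
    have "?m powr (-1/3) * ?m powr (-1/3) * ?m powr (2/3) = 1" using n0 by (simp add: powr_add[symmetric])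
    then show ?thesis by (simp add: \<sigma>_def \<nu>_def power2_eq_square power3_eq_cube mult_ac)
  qed
  let ?P = "csqrt (2 * of_real pi * ?a / 3)"
  have "\<bar>\<tau>\<bar> \<le> 2" using L by (simp add: \<tau>_def abs_divide divide_le_eq)
  moreover have "L ^ 3 / 2 / (of_real \<sigma> * Complex 1 t)\<^sup>2 = of_real \<nu> * (?a ^ 3 / (2 * (Complex 1 t)\<^sup>2))" for t
  proof -
    have "L ^ 3 = of_real (Re L ^ 3) * ?a ^ 3" using arg_cong[OF La, of "\<lambda>z. z ^ 3"] by (simp add: power_mult_distrib)
    also have "\<dots> = of_real (\<sigma>\<^sup>2 * \<nu>) * ?a ^ 3" unfolding \<sigma>2\<nu> ..
    finally show ?thesis using \<sigma> by (simp add: power_mult_distrib)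
  qed
  moreover have "continuous_on {p..q} (\<lambda>t. G (\<sigma> * t))"
    by (intro continuous_on_compose2[OF G(1)] continuous_intros) auto
  ultimately have saddle: "norm (integral {p..q} (\<lambda>t. exp (G (\<sigma> * t) + of_real \<nu> * Complex 1 t))
      - exp (K + 3 / 2 * of_real \<nu> * ?a) * (?P / of_real (sqrt \<nu>)))
    \<le> norm (exp (K + 3 / 2 * of_real \<nu> * ?a)) * ((3 * E * (q - p) + 8 * pi / c\<^sup>2 + 14 / s) / \<nu>)"
    using G by (intro saddle_arc_integral s c \<nu>) auto
  define J where "J = integral {p..q} (\<lambda>t. exp (G (\<sigma> * t) + of_real \<nu> * Complex 1 t))"
  define V where "V = exp (K + 3 / 2 * of_real \<nu> * ?a)"
  define Y where "Y = ?P / of_real (sqrt \<nu>)"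
  define e where "e = (J - V * Y) / (V * Y)"
  have V0: "V \<noteq> 0" by (simp add: V_def)
  have nP: "norm ?P \<ge> 1"
  proof -
    have "norm ?P ^ 2 = norm (2 * of_real pi * ?a / 3)" by (simp flip: norm_power)
    also have "\<dots> = 2 * pi / 3 * norm ?a" by (simp add: norm_mult norm_divide)
    also have "\<dots> \<ge> 1 * 1" using pi_gt3 norm_Complex_1_ge by (intro mult_mono) auto
    finally have "norm ?P ^ 2 \<ge> 1 ^ 2" by simp
    then show ?thesis by (rule power2_le_imp_le) simp
  qed
  then have Y0: "Y \<noteq> 0" using \<nu> by (auto simp: Y_def)
  have J: "J = V * Y * (1 + e)" using V0 Y0 by (simp add: e_def field_simps)
  have ne: "norm e \<le> (3 * E * (q - p) + 8 * pi / c\<^sup>2 + 14 / s) / sqrt \<nu>"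
  proof -
    let ?C = "3 * E * (q - p) + 8 * pi / c\<^sup>2 + 14 / s"
    have s1: "norm (J - V * Y) \<le> norm V * (?C / \<nu>)" using saddle unfolding J_def V_def Y_def .
    then have C0: "?C \<ge> 0"
      using V0 \<nu> norm_ge_zero[of "J - V * Y"] by (smt (verit, best) divide_nonneg_pos mult_pos_neg divide_neg_pos zero_less_norm_iff)
    have nY: "norm Y \<ge> 1 / sqrt \<nu>" unfolding Y_def norm_divide using nP \<nu> by (simp add: divide_right_mono)
    have "norm e = norm (J - V * Y) / (norm V * norm Y)" by (simp add: e_def norm_divide norm_mult)
    also have "\<dots> \<le> norm V * (?C / \<nu>) / (norm V * (1 / sqrt \<nu>))"
      using s1 nY V0 \<nu> C0 by (intro frac_le mult_left_mono) auto
    also have "\<dots> = ?C / \<nu> * sqrt \<nu>" using V0 by simp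
    also have "\<dots> = ?C / sqrt \<nu>"
    proof -
      have "D / \<nu> * sqrt \<nu> = D / sqrt \<nu>" for D using \<nu> by (simp add: field_simps)
      then show ?thesis .
    qed
    finally show ?thesis .
  qed
  have scale: "integral {\<sigma> * p..\<sigma> * q} (\<lambda>\<theta>. exp (G \<theta> + of_nat n * Complex \<sigma> \<theta>)) = of_real \<sigma> * J"
  proof -
    let ?h = "\<lambda>\<theta>. exp (G \<theta> + of_nat n * Complex \<sigma> \<theta>)"
    have "?h integrable_on {\<sigma> * p..\<sigma> * q}"
      by (intro integrable_continuous_real continuous_intros continuous_on_subset[OF G(1)]) auto
    then have "(?h has_integral integral {\<sigma> * p..\<sigma> * q} ?h) (cbox (\<sigma> * p) (\<sigma> * q))" by (simp add: integrable_integral)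
    from has_integral_affinity[OF this, of \<sigma> 0] \<sigma>
    have "((\<lambda>t. ?h (\<sigma> * t)) has_integral (1 / \<sigma>) *\<^sub>R integral {\<sigma> * p..\<sigma> * q} ?h) ((\<lambda>x. x / \<sigma>) ` {\<sigma> * p..\<sigma> * q})" by simp
    also have "(\<lambda>x. x / \<sigma>) ` {\<sigma> * p..\<sigma> * q} = {p..q}"
      using \<sigma> s by (subst image_divide_atLeastAtMost) auto
    finally have "((\<lambda>t. ?h (\<sigma> * t)) has_integral (1 / \<sigma>) *\<^sub>R integral {\<sigma> * p..\<sigma> * q} ?h) {p..q}" .
    moreover have "?h (\<sigma> * t) = exp (G (\<sigma> * t) + of_real \<nu> * Complex 1 t)" for t
    proof -
      have "of_nat n * Complex \<sigma> (\<sigma> * t) = of_real \<nu> * Complex 1 t"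
        unfolding n\<sigma>[symmetric] by (simp add: complex_eq_iff)
      then show ?thesis by simp
    qed
    ultimately have "J = (1 / \<sigma>) *\<^sub>R integral {\<sigma> * p..\<sigma> * q} ?h" unfolding J_def by (simp add: integral_unique)
    then show ?thesis using \<sigma> by (simp add: scaleR_conv_of_real)
  qed
  \<comment> \<open>Collects the Jacobian \<open>\<sigma>\<close>, the factor \<open>2 pi\<close>
    and \<open>sqrt \<nu>\<close>. Only its positive square is moved under the principal root, which
    does not change the branch.\<close>
  define \<rho> where "\<rho> = \<sigma> / (2 * pi * sqrt \<nu>)"
  have \<rho>: "\<rho> > 0" using \<sigma> \<nu> by (simp add: \<rho>_def)
  have csq: "csqrt (L / of_real (6 * pi * ?m powr (4/3))) = of_real \<rho> * ?P"
  proof -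
    have "\<rho>\<^sup>2 = \<sigma>\<^sup>2 / (4 * pi\<^sup>2 * \<nu>)" using \<nu> by (simp add: \<rho>_def power_divide power_mult_distrib)
    also have "\<dots> = Re L / (4 * pi\<^sup>2 * ?m powr (4/3))"
    proof -
      have "?m powr (4/3) * (?m powr (-1/3) * ?m powr (-1/3)) = ?m powr (2/3)" using n0 by (simp add: powr_add[symmetric])
      then show ?thesis using L n0 by (simp add: \<sigma>_def \<nu>_def power2_eq_square field_simps)
    qed
    finally have "\<rho>\<^sup>2 = Re L / (4 * pi\<^sup>2 * ?m powr (4/3))" .
    then have "\<rho>\<^sup>2 * (2 * pi / 3) = Re L / (6 * pi * ?m powr (4/3))"
      by (simp add: power2_eq_square field_simps)
    moreover have "of_real (\<rho>\<^sup>2) * (2 * of_real pi * ?a / 3) = of_real (\<rho>\<^sup>2 * (2 * pi / 3)) * ?a" by simp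
    ultimately have "of_real (\<rho>\<^sup>2) * (2 * of_real pi * ?a / 3) = (of_real (Re L) * ?a) / of_real (6 * pi * ?m powr (4/3))"
      by (simp only: of_real_divide times_divide_eq_left)
    then show ?thesis using csqrt_of_real_square_mult[OF \<rho>, of "2 * of_real pi * ?a / 3"] by (simp only: La[symmetric])
  qed
  have "integral {\<sigma> * p..\<sigma> * q} (\<lambda>\<theta>. exp (G \<theta> + of_nat n * Complex \<sigma> \<theta>)) =
     2 * of_real pi * (exp K * csqrt (L / of_real (6 * pi * ?m powr (4/3))) * exp (3/2 * of_real (?m powr (2/3)) * L) * (1 + e))"
  proof -
    have V: "V = exp K * exp (3/2 * of_real (?m powr (2/3)) * L)"
    proof -
      have "of_real \<nu> * ?a = of_real (?m powr (2/3)) * L"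
        using arg_cong[OF La, of "\<lambda>z. of_real (?m powr (2/3)) * z"] by (simp only: \<nu>_def of_real_mult mult_ac)
      then show ?thesis by (simp add: V_def exp_add mult.assoc)
    qed
    have "of_real \<sigma> * Y = 2 * of_real pi * (of_real \<rho> * ?P)" by (simp add: Y_def \<rho>_def)
    then show ?thesis unfolding scale J csq V by (simp add: mult_ac)
  qed
  then show ?thesis using ne by (rule that)
qed

lemma exp_minus_le_square: "y > 0 \<Longrightarrow> exp (- y) \<le> 2 / (y::real)\<^sup>2"
  using exp_lower_Taylor_quadratic[of y] by (simp add: exp_minus field_simps)

text \<open>Besides \<open>exp (3/2 \<nu>)\<close>, with \<open>\<nu> = Re L n^(2/3)\<close>, the
  main term \<open>M\<close> only has a factor of order \<open>n^(-2/3)\<close>. A saving of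
  \<open>exp (- \<epsilon> \<nu>)\<close> therefore leaves
  \<open>n^(2/3) exp (- \<epsilon> \<nu>)\<close>, and \<open>exp (- y) <= 2 / y^2\<close> makes
  this \<open>O(n^(-2/3))\<close>. The lower bounds \<open>\<alpha>\<close> and \<open>k\<close>
  carry the uniformity in \<open>x\<close>.\<close>

lemma remainder_bound:
  fixes L K R :: complex and n :: nat
  defines "M \<equiv> exp K * csqrt (L / of_real (6 * pi * real n powr (4/3))) * exp (3/2 * of_real (real n powr (2/3)) * L)"
  assumes \<alpha>: "0 < \<alpha>" "\<alpha> \<le> Re L" and k: "k \<le> Re K" and \<epsilon>: "\<epsilon> > 0" and n: "n \<ge> 1" and B: "B \<ge> 0"
    and R: "norm R \<le> B * exp ((3/2 - \<epsilon>) * (Re L * real n powr (2/3)))"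
  shows "norm (R / M) \<le> B * (2 * sqrt (6 * pi / \<alpha>) * exp (- k) / (\<epsilon> * \<alpha>)\<^sup>2) * real n powr (-1/3)"
proof -
  let ?m = "real n" and ?\<nu> = "Re L * real n powr (2/3)"
  have n0: "?m > 0" using n by simp
  have \<nu>: "?\<nu> \<ge> \<alpha> * ?m powr (2/3)" using \<alpha> by (intro mult_right_mono) auto
  have a0: "\<alpha> * ?m powr (2/3) > 0" using \<alpha> n0 by simp
  have "norm M = exp (Re K) * sqrt (norm (L / of_real (6 * pi * ?m powr (4/3)))) * exp (3/2 * ?\<nu>)"
    by (simp add: M_def norm_mult cmod_csqrt_eq mult_ac)
  also have "\<dots> \<ge> exp k * sqrt (\<alpha> / (6 * pi * ?m powr (4/3))) * exp (3/2 * ?\<nu>)"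
  proof (intro mult_right_mono mult_mono)
    have "\<alpha> \<le> norm L" using \<alpha> complex_Re_le_cmod[of L] by linarith
    then have "\<alpha> / (6 * pi * ?m powr (4/3)) \<le> norm L / (6 * pi * ?m powr (4/3))"
      by (intro divide_right_mono) auto
    then show "sqrt (\<alpha> / (6 * pi * ?m powr (4/3))) \<le> sqrt (norm (L / of_real (6 * pi * ?m powr (4/3))))"
      using n0 by (simp add: norm_divide norm_mult)
  qed (use k \<alpha> n0 in auto)
  finally have M: "norm M \<ge> exp k * sqrt (\<alpha> / (6 * pi * ?m powr (4/3))) * exp (3/2 * ?\<nu>)" .
  have sq: "sqrt (\<alpha> / (6 * pi * ?m powr (4/3))) = 1 / (sqrt (6 * pi / \<alpha>) * ?m powr (2/3))"
  proof -
    have "sqrt (?m powr (4/3)) = ?m powr (2/3)"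
      using n0 by (simp add: powr_half_sqrt[symmetric] powr_powr)
    then show ?thesis using \<alpha> by (simp add: real_sqrt_divide real_sqrt_mult field_simps)
  qed
  have pos: "exp k * sqrt (\<alpha> / (6 * pi * ?m powr (4/3))) * exp (3/2 * ?\<nu>) > 0" using \<alpha> n0 by simp
  have "norm (R / M) \<le> (B * exp ((3/2 - \<epsilon>) * ?\<nu>)) / (exp k * sqrt (\<alpha> / (6 * pi * ?m powr (4/3))) * exp (3/2 * ?\<nu>))"
    unfolding norm_divide using R M pos B by (intro frac_le) auto
  also have "\<dots> = B * (sqrt (6 * pi / \<alpha>) * exp (- k)) * (?m powr (2/3) * exp (- (\<epsilon> * ?\<nu>)))"
  proof -
    have "exp ((3/2 - \<epsilon>) * ?\<nu>) = exp (3/2 * ?\<nu>) * exp (- (\<epsilon> * ?\<nu>))" by (simp add: exp_add[symmetric] algebra_simps)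
    then show ?thesis unfolding sq by (simp add: exp_minus field_simps)
  qed
  also have "\<dots> \<le> B * (sqrt (6 * pi / \<alpha>) * exp (- k)) * (?m powr (2/3) * (2 / (\<epsilon> * (\<alpha> * ?m powr (2/3)))\<^sup>2))"
  proof (intro mult_left_mono)
    let ?y = "\<epsilon> * (\<alpha> * ?m powr (2/3))"
    have y: "?y > 0" using \<epsilon> a0 by simp
    have "exp (- (\<epsilon> * ?\<nu>)) \<le> exp (- ?y)" using \<nu> \<epsilon> by simp
    also have "\<dots> \<le> 2 / ?y\<^sup>2" by (rule exp_minus_le_square[OF y])
    finally show "exp (- (\<epsilon> * ?\<nu>)) \<le> 2 / (\<epsilon> * (\<alpha> * ?m powr (2/3)))\<^sup>2" .
  qed (use B \<alpha> in auto)
  also have "?m powr (2/3) * (2 / (\<epsilon> * (\<alpha> * ?m powr (2/3)))\<^sup>2) = 2 / (\<epsilon> * \<alpha>)\<^sup>2 * ?m powr (-2/3)"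
    using n0 by (simp add: power_mult_distrib power2_eq_square powr_minus_divide field_simps)
  also have "B * (sqrt (6 * pi / \<alpha>) * exp (- k)) * (2 / (\<epsilon> * \<alpha>)\<^sup>2 * ?m powr (-2/3)) \<le>
      B * (sqrt (6 * pi / \<alpha>) * exp (- k)) * (2 / (\<epsilon> * \<alpha>)\<^sup>2 * ?m powr (-1/3))"
    using n B \<alpha> by (intro mult_left_mono powr_mono) auto
  finally show ?thesis by (simp add: mult_ac)
qed


section \<open>Scales and constants common to all points of a compact set\<close>

lemma scaling_relations:
  fixes L :: complex and n :: nat
  defines "\<sigma> \<equiv> Re L * real n powr (-1/3)" and "\<nu> \<equiv> Re L * real n powr (2/3)"
  assumes "Re L > 0" "n \<ge> 1"
  shows "\<sigma> > 0" "\<nu> > 0" "\<sigma>\<^sup>2 * \<nu> = Re L ^ 3" "real n * \<sigma> = \<nu>"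
proof -
  have n0: "real n > 0" using assms by simp
  show "\<sigma> > 0" "\<nu> > 0" using assms n0 by (auto simp: \<sigma>_def \<nu>_def)
  have "real n powr (-1/3) * real n powr (-1/3) * real n powr (2/3) = 1" using n0 by (simp add: powr_add[symmetric])
  then show "\<sigma>\<^sup>2 * \<nu> = Re L ^ 3" by (simp add: \<sigma>_def \<nu>_def power2_eq_square power3_eq_cube mult_ac)
  have "real n * real n powr (-1/3) = real n powr (2/3)" using powr_mult_base[of "real n" "-1/3"] n0 by simp
  then show "real n * \<sigma> = \<nu>" by (simp add: \<sigma>_def \<nu>_def mult_ac)
qed

text \<open>577 = 1 + 24^2: on the arc \<open>|w|^2 <= 577 \<sigma>^2\<close>, and
  \<open>\<sigma>^2 = (Re L)^3 / \<nu>\<close> converts the expansion error \<open>C |w|^2\<close>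
  into \<open>E / \<nu>\<close>.\<close>

lemma arc_point:
  fixes L :: complex and n :: nat
  defines "\<sigma> \<equiv> Re L * real n powr (-1/3)" and "\<nu> \<equiv> Re L * real n powr (2/3)"
  assumes L: "Re L > 0" and n: "n \<ge> 1" and t: "\<bar>t\<bar> \<le> 24" and C: "C \<ge> 0" "577 * C * Re L ^ 3 \<le> E"
  shows "of_real \<sigma> * Complex 1 t = Complex \<sigma> (\<sigma> * t)" "Re (Complex \<sigma> (\<sigma> * t)) > 0"
    "\<bar>Im (Complex \<sigma> (\<sigma> * t))\<bar> \<le> 24 * Re (Complex \<sigma> (\<sigma> * t))" "C * norm (Complex \<sigma> (\<sigma> * t)) ^ 2 \<le> E / \<nu>"
proof -
  note sc = scaling_relations[OF L n, folded \<sigma>_def \<nu>_def]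
  show "of_real \<sigma> * Complex 1 t = Complex \<sigma> (\<sigma> * t)" by (simp add: complex_eq_iff)
  show "Re (Complex \<sigma> (\<sigma> * t)) > 0" using sc by simp
  show "\<bar>Im (Complex \<sigma> (\<sigma> * t))\<bar> \<le> 24 * Re (Complex \<sigma> (\<sigma> * t))" using sc t by (simp add: abs_mult)
  have "t\<^sup>2 \<le> 24\<^sup>2" using power_mono[OF t, of 2] by simp
  then have "norm (Complex \<sigma> (\<sigma> * t)) ^ 2 \<le> 577 * \<sigma>\<^sup>2"
    using mult_left_mono[of "t\<^sup>2" "24\<^sup>2" "\<sigma>\<^sup>2"] by (simp add: cmod_power2 power_mult_distrib)
  then have "C * norm (Complex \<sigma> (\<sigma> * t)) ^ 2 \<le> C * (577 * \<sigma>\<^sup>2)" using C by (intro mult_left_mono)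
  also have "\<dots> = 577 * C * Re L ^ 3 / \<nu>" unfolding sc(3)[symmetric] using sc(2) by simp
  also have "\<dots> \<le> E / \<nu>" using C sc by (intro divide_right_mono) auto
  finally show "C * norm (Complex \<sigma> (\<sigma> * t)) ^ 2 \<le> E / \<nu>" .
qed

text \<open>As 35/384 = 35/76 * 38/192, the logarithm contributes at most
  \<open>35/76 \<nu>\<close>, and \<open>n \<sigma>\<close> contributes \<open>\<nu>\<close>. The
  total \<open>111/76 \<nu>\<close> falls short of \<open>3/2 \<nu>\<close> by
  \<open>3/76 \<nu>\<close>.\<close>

lemma minor_exponent:
  assumes x: "0 < norm x" "norm x < 1" and n: "n \<ge> 1"
  defines "\<sigma> \<equiv> Re (L_phase 1 x) * real n powr (-1/3)" and "\<nu> \<equiv> Re (L_phase 1 x) * real n powr (2/3)"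
  shows "35 / 384 * norm x / \<sigma>\<^sup>2 + real n * \<sigma> \<le> (3/2 - 3/76) * \<nu>"
proof -
  note sc = scaling_relations[OF Re_L_phase_1_ge(2)[OF x] n, folded \<sigma>_def \<nu>_def]
  have "38 / 192 * norm x \<le> \<sigma>\<^sup>2 * \<nu>" unfolding sc(3) by (rule Re_L_phase_1_ge(5)[OF x])
  then have "35 / 384 * norm x \<le> 35 / 76 * \<nu> * \<sigma>\<^sup>2" by (simp add: mult_ac)
  then have "35 / 384 * norm x / \<sigma>\<^sup>2 \<le> 35 / 76 * \<nu>" using sc by (simp add: divide_le_eq)
  then show ?thesis unfolding sc(4) by (simp add: algebra_simps)
qed

lemma eventually_large:
  fixes \<alpha>0 \<alpha>1 E :: real assumes "\<alpha>0 > 0"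
  shows "\<forall>\<^sub>F n in sequentially. n \<ge> 1 \<and> 24 * (\<alpha>1 * real n powr (-1/3)) \<le> 1 \<and> E \<le> \<alpha>0 * real n powr (2/3)"
proof -
  have "(\<lambda>n. real n powr (-1/3)) \<longlonglongrightarrow> 0" by real_asymp
  then have "(\<lambda>n. 24 * (\<alpha>1 * real n powr (-1/3))) \<longlonglongrightarrow> 0" by (intro tendsto_mult_right_zero)
  then have "\<forall>\<^sub>F n in sequentially. 24 * (\<alpha>1 * real n powr (-1/3)) < 1" by (rule order_tendstoD) simp
  moreover have "filterlim (\<lambda>n. real n powr (2/3)) at_top sequentially" by real_asymp
  then have "\<forall>\<^sub>F n in sequentially. E / \<alpha>0 \<le> real n powr (2/3)" by (simp add: filterlim_at_top)
  ultimately show ?thesis using eventually_ge_at_top[of 1]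
    by eventually_elim (use assms in \<open>auto simp: divide_le_eq mult.commute\<close>)
qed

lemma inverse_sqrt_scale:
  assumes "\<alpha>0 > 0" "\<alpha>0 \<le> \<alpha>" "n \<ge> 1" "D \<ge> 0"
  shows "D / sqrt (\<alpha> * real n powr (2/3)) \<le> D / sqrt \<alpha>0 * real n powr (-1/3)"
proof -
  have n0: "real n > 0" using assms by simp
  have s: "sqrt (real n powr (2/3)) = real n powr (1/3)" using n0 by (simp add: powr_half_sqrt[symmetric] powr_powr)
  have "D / sqrt (\<alpha> * real n powr (2/3)) \<le> D / (sqrt \<alpha>0 * real n powr (1/3))"
    unfolding real_sqrt_mult s using assms n0 by (intro divide_left_mono mult_right_mono) auto
  also have "\<dots> = D / sqrt \<alpha>0 * real n powr (-1/3)" by (simp add: powr_minus_divide)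
  finally show ?thesis .
qed

lemma Re_saddle_kern_ge:
  assumes "\<delta> \<ge> 0" "\<delta> \<le> (t + \<tau>)\<^sup>2 + 3 - \<tau>\<^sup>2" "\<bar>t\<bar> \<le> 24"
  shows "\<delta> / (2 * 577\<^sup>2) \<le> Re (saddle_kern \<tau> t)"
proof -
  have "t\<^sup>2 \<le> 24\<^sup>2" using power_mono[OF assms(3), of 2] by simp
  then have "(1 + t\<^sup>2)\<^sup>2 \<le> 577\<^sup>2" by (intro power_mono) auto
  moreover have "1 + t\<^sup>2 > 0" by (simp add: add_pos_nonneg)
  ultimately show ?thesis unfolding Re_saddle_kern using assms by (intro frac_le) auto
qed

lemma continuous_on_L_phase:
  assumes "\<And>x. x \<in> X \<Longrightarrow> 0 < norm x \<and> norm x < 1 \<and> 2 * Li3 (x ^ k) \<notin> \<real>\<^sub>\<le>\<^sub>0" and k: "k \<ge> 1"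
  shows "continuous_on X (L_phase k)"
proof -
  have "continuous_on X (\<lambda>x. exp (Ln (2 * Li3 (x ^ k)) / 3) / of_nat k)"
    using assms k
    by (intro continuous_intros continuous_on_compose2[OF continuous_on_Li3_complex])
       (auto simp: norm_power power_less_one_iff)
  moreover have eq: "exp (Ln (2 * Li3 (x ^ k)) / 3) / of_nat k = L_phase k x" if "x \<in> X" for x
  proof -
    have "2 * Li3 (x ^ k) \<noteq> 0" using assms(1)[OF that] by (intro Li3_nz) (auto simp: norm_power power_le_one)
    then show ?thesis by (simp add: L_phase_def powr_def)
  qed
  ultimately show ?thesis using continuous_on_cong[OF refl eq, of X] by simp
qed

text \<open>The strict sector condition of the cube root, rewritten as the condition under which the
  numerator in \<open>Re_saddle_kern\<close> is positive for every \<open>t\<close>.\<close>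

lemma tau_bound:
  assumes "norm L < 2 * Re L" shows "0 < 3 - (Im L / Re L)\<^sup>2"
proof -
  have R: "Re L > 0" using assms norm_ge_zero[of L] by linarith
  have "norm L ^ 2 < (2 * Re L)\<^sup>2" using assms by (intro power_strict_mono) auto
  then have "(Im L)\<^sup>2 < 3 * (Re L)\<^sup>2" unfolding cmod_power2 by (simp add: power_mult_distrib)
  then show ?thesis using R by (simp add: power_divide divide_less_eq)
qed

lemma abs_le_of_tau:
  assumes "R > 0" "0 < 3 - (I / R)\<^sup>2" shows "\<bar>I\<bar> \<le> 2 * R" "\<bar>I / R\<bar> \<le> (2::real)"
proof -
  have "(I / R)\<^sup>2 \<le> 2\<^sup>2" using assms by simp
  then show "\<bar>I / R\<bar> \<le> 2" using abs_le_square_iff[of "I / R" 2] by simp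
  then show "\<bar>I\<bar> \<le> 2 * R" using assms by (simp add: abs_divide divide_le_eq)
qed

section \<open>The two asymptotic formulas\<close>

text \<open>Compactness of \<open>X\<close> supplies the uniform data: the radius \<open>r\<close>,
  bounds for \<open>Re L_1\<close>, and a positive \<open>\<delta>\<close> below
  \<open>3 - \<tau>^2\<close> for both phases. Without \<open>x_star\<close> every point is
  non-real, and by \<open>level_set_not_imaginary\<close> so is its square, which gives continuity
  and strictness. One \<open>\<sigma>\<close> and one \<open>\<nu>\<close> serve both arcs because
  the real parts agree.\<close>

lemma pp_poly_asymp_level_set:
  fixes X :: "complex set"
  assumes "compact X" "X \<subseteq> level_set - {complex_of_real x_star}"
  shows "\<exists>(E1 :: nat \<Rightarrow> complex \<Rightarrow> complex) (E2 :: nat \<Rightarrow> complex \<Rightarrow> complex) (C :: real).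
         \<forall>\<^sub>F n in sequentially. \<forall>x\<in>X.
         norm (E1 n x) \<le> C * real n powr (-1/3) \<and>
         norm (E2 n x) \<le> C * real n powr (-1/3) \<and>
         pp_poly n x =
           (1 - x) powr (1/12)
           * csqrt (L_phase 1 x / complex_of_real (6 * pi * real n powr (4/3)))
           * exp (3/2 * complex_of_real (real n powr (2/3)) * L_phase 1 x)
           * (1 + E1 n x)
           + (-1) ^ n * (1 - x\<^sup>2) powr (1/24) * ((1 - x) / (1 + x)) powr (1/8)
           * csqrt (L_phase 2 x / complex_of_real (6 * pi * real n powr (4/3)))
           * exp (3/2 * complex_of_real (real n powr (2/3)) * L_phase 2 x)
           * (1 + E2 n x)"
proof (cases "X = {}")
  case False
  have X: "0 < norm x" "norm x < 1" "Re (L_phase 1 x) = Re (L_phase 2 x)" "Im x \<noteq> 0" "Im (x\<^sup>2) \<noteq> 0" if "x \<in> X" for x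
  proof -
    have l: "x \<in> level_set" "x \<noteq> complex_of_real x_star" using assms that by auto
    then show "0 < norm x" "norm x < 1" "Re (L_phase 1 x) = Re (L_phase 2 x)" by (auto simp: level_set_def)
    show im: "Im x \<noteq> 0"
    proof
      assume "Im x = 0"
      then have "x = complex_of_real (Re x)" by (simp add: complex_eq_iff)
      then show False using x_star_props(4)[of "Re x"] l by metis
    qed
    then show "Im (x\<^sup>2) \<noteq> 0" using level_set_not_imaginary l by blast
  qed
  have x2: "norm (x\<^sup>2) < 1" if "x \<in> X" for x using X[OF that] by (simp add: norm_power power_less_one_iff)
  have nn: "2 * Li3 x \<notin> \<real>\<^sub>\<le>\<^sub>0" "2 * Li3 (x\<^sup>2) \<notin> \<real>\<^sub>\<le>\<^sub>0" if "x \<in> X" for x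
    using X[OF that] x2[OF that] by (intro Li3_not_nonpos; simp)+
  have cont: "continuous_on X (L_phase 1)" "continuous_on X (L_phase 2)"
    using X nn by (intro continuous_on_L_phase; simp)+
  have R1: "Re (L_phase 1 x) > 0" and R2: "Re (L_phase 2 x) > 0" if "x \<in> X" for x
    using Re_L_phase_1_ge(2) L_phase_2_props(2) X that by auto
  have T1: "0 < 3 - (Im (L_phase 1 x) / Re (L_phase 1 x))\<^sup>2" and T2: "0 < 3 - (Im (L_phase 2 x) / Re (L_phase 2 x))\<^sup>2" if "x \<in> X" for x
  proof -
    have "norm (L_phase 1 x) < 2 * Re (L_phase 1 x)"
      using cube_root_props(5)[of "2 * Li3 x"] nn[OF that] X[OF that] Li3_nz[of x] by (simp add: L_phase_def)
    then show "0 < 3 - (Im (L_phase 1 x) / Re (L_phase 1 x))\<^sup>2" by (rule tau_bound)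
    have L2: "(2 * Li3 (x\<^sup>2)) powr (1/3) = 2 * L_phase 2 x" by (simp add: L_phase_def)
    have "norm (L_phase 2 x) < 2 * Re (L_phase 2 x)"
      using cube_root_props(5)[of "2 * Li3 (x\<^sup>2)", unfolded L2] nn[OF that] X[OF that] x2[OF that] Li3_nz[of "x\<^sup>2"] by (auto simp: norm_mult)
    then show "0 < 3 - (Im (L_phase 2 x) / Re (L_phase 2 x))\<^sup>2" by (rule tau_bound)
  qed
  obtain xr where xr: "xr \<in> X" "\<And>x. x \<in> X \<Longrightarrow> norm x \<le> norm xr"
    using continuous_attains_sup[OF assms(1) False, of norm] by (auto intro: continuous_intros)
  define r where "r = norm xr"
  have r: "0 \<le> r" "r < 1" "\<And>x. x \<in> X \<Longrightarrow> norm x \<le> r" using xr X by (auto simp: r_def)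
  have cRe: "continuous_on X (\<lambda>x. Re (L_phase 1 x))" by (intro continuous_intros cont)
  obtain xa where xa: "xa \<in> X" "\<And>x. x \<in> X \<Longrightarrow> Re (L_phase 1 xa) \<le> Re (L_phase 1 x)"
    using continuous_attains_inf[OF assms(1) False cRe] by auto
  obtain xb where xb: "xb \<in> X" "\<And>x. x \<in> X \<Longrightarrow> Re (L_phase 1 x) \<le> Re (L_phase 1 xb)"
    using continuous_attains_sup[OF assms(1) False cRe] by auto
  define \<alpha>0 \<alpha>1 where "\<alpha>0 = Re (L_phase 1 xa)" and "\<alpha>1 = Re (L_phase 1 xb)"
  have \<alpha>: "\<alpha>0 > 0" "\<And>x. x \<in> X \<Longrightarrow> \<alpha>0 \<le> Re (L_phase 1 x)" "\<And>x. x \<in> X \<Longrightarrow> Re (L_phase 1 x) \<le> \<alpha>1"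
    using xa xb R1 by (auto simp: \<alpha>0_def \<alpha>1_def)
  have c1: "continuous_on X (\<lambda>x. 3 - (Im (L_phase 1 x) / Re (L_phase 1 x))\<^sup>2)"
    using R1 by (intro continuous_intros cont) force
  have c2: "continuous_on X (\<lambda>x. 3 - (Im (L_phase 2 x) / Re (L_phase 2 x))\<^sup>2)"
    using R2 by (intro continuous_intros cont) force
  obtain y1 where y1: "y1 \<in> X" "\<And>x. x \<in> X \<Longrightarrow> 3 - (Im (L_phase 1 y1) / Re (L_phase 1 y1))\<^sup>2 \<le> 3 - (Im (L_phase 1 x) / Re (L_phase 1 x))\<^sup>2"
    using continuous_attains_inf[OF assms(1) False c1] by blast
  obtain y2 where y2: "y2 \<in> X" "\<And>x. x \<in> X \<Longrightarrow> 3 - (Im (L_phase 2 y2) / Re (L_phase 2 y2))\<^sup>2 \<le> 3 - (Im (L_phase 2 x) / Re (L_phase 2 x))\<^sup>2"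
    using continuous_attains_inf[OF assms(1) False c2] by blast
  define \<delta> where "\<delta> = min (3 - (Im (L_phase 1 y1) / Re (L_phase 1 y1))\<^sup>2) (3 - (Im (L_phase 2 y2) / Re (L_phase 2 y2))\<^sup>2)"
  have \<delta>: "\<delta> > 0" using T1[OF y1(1)] T2[OF y2(1)] by (simp add: \<delta>_def)
  have \<delta>1: "\<delta> \<le> 3 - (Im (L_phase 1 x) / Re (L_phase 1 x))\<^sup>2" and \<delta>2: "\<delta> \<le> 3 - (Im (L_phase 2 x) / Re (L_phase 2 x))\<^sup>2" if "x \<in> X" for x
    using y1(2)[OF that] y2(2)[OF that] by (auto simp: \<delta>_def min_def)
  obtain C1 where C1: "C1 > 0" "\<And>x w :: complex. norm x \<le> r \<Longrightarrow> Re w > 0 \<Longrightarrow> \<bar>Im w\<bar> \<le> 24 * Re w \<Longrightarrow>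
    norm (pp_log x (exp (- w)) - (Li3 x / w\<^sup>2 + Ln (1 - x) / 12)) \<le> C1 * norm w ^ 2"
    using pp_log_cone[of 24 r] r by auto
  obtain C2 where C2: "C2 > 0" "\<And>x w :: complex. norm x \<le> r \<Longrightarrow> Re w > 0 \<Longrightarrow> \<bar>Im w\<bar> \<le> 24 * Re w \<Longrightarrow>
    norm (pp_log x (- exp (- w)) - (Li3 (x\<^sup>2) / (8 * w\<^sup>2) + (Ln (1 - x\<^sup>2) / 24 + Ln ((1 - x) / (1 + x)) / 8))) \<le> C2 * norm w ^ 2"
    using pp_log_cone_minus[of 24 r] r by auto
  define E where "E = 577 * max C1 C2 * \<alpha>1 ^ 3"
  define c where "c = \<delta> / (2 * 577\<^sup>2)"
  \<comment> \<open>Full arcs \<open>{-24..24}\<close> with margin 22 around the saddle, since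
    \<open>|\<tau>| <= 2\<close>.\<close>
  define D where "D = 3 * E * (24 - (-24)) + 8 * pi / c\<^sup>2 + 14 / 22"
  have c: "c > 0" using \<delta> by (simp add: c_def)
  have E: "577 * C1 * Re (L_phase 1 x) ^ 3 \<le> E" "577 * C2 * Re (L_phase 2 x) ^ 3 \<le> E" "E \<ge> 0" if "x \<in> X" for x
  proof -
    have p: "Re (L_phase 1 x) ^ 3 \<le> \<alpha>1 ^ 3" "0 \<le> Re (L_phase 1 x) ^ 3" using \<alpha>(3)[OF that] R1[OF that] by (auto intro: power_mono)
    show "577 * C1 * Re (L_phase 1 x) ^ 3 \<le> E" unfolding E_def using C1(1) p by (intro mult_mono) auto
    show "577 * C2 * Re (L_phase 2 x) ^ 3 \<le> E" unfolding E_def X(3)[OF that, symmetric] using C2(1) p by (intro mult_mono) auto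
    have "\<alpha>1 \<ge> 0" using \<alpha>(3)[OF that] R1[OF that] by linarith
    then show "E \<ge> 0" unfolding E_def using C1(1) by (intro mult_nonneg_nonneg) auto
  qed
  have D: "D \<ge> 0" using E(3)[OF xr(1)] c unfolding D_def by (intro add_nonneg_nonneg) auto
  define k where "k = ln (1 - r) / 12"
  \<comment> \<open>The bound for the minor arcs, with \<open>\<epsilon> = 3/76\<close>; the leading
    1 is the constant \<open>B\<close>, as the remainder is divided by \<open>2 pi\<close>.\<close>
  define Z where "Z = 1 * (2 * sqrt (6 * pi / \<alpha>0) * exp (- k) / (3/76 * \<alpha>0)\<^sup>2)"
  define Cst where "Cst = D / sqrt \<alpha>0 + Z"
  have Z: "Z \<ge> 0" unfolding Z_def using \<alpha>(1) by auto
  define M1 where "M1 n x = (1 - x) powr (1/12) * csqrt (L_phase 1 x / complex_of_real (6 * pi * real n powr (4/3)))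
           * exp (3/2 * complex_of_real (real n powr (2/3)) * L_phase 1 x)" for n x
  define M2 where "M2 n x = (1 - x\<^sup>2) powr (1/24) * ((1 - x) / (1 + x)) powr (1/8)
           * csqrt (L_phase 2 x / complex_of_real (6 * pi * real n powr (4/3)))
           * exp (3/2 * complex_of_real (real n powr (2/3)) * L_phase 2 x)" for n x
  \<comment> \<open>The equation determines the two errors only jointly, so \<open>P\<close>
    describes an admissible pair and \<open>e\<close> later selects one.\<close>
  define P where "P n x e \<longleftrightarrow> norm (fst e) \<le> Cst * real n powr (-1/3) \<and> norm (snd e) \<le> Cst * real n powr (-1/3) \<and>
     pp_poly n x = M1 n x * (1 + fst e) + (-1) ^ n * M2 n x * (1 + snd e)" for n x and e :: "complex \<times> complex"
  have main: "\<exists>e. P n x e" if x: "x \<in> X" and n: "n \<ge> 1" "24 * (\<alpha>1 * real n powr (-1/3)) \<le> 1" "E \<le> \<alpha>0 * real n powr (2/3)" for n x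
  proof -
    define L1 L2 where "L1 = L_phase 1 x" and "L2 = L_phase 2 x"
    define \<sigma> \<nu> where "\<sigma> = Re L1 * real n powr (-1/3)" and "\<nu> = Re L1 * real n powr (2/3)"
    have eqR: "Re L2 = Re L1" using X(3)[OF x] by (simp add: L1_def L2_def)
    have L1p: "Re L1 > 0" and L2p: "Re L2 > 0" using R1[OF x] R2[OF x] by (auto simp: L1_def L2_def)
    note sc = scaling_relations[OF L1p n(1), folded \<sigma>_def \<nu>_def]
    have nx: "norm x < 1" "0 < norm x" using X[OF x] by auto
    have d: "24 * \<sigma> \<le> 1"
    proof -
      have "\<sigma> \<le> \<alpha>1 * real n powr (-1/3)" unfolding \<sigma>_def L1_def using \<alpha>(3)[OF x] by (intro mult_right_mono) auto
      then show ?thesis using n(2) by linarith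
    qed
    have En: "E \<le> \<nu>"
    proof -
      have "\<alpha>0 * real n powr (2/3) \<le> \<nu>" unfolding \<nu>_def L1_def using \<alpha>(2)[OF x] by (intro mult_right_mono) auto
      then show ?thesis using n(3) by linarith
    qed
    have t1: "0 < 3 - (Im L1 / Re L1)\<^sup>2" "\<delta> \<le> 3 - (Im L1 / Re L1)\<^sup>2" and t2: "0 < 3 - (Im L2 / Re L2)\<^sup>2" "\<delta> \<le> 3 - (Im L2 / Re L2)\<^sup>2"
      using T1[OF x] T2[OF x] \<delta>1[OF x] \<delta>2[OF x] by (auto simp: L1_def L2_def)
    note a1 = abs_le_of_tau[OF L1p t1(1)] and a2 = abs_le_of_tau[OF L2p t2(1)]
    have ck: "c \<le> Re (saddle_kern \<tau> t)" if "\<delta> \<le> 3 - \<tau>\<^sup>2" "t \<in> {-24..24}" for t \<tau>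
      unfolding c_def
    proof (rule Re_saddle_kern_ge)
      show "\<delta> \<le> (t + \<tau>)\<^sup>2 + 3 - \<tau>\<^sup>2" using that(1) zero_le_power2[of "t + \<tau>"] by linarith
    qed (use \<delta> that in auto)
    let ?K1 = "Ln (1 - x) / 12" and ?K2 = "Ln (1 - x\<^sup>2) / 24 + Ln ((1 - x) / (1 + x)) / 8"
    have app1: "norm (pp_log x (exp (- Complex \<sigma> (\<sigma> * t))) - (L1 ^ 3 / 2 / (of_real \<sigma> * Complex 1 t)\<^sup>2 + ?K1)) \<le> E / \<nu>" if t: "t \<in> {-24..24}" for t
    proof -
      have t': "\<bar>t\<bar> \<le> 24" using t by auto
      have EE: "577 * C1 * Re L1 ^ 3 \<le> E" using E(1)[OF x] by (simp add: L1_def)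
      note ap = arc_point[OF L1p n(1) t' less_imp_le[OF C1(1)] EE, folded \<sigma>_def \<nu>_def]
      have L3: "L1 ^ 3 / 2 = Li3 x" using Re_L_phase_1_ge(3)[OF nx(2,1)] by (simp add: L1_def)
      show ?thesis unfolding L3 ap(1)
        using C1(2)[OF r(3)[OF x] ap(2,3)] ap(4) by (rule order_trans)
    qed
    have app2: "norm (pp_log x (- exp (- Complex \<sigma> (\<sigma> * t))) - (L2 ^ 3 / 2 / (of_real \<sigma> * Complex 1 t)\<^sup>2 + ?K2)) \<le> E / \<nu>" if t: "t \<in> {-24..24}" for t
    proof -
      have t': "\<bar>t\<bar> \<le> 24" using t by auto
      have EE: "577 * C2 * Re L1 ^ 3 \<le> E" using E(2)[OF x] eqR by (simp add: L2_def)
      note ap = arc_point[OF L1p n(1) t' less_imp_le[OF C2(1)] EE, folded \<sigma>_def \<nu>_def]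
      have L3: "L2 ^ 3 / 2 / w = Li3 (x\<^sup>2) / (8 * w)" for w unfolding L2_def L_phase_2_props(3)[OF nx(2,1)] by simp
      show ?thesis unfolding L3 ap(1)
        using C2(2)[OF r(3)[OF x] ap(2,3)] ap(4) by (rule order_trans)
    qed
    have "\<exists>e1. integral {\<sigma> * -24..\<sigma> * 24} (\<lambda>\<theta>. exp (pp_log x (exp (- Complex \<sigma> \<theta>)) + of_nat n * Complex \<sigma> \<theta>)) =
       2 * of_real pi * (exp ?K1 * csqrt (L1 / of_real (6 * pi * real n powr (4/3))) * exp (3/2 * of_real (real n powr (2/3)) * L1) * (1 + e1))
       \<and> norm e1 \<le> D / sqrt \<nu>"
    proof (rule arc_contribution[OF L1p a1(1) n(1), where p = "-24" and q = 24 and s = 22 and c = c and E = E and K = ?K1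
            and G = "\<lambda>\<theta>. pp_log x (exp (- Complex \<sigma> \<theta>))", folded \<sigma>_def \<nu>_def])
      show "- 24 \<le> Im L1 / Re L1 - 22" "Im L1 / Re L1 + 22 \<le> 24" using a1(2) unfolding abs_le_iff eqR by linarith+
      show "c \<le> Re (saddle_kern (Im L1 / Re L1) t)" if "t \<in> {-24..24}" for t
        using ck[OF t1(2) that] eqR by simp
      show "continuous_on UNIV (\<lambda>\<theta>. pp_log x (exp (- Complex \<sigma> \<theta>)))" by (rule pp_log_continuous(1)[OF nx(1) sc(1)])
      show "norm (pp_log x (exp (- Complex \<sigma> (\<sigma> * t))) - (L1 ^ 3 / 2 / (of_real \<sigma> * Complex 1 t)\<^sup>2 + ?K1)) \<le> E / \<nu>"
        if "t \<in> {-24..24}" for t by (rule app1[OF that])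
    qed (use c En in \<open>auto simp: D_def\<close>)
    then obtain e1 where e1: "integral {\<sigma> * -24..\<sigma> * 24} (\<lambda>\<theta>. exp (pp_log x (exp (- Complex \<sigma> \<theta>)) + of_nat n * Complex \<sigma> \<theta>)) =
       2 * of_real pi * (exp ?K1 * csqrt (L1 / of_real (6 * pi * real n powr (4/3))) * exp (3/2 * of_real (real n powr (2/3)) * L1) * (1 + e1))"
       "norm e1 \<le> D / sqrt \<nu>" by blast
    have "\<exists>e2. integral {\<sigma> * -24..\<sigma> * 24} (\<lambda>\<theta>. exp (pp_log x (- exp (- Complex \<sigma> \<theta>)) + of_nat n * Complex \<sigma> \<theta>)) =
       2 * of_real pi * (exp ?K2 * csqrt (L2 / of_real (6 * pi * real n powr (4/3))) * exp (3/2 * of_real (real n powr (2/3)) * L2) * (1 + e2))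
       \<and> norm e2 \<le> D / sqrt \<nu>"
    proof (rule arc_contribution[OF L2p a2(1) n(1), where p = "-24" and q = 24 and s = 22 and c = c and E = E and K = ?K2
            and G = "\<lambda>\<theta>. pp_log x (- exp (- Complex \<sigma> \<theta>))", unfolded eqR, folded \<sigma>_def \<nu>_def])
      show "- 24 \<le> Im L2 / Re L1 - 22" "Im L2 / Re L1 + 22 \<le> 24" using a2(2) unfolding abs_le_iff eqR by linarith+
      show "c \<le> Re (saddle_kern (Im L2 / Re L1) t)" if "t \<in> {-24..24}" for t
        using ck[OF t2(2) that] eqR by simp
      show "continuous_on UNIV (\<lambda>\<theta>. pp_log x (- exp (- Complex \<sigma> \<theta>)))" by (rule pp_log_continuous(2)[OF nx(1) sc(1)])
      show "norm (pp_log x (- exp (- Complex \<sigma> (\<sigma> * t))) - (L2 ^ 3 / 2 / (of_real \<sigma> * Complex 1 t)\<^sup>2 + ?K2)) \<le> E / \<nu>"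
        if "t \<in> {-24..24}" for t by (rule app2[OF that])
    qed (use c En in \<open>auto simp: D_def\<close>)
    then obtain e2 where e2: "integral {\<sigma> * -24..\<sigma> * 24} (\<lambda>\<theta>. exp (pp_log x (- exp (- Complex \<sigma> \<theta>)) + of_nat n * Complex \<sigma> \<theta>)) =
       2 * of_real pi * (exp ?K2 * csqrt (L2 / of_real (6 * pi * real n powr (4/3))) * exp (3/2 * of_real (real n powr (2/3)) * L2) * (1 + e2))"
       "norm e2 \<le> D / sqrt \<nu>" by blast
    have x1: "1 - x \<noteq> 0" "1 + x \<noteq> 0" "1 - x\<^sup>2 \<noteq> 0"
      using nx x2[OF x] by (auto simp: add_eq_0_iff)
    have k1: "exp ?K1 = (1 - x) powr (1/12)" using x1 by (simp add: powr_def)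
    have k2: "exp ?K2 = (1 - x\<^sup>2) powr (1/24) * ((1 - x) / (1 + x)) powr (1/8)" using x1 by (simp add: powr_def exp_add)
    have m1: "exp ?K1 * csqrt (L1 / of_real (6 * pi * real n powr (4/3))) * exp (3/2 * of_real (real n powr (2/3)) * L1) = M1 n x"
      unfolding k1 M1_def L1_def ..
    have m2: "exp ?K2 * csqrt (L2 / of_real (6 * pi * real n powr (4/3))) * exp (3/2 * of_real (real n powr (2/3)) * L2) = M2 n x"
      unfolding k2 M2_def L2_def ..
    obtain R where R: "2 * of_real pi * pp_poly n x =
       integral {- (24 * \<sigma>)..24 * \<sigma>} (\<lambda>\<theta>. exp (pp_log x (exp (- Complex \<sigma> \<theta>)) + of_nat n * Complex \<sigma> \<theta>))
     + (-1) ^ n * integral {- (24 * \<sigma>)..24 * \<sigma>} (\<lambda>\<theta>. exp (pp_log x (- exp (- Complex \<sigma> \<theta>)) + of_nat n * Complex \<sigma> \<theta>)) + R"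
      "norm R \<le> 2 * pi * exp (35 / 384 * norm x / \<sigma>\<^sup>2 + real n * \<sigma>)"
      using circle_split[OF nx(1) sc(1) d n(1)] by blast
    have ints: "\<sigma> * -24 = - (24 * \<sigma>)" "\<sigma> * 24 = 24 * \<sigma>" by auto
    have Q: "pp_poly n x = M1 n x * (1 + e1) + (-1) ^ n * M2 n x * (1 + e2) + R / (2 * of_real pi)"
    proof -
      have "2 * of_real pi * pp_poly n x = 2 * of_real pi * (M1 n x * (1 + e1)) + (-1) ^ n * (2 * of_real pi * (M2 n x * (1 + e2))) + R"
        using R(1) e1(1)[unfolded m1 ints] e2(1)[unfolded m2 ints] by simp
      then have "pp_poly n x = (2 * of_real pi * (M1 n x * (1 + e1)) + (-1) ^ n * (2 * of_real pi * (M2 n x * (1 + e2))) + R) / (2 * of_real pi)"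
        by (simp add: field_simps)
      then show ?thesis by (simp add: add_divide_distrib)
    qed
    have "L1 \<noteq> 0" using L1p by auto
    then have M1nz: "M1 n x \<noteq> 0" unfolding m1[symmetric] using n by simp
    have rem: "norm (R / (2 * of_real pi) / M1 n x) \<le> Z * real n powr (-1/3)"
      unfolding Z_def m1[symmetric]
    proof (rule remainder_bound)
      show "norm (R / (2 * of_real pi)) \<le> 1 * exp ((3/2 - 3/76) * (Re L1 * real n powr (2/3)))"
      proof -
        have "norm (R / (2 * of_real pi)) = norm R / (2 * pi)" by (simp add: norm_divide norm_mult)
        also have "\<dots> \<le> exp (35 / 384 * norm x / \<sigma>\<^sup>2 + real n * \<sigma>)" using R(2) by (simp add: divide_le_eq mult.commute)
        also have "\<dots> \<le> exp ((3/2 - 3/76) * \<nu>)"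
          using minor_exponent[OF nx(2,1) n(1)] by (simp add: \<sigma>_def \<nu>_def L1_def)
        finally show ?thesis by (simp add: \<nu>_def)
      qed
      show "k \<le> Re ?K1"
      proof -
        have "1 - r \<le> norm (1 - x)" using norm_triangle_ineq2[of 1 x] r(3)[OF x] by simp
        then have "ln (1 - r) \<le> ln (norm (1 - x))" using r x1 by simp
        then show ?thesis using x1 by (simp add: k_def)
      qed
    qed (use \<alpha> x n in \<open>auto simp: L1_def\<close>)
    have e_le: "D / sqrt \<nu> \<le> D / sqrt \<alpha>0 * real n powr (-1/3)"
      unfolding \<nu>_def using \<alpha>(1) \<alpha>(2)[OF x] n D by (intro inverse_sqrt_scale) (auto simp: L1_def)
    \<comment> \<open>The minor arcs are charged to the first error term.\<close>
    define f1 where "f1 = e1 + R / (2 * of_real pi) / M1 n x"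
    have "norm f1 \<le> D / sqrt \<alpha>0 * real n powr (-1/3) + Z * real n powr (-1/3)"
      unfolding f1_def using e1(2) e_le rem norm_triangle_ineq[of e1 "R / (2 * of_real pi) / M1 n x"] by linarith
    then have "norm f1 \<le> Cst * real n powr (-1/3)" by (simp add: Cst_def algebra_simps)
    moreover have "norm e2 \<le> Cst * real n powr (-1/3)"
    proof -
      have "D / sqrt \<alpha>0 * real n powr (-1/3) \<le> Cst * real n powr (-1/3)" unfolding Cst_def using Z by (intro mult_right_mono) auto
      then show ?thesis using e2(2) e_le by linarith
    qed
    moreover have "pp_poly n x = M1 n x * (1 + f1) + (-1) ^ n * M2 n x * (1 + e2)"
      unfolding Q f1_def using M1nz by (simp add: algebra_simps)
    ultimately have "P n x (f1, e2)" by (simp add: P_def)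
    then show ?thesis by blast
  qed
  define e where "e n x = (SOME e. P n x e)" for n x
  have "\<forall>\<^sub>F n in sequentially. \<forall>x\<in>X. P n x (e n x)"
    using eventually_large[OF \<alpha>(1), of \<alpha>1 E]
  proof eventually_elim
    case (elim n)
    then show ?case unfolding e_def using main by (auto intro: someI_ex)
  qed
  then have "\<forall>\<^sub>F n in sequentially. \<forall>x\<in>X.
         norm (fst (e n x)) \<le> Cst * real n powr (-1/3) \<and>
         norm (snd (e n x)) \<le> Cst * real n powr (-1/3) \<and>
         pp_poly n x =
           (1 - x) powr (1/12)
           * csqrt (L_phase 1 x / complex_of_real (6 * pi * real n powr (4/3)))
           * exp (3/2 * complex_of_real (real n powr (2/3)) * L_phase 1 x)
           * (1 + fst (e n x))
           + (-1) ^ n * (1 - x\<^sup>2) powr (1/24) * ((1 - x) / (1 + x)) powr (1/8)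
           * csqrt (L_phase 2 x / complex_of_real (6 * pi * real n powr (4/3)))
           * exp (3/2 * complex_of_real (real n powr (2/3)) * L_phase 2 x)
           * (1 + snd (e n x))"
    unfolding P_def M1_def M2_def mult.assoc .
  then show ?thesis
    by (intro exI[of _ "\<lambda>n x. fst (e n x)"] exI[of _ "\<lambda>n x. snd (e n x)"] exI[of _ Cst])
qed auto

section \<open>Negative real arguments\<close>

lemma pp_log_cnj:
  fixes x :: real and u :: complex assumes "\<bar>x\<bar> < 1" "norm u < 1"
  shows "pp_log (of_real x) (cnj u) = cnj (pp_log (of_real x) u)"
proof -
  let ?t = "\<lambda>u k. complex_of_real x ^ Suc k / of_nat (Suc k) * (u ^ Suc k / (1 - u ^ Suc k)\<^sup>2)"
  have s: "?t u sums pp_log (of_real x) u" if "norm u < 1" for u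
    unfolding pp_log_def using pp_log_summable(1)[of "complex_of_real x" u] assms that
    by (intro summable_sums[OF summable_norm_cancel]) simp
  have "(\<lambda>k. cnj (?t u k)) sums cnj (pp_log (of_real x) u)" using s[OF assms(2)] by (subst sums_cnj)
  moreover have "cnj (?t u k) = ?t (cnj u) k" for k by simp
  moreover have "?t (cnj u) sums pp_log (of_real x) (cnj u)" using assms by (intro s) simp
  ultimately show ?thesis using sums_unique2 by (metis (no_types, lifting) sums_cong)
qed

text \<open>Conjugation exchanges the two halves of the arc, so the half around one saddle
  determines the real part of the whole.\<close>

lemma integral_symmetric_cnj:
  fixes f :: "real \<Rightarrow> complex"
  assumes f: "continuous_on UNIV f" "\<And>t. f (- t) = cnj (f t)" and d: "d \<ge> 0"
  shows "Re (integral {-d..d} f) = 2 * Re (integral {0..d} f)"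
proof -
  have int: "f integrable_on {a..b}" for a b
    by (intro integrable_continuous_real continuous_on_subset[OF f(1)]) auto
  have "integral {-d..d} f = integral {-d..0} f + integral {0..d} f"
    using d int by (intro Henstock_Kurzweil_Integration.integral_combine[symmetric]) auto
  also have "integral {-d..0} f = integral {0..d} (\<lambda>t. f (- t))"
    using Henstock_Kurzweil_Integration.integral_reflect_real[where a = 0 and b = d and f = "\<lambda>t. f (- t)"] by simp
  also have "\<dots> = integral {0..d} (\<lambda>t. cnj (f t))" using f(2) by simp
  also have "\<dots> = cnj (integral {0..d} f)" by (rule integral_cnj[symmetric])
  finally show ?thesis by simp
qed

text \<open>In the real case the arc at \<open>u = -1\<close> is part of the remainder, so an upper
  bound for the constant of its expansion is enough.\<close>

lemma Re_Ln_minus_const_le: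
  fixes x :: real assumes "\<bar>x\<bar> \<le> r" "r < 1"
  shows "Re (Ln (1 - (complex_of_real x)\<^sup>2) / 24 + Ln ((1 - of_real x) / (1 + of_real x)) / 8) \<le> ln 2 / 24 + ln (2 / (1 - r)) / 8"
proof -
  have x: "\<bar>x\<bar> < 1" using assms by simp
  have x2: "x\<^sup>2 < 1" using x by (simp add: abs_square_less_1)
  have 1: "1 - (complex_of_real x)\<^sup>2 = of_real (1 - x\<^sup>2)" by simp
  have 2: "(1 - complex_of_real x) / (1 + of_real x) = of_real ((1 - x) / (1 + x))" by simp
  have p: "(1 - x) / (1 + x) > 0" using x by (intro divide_pos_pos) linarith+
  have "(1 - x) / (1 + x) \<le> 2 / (1 - r)" using assms x by (intro frac_le) linarith+
  then have "ln ((1 - x) / (1 + x)) \<le> ln (2 / (1 - r))" using p assms by (subst ln_le_cancel_iff) auto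
  moreover have "ln (1 - x\<^sup>2) \<le> ln 2" using x2 zero_le_power2[of x] by (subst ln_le_cancel_iff) linarith+
  moreover have "Re (Ln (of_real (1 - x\<^sup>2))) = ln (1 - x\<^sup>2)" "Re (Ln (of_real ((1 - x) / (1 + x)))) = ln ((1 - x) / (1 + x))"
    using x2 p by (subst Ln_of_real; simp)+
  ultimately show ?thesis unfolding 1 2 by simp
qed

text \<open>Here \<open>\<tau> = sqrt 3\<close>, and positivity of the kernel fails at
  \<open>t = - sqrt 3\<close>. On the half arc \<open>t >= 0\<close> there is one saddle and
  \<open>(t + sqrt 3)^2 >= 3\<close>; twice the real part of its contribution is the cosine term.
  The error is added to the cosine and not a factor, because the cosine may vanish.\<close>

lemma pp_poly_asymp_negative_real:
  fixes X :: "real set"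
  assumes "compact X" "X \<subseteq> {x_star<..<0}"
  shows "\<exists>(E :: nat \<Rightarrow> real \<Rightarrow> real) (C :: real). \<forall>\<^sub>F n in sequentially. \<forall>x\<in>X.
         \<bar>E n x\<bar> \<le> C * real n powr (-1/3) \<and>
         pp_poly n x =
           2 powr (7/6) * root 12 (1 - x) * (1 / sqrt (6 * pi * real n powr (4/3)))
           * \<bar>Li3 x\<bar> powr (1/6)
           * exp (3/4 * root 3 2 * real n powr (2/3) * \<bar>Li3 x\<bar> powr (1/3))
           * (cos (3 * sqrt 3 / 4 * root 3 2 * real n powr (2/3) * \<bar>Li3 x\<bar> powr (1/3) + pi / 6)
              + E n x)"
proof (cases "X = {}")
  case False
  have X: "x_star < x" "x < 0" "-1 < x" "\<bar>x\<bar> < 1" "Li3 x < 0" "Li3 (x\<^sup>2) < \<bar>Li3 x\<bar>" if "x \<in> X" for x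
  proof -
    show 1: "x_star < x" "x < 0" using assms that by auto
    then show 2: "-1 < x" using x_star_props(1) by simp
    show "\<bar>x\<bar> < 1" using 1 2 by simp
    then show "Li3 x < 0" using Li3_real_signs(2)[of x] 1 by simp
    show "Li3 (x\<^sup>2) < \<bar>Li3 x\<bar>" using x_star_props(5) 1 by blast
  qed
  define \<alpha> where "\<alpha> x = (2 * \<bar>Li3 x\<bar>) powr (1/3) / 2" for x :: real
  have L1: "L_phase 1 (of_real x) = of_real (2 * \<alpha> x) * exp (\<i> * of_real (pi / 3))" "Re (L_phase 1 (of_real x)) = \<alpha> x"
      "Im (L_phase 1 (of_real x)) = \<alpha> x * sqrt 3" "\<alpha> x > 0" if "x \<in> X" for x
  proof -
    show 1: "L_phase 1 (of_real x) = of_real (2 * \<alpha> x) * exp (\<i> * of_real (pi / 3))"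
      using L_phase_real_neg(1)[of x] X[OF that] by (simp add: \<alpha>_def)
    show "Re (L_phase 1 (of_real x)) = \<alpha> x" unfolding 1 by (simp add: Re_exp cos_60)
    show "Im (L_phase 1 (of_real x)) = \<alpha> x * sqrt 3" unfolding 1 by (simp add: Im_exp sin_60)
    show "\<alpha> x > 0" using X[OF that] by (simp add: \<alpha>_def)
  qed
  have \<alpha>3: "\<alpha> x ^ 3 = \<bar>Li3 x\<bar> / 4" if "x \<in> X" for x
  proof -
    have "((2 * \<bar>Li3 x\<bar>) powr (1/3)) ^ 3 = 2 * \<bar>Li3 x\<bar>"
      using X[OF that] by (simp add: powr_power)
    then show ?thesis by (simp add: \<alpha>_def power_divide)
  qed
  have cLi: "continuous_on X Li3" using X by (intro continuous_on_subset[OF continuous_on_Li3_real]) fastforce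
  have cLi2: "continuous_on X (\<lambda>x. Li3 (x\<^sup>2))"
  proof (rule continuous_on_compose2[OF continuous_on_Li3_real])
    show "(\<lambda>x. x\<^sup>2) ` X \<subseteq> {-1<..<1}"
    proof (rule image_subsetI)
      fix x assume "x \<in> X"
      then have "x\<^sup>2 < 1" "x\<^sup>2 \<ge> 0" using X(4) by (auto simp: abs_square_less_1)
      then show "x\<^sup>2 \<in> {-1<..<1}" unfolding greaterThanLessThan_iff by linarith
    qed
  qed (intro continuous_intros)
  have c\<alpha>: "continuous_on X \<alpha>" unfolding \<alpha>_def[abs_def]
    using X(5) by (intro continuous_intros cLi) force+
  have cabs: "continuous_on X (\<lambda>x::real. \<bar>x\<bar>)" by (intro continuous_intros)
  obtain xr where xr: "xr \<in> X" "\<And>x. x \<in> X \<Longrightarrow> \<bar>x\<bar> \<le> \<bar>xr\<bar>"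
    using continuous_attains_sup[OF assms(1) False cabs] by blast
  define r where "r = \<bar>xr\<bar>"
  have r: "0 \<le> r" "r < 1" "\<And>x. x \<in> X \<Longrightarrow> \<bar>x\<bar> \<le> r" using xr X by (auto simp: r_def)
  obtain xa where xa: "xa \<in> X" "\<And>x. x \<in> X \<Longrightarrow> \<alpha> xa \<le> \<alpha> x"
    using continuous_attains_inf[OF assms(1) False c\<alpha>] by auto
  obtain xb where xb: "xb \<in> X" "\<And>x. x \<in> X \<Longrightarrow> \<alpha> x \<le> \<alpha> xb"
    using continuous_attains_sup[OF assms(1) False c\<alpha>] by auto
  define \<alpha>0 \<alpha>1 where "\<alpha>0 = \<alpha> xa" and "\<alpha>1 = \<alpha> xb"
  have \<alpha>: "\<alpha>0 > 0" "\<And>x. x \<in> X \<Longrightarrow> \<alpha>0 \<le> \<alpha> x" "\<And>x. x \<in> X \<Longrightarrow> \<alpha> x \<le> \<alpha>1"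
    using xa xb L1(4) by (auto simp: \<alpha>0_def \<alpha>1_def)
  have cq: "continuous_on X (\<lambda>x. 1 - Li3 (x\<^sup>2) / \<bar>Li3 x\<bar>)"
    using X(5) by (intro continuous_intros cLi cLi2) force
  obtain ye where ye: "ye \<in> X" "\<And>x. x \<in> X \<Longrightarrow> 1 - Li3 (ye\<^sup>2) / \<bar>Li3 ye\<bar> \<le> 1 - Li3 (x\<^sup>2) / \<bar>Li3 x\<bar>"
    using continuous_attains_inf[OF assms(1) False cq] by blast
  define \<epsilon>0 where "\<epsilon>0 = 1 - Li3 (ye\<^sup>2) / \<bar>Li3 ye\<bar>"
  have \<epsilon>0: "\<epsilon>0 > 0" "\<And>x. x \<in> X \<Longrightarrow> Li3 (x\<^sup>2) \<le> (1 - \<epsilon>0) * \<bar>Li3 x\<bar>"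
  proof -
    have p: "\<bar>Li3 x\<bar> > 0" if "x \<in> X" for x using X(5)[OF that] by linarith
    have "Li3 (ye\<^sup>2) / \<bar>Li3 ye\<bar> < 1" using X(6)[OF ye(1)] p[OF ye(1)] by (simp only: divide_less_eq_1_pos)
    then show "\<epsilon>0 > 0" unfolding \<epsilon>0_def by linarith
    fix x assume x: "x \<in> X"
    have "Li3 (x\<^sup>2) / \<bar>Li3 x\<bar> \<le> 1 - \<epsilon>0" using ye(2)[OF x] unfolding \<epsilon>0_def by linarith
    then show "Li3 (x\<^sup>2) \<le> (1 - \<epsilon>0) * \<bar>Li3 x\<bar>" using p[OF x] by (simp only: pos_divide_le_eq)
  qed
  \<comment> \<open>\<open>\<epsilon>0 / 2\<close> is the saving on the arc at
    \<open>u = -1\<close>, where the exponent is at most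
    \<open>(1 - \<epsilon>0) \<nu> / 2 + \<nu>\<close> up to a constant; 3/76 is the saving on the
    minor arcs.\<close>
  define \<epsilon> where "\<epsilon> = min (\<epsilon>0 / 2) (3 / 76)"
  have \<epsilon>: "\<epsilon> > 0" "\<epsilon> \<le> \<epsilon>0 / 2" "\<epsilon> \<le> 3 / 76" using \<epsilon>0 by (auto simp: \<epsilon>_def)
  obtain C1 where C1: "C1 > 0" "\<And>x w :: complex. norm x \<le> r \<Longrightarrow> Re w > 0 \<Longrightarrow> \<bar>Im w\<bar> \<le> 24 * Re w \<Longrightarrow>
    norm (pp_log x (exp (- w)) - (Li3 x / w\<^sup>2 + Ln (1 - x) / 12)) \<le> C1 * norm w ^ 2"
    using pp_log_cone[of 24 r] r by auto
  obtain C2 where C2: "C2 > 0" "\<And>x w :: complex. norm x \<le> r \<Longrightarrow> Re w > 0 \<Longrightarrow> \<bar>Im w\<bar> \<le> 24 * Re w \<Longrightarrow>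
    norm (pp_log x (- exp (- w)) - (Li3 (x\<^sup>2) / (8 * w\<^sup>2) + (Ln (1 - x\<^sup>2) / 24 + Ln ((1 - x) / (1 + x)) / 8))) \<le> C2 * norm w ^ 2"
    using pp_log_cone_minus[of 24 r] r by auto
  define E where "E = 577 * max C1 C2 * \<alpha>1 ^ 3"
  \<comment> \<open>On the half arc \<open>(t + sqrt 3)^2 + 3 - 3 >= 3\<close>, so 3 takes the place
    of a compactness constant. The next constant uses the interval \<open>{0..24}\<close> and the
    margin 1, which fits because \<open>sqrt 3 >= 1\<close>.\<close>
  define c :: real where "c = 3 / (2 * 577\<^sup>2)"
  define D where "D = 3 * E * (24 - 0) + 8 * pi / c\<^sup>2 + 14 / 1"
  have c: "c > 0" by (simp add: c_def)
  have E: "577 * C1 * \<alpha> x ^ 3 \<le> E" "577 * C2 * \<alpha> x ^ 3 \<le> E" "E \<ge> 0" if "x \<in> X" for x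
  proof -
    have p: "\<alpha> x ^ 3 \<le> \<alpha>1 ^ 3" "0 \<le> \<alpha> x ^ 3" using \<alpha>(3)[OF that] L1(4)[OF that] by (auto intro: power_mono)
    show "577 * C1 * \<alpha> x ^ 3 \<le> E" unfolding E_def using C1(1) p by (intro mult_mono) auto
    show "577 * C2 * \<alpha> x ^ 3 \<le> E" unfolding E_def using C2(1) p by (intro mult_mono) auto
    have "\<alpha>1 \<ge> 0" using \<alpha>(3)[OF that] L1(4)[OF that] by linarith
    then show "E \<ge> 0" unfolding E_def using C1(1) by (intro mult_nonneg_nonneg) auto
  qed
  have D: "D \<ge> 0" using E(3)[OF xr(1)] c unfolding D_def by (intro add_nonneg_nonneg) auto
  define k where "k = ln (1 - r) / 12"
  \<comment> \<open>The final 1 bounds the error of the expansion,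
    \<open>C2 |w|^2 <= E / \<nu> <= 1\<close>.\<close>
  define k2 where "k2 = ln 2 / 24 + ln (2 / (1 - r)) / 8 + 1"
  \<comment> \<open>\<open>2 * exp k2\<close> covers the arc at \<open>u = -1\<close>, of length
    \<open>48 \<sigma> <= 2\<close>, and \<open>2 * pi\<close> the minor arcs.\<close>
  define B where "B = 2 * exp k2 + 2 * pi"
  define Z where "Z = B * (2 * sqrt (6 * pi / \<alpha>0) * exp (- k) / (\<epsilon> * \<alpha>0)\<^sup>2)"
  define Cst where "Cst = D / sqrt \<alpha>0 + Z"
  have B: "B \<ge> 0" by (simp add: B_def)
  define P where "P n x = 2 powr (7/6) * root 12 (1 - x) * (1 / sqrt (6 * pi * real n powr (4/3)))
           * \<bar>Li3 x\<bar> powr (1/6) * exp (3/4 * root 3 2 * real n powr (2/3) * \<bar>Li3 x\<bar> powr (1/3))" for n x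
  define ph where "ph n x = 3 * sqrt 3 / 4 * root 3 2 * real n powr (2/3) * \<bar>Li3 x\<bar> powr (1/3) + pi / 6" for n x
  \<comment> \<open>As \<open>P n x\<close> is positive, the error can be defined outright as what
    division by it leaves beside the cosine.\<close>
  define Er where "Er n x = pp_poly n x / P n x - cos (ph n x)" for n x
  have main: "\<bar>Er n x\<bar> \<le> Cst * real n powr (-1/3) \<and> pp_poly n x = P n x * (cos (ph n x) + Er n x)"
    if x: "x \<in> X" and n: "n \<ge> 1" "24 * (\<alpha>1 * real n powr (-1/3)) \<le> 1" "max E 1 \<le> \<alpha>0 * real n powr (2/3)" for n x
  proof -
    define z where "z = complex_of_real x"
    define L where "L = L_phase 1 z"
    have LRe: "Re L = \<alpha> x" and LIm: "Im L = \<alpha> x * sqrt 3" using L1[OF x] by (auto simp: L_def z_def)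
    have ReL: "Re L > 0" and Ltau: "Im L / Re L = sqrt 3" using L1(4)[OF x] by (auto simp: LRe LIm)
    have s3: "sqrt 3 \<le> 2" "1 \<le> sqrt 3" by (auto simp: real_le_lsqrt)
    have ImL: "\<bar>Im L\<bar> \<le> 2 * Re L" using s3 L1(4)[OF x] unfolding LRe LIm by (simp add: abs_mult mult.commute)
    define \<sigma> \<nu> where "\<sigma> = Re L * real n powr (-1/3)" and "\<nu> = Re L * real n powr (2/3)"
    note sc = scaling_relations[OF ReL n(1), folded \<sigma>_def \<nu>_def]
    have nz: "norm z < 1" "0 < norm z" "norm z \<le> r" using X[OF x] r(3)[OF x] by (auto simp: z_def)
    have d: "24 * \<sigma> \<le> 1"
    proof -
      have "\<sigma> \<le> \<alpha>1 * real n powr (-1/3)" unfolding \<sigma>_def LRe using \<alpha>(3)[OF x] by (intro mult_right_mono) auto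
      then show ?thesis using n(2) by linarith
    qed
    have En: "E \<le> \<nu>"
    proof -
      have "\<alpha>0 * real n powr (2/3) \<le> \<nu>" unfolding \<nu>_def LRe using \<alpha>(2)[OF x] by (intro mult_right_mono) auto
      then show ?thesis using n(3) by linarith
    qed
    let ?K1 = "Ln (1 - z) / 12" and ?K2 = "Ln (1 - z\<^sup>2) / 24 + Ln ((1 - z) / (1 + z)) / 8"
    let ?f = "\<lambda>\<theta>. exp (pp_log z (exp (- Complex \<sigma> \<theta>)) + of_nat n * Complex \<sigma> \<theta>)"
    let ?g = "\<lambda>\<theta>. exp (pp_log z (- exp (- Complex \<sigma> \<theta>)) + of_nat n * Complex \<sigma> \<theta>)"
    have EE: "577 * C1 * Re L ^ 3 \<le> E" "577 * C2 * Re L ^ 3 \<le> E" using E[OF x] by (auto simp: LRe)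
    have "\<exists>e. integral {\<sigma> * 0..\<sigma> * 24} ?f =
       2 * of_real pi * (exp ?K1 * csqrt (L / of_real (6 * pi * real n powr (4/3))) * exp (3/2 * of_real (real n powr (2/3)) * L) * (1 + e))
       \<and> norm e \<le> D / sqrt \<nu>"
    proof (rule arc_contribution[OF ReL ImL n(1), where p = 0 and q = 24 and s = 1 and c = c and E = E and K = ?K1
            and G = "\<lambda>\<theta>. pp_log z (exp (- Complex \<sigma> \<theta>))", folded \<sigma>_def \<nu>_def])
      show "0 \<le> Im L / Re L - 1" "Im L / Re L + 1 \<le> 24" unfolding Ltau using s3 by linarith+
      show "c \<le> Re (saddle_kern (Im L / Re L) t)" if t: "t \<in> {0..24}" for t
        unfolding Ltau c_def
      proof (rule Re_saddle_kern_ge)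
        have "(sqrt 3)\<^sup>2 \<le> (t + sqrt 3)\<^sup>2" using t by (intro power_mono) auto
        then show "3 \<le> (t + sqrt 3)\<^sup>2 + 3 - (sqrt 3)\<^sup>2" by simp
      qed (use t in auto)
      show "continuous_on UNIV (\<lambda>\<theta>. pp_log z (exp (- Complex \<sigma> \<theta>)))" by (rule pp_log_continuous(1)[OF nz(1) sc(1)])
      show "norm (pp_log z (exp (- Complex \<sigma> (\<sigma> * t))) - (L ^ 3 / 2 / (of_real \<sigma> * Complex 1 t)\<^sup>2 + ?K1)) \<le> E / \<nu>"
        if t: "t \<in> {0..24}" for t
      proof -
        have t': "\<bar>t\<bar> \<le> 24" using t by auto
        note ap = arc_point[OF ReL n(1) t' less_imp_le[OF C1(1)] EE(1), folded \<sigma>_def \<nu>_def]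
        have L3: "L ^ 3 / 2 = Li3 z" using Re_L_phase_1_ge(3)[OF nz(2,1)] by (simp add: L_def)
        show ?thesis unfolding L3 ap(1)
          using C1(2)[OF nz(3) ap(2,3)] ap(4) by (rule order_trans)
      qed
    qed (use c En in \<open>auto simp: D_def\<close>)
    then obtain e where e: "integral {\<sigma> * 0..\<sigma> * 24} ?f =
       2 * of_real pi * (exp ?K1 * csqrt (L / of_real (6 * pi * real n powr (4/3))) * exp (3/2 * of_real (real n powr (2/3)) * L) * (1 + e))"
      "norm e \<le> D / sqrt \<nu>" by blast
    define M where "M = exp ?K1 * csqrt (L / of_real (6 * pi * real n powr (4/3))) * exp (3/2 * of_real (real n powr (2/3)) * L)"
    have cont: "continuous_on S ?f" "continuous_on S ?g" for S
      by (intro continuous_intros pp_log_continuous nz sc)+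
    have sym: "?f (- \<theta>) = cnj (?f \<theta>)" for \<theta>
    proof -
      have C: "Complex \<sigma> (- \<theta>) = cnj (Complex \<sigma> \<theta>)" by (simp add: complex_eq_iff)
      have "exp (- Complex \<sigma> (- \<theta>)) = cnj (exp (- Complex \<sigma> \<theta>))" unfolding C by (simp add: exp_cnj)
      moreover have "pp_log z (cnj (exp (- Complex \<sigma> \<theta>))) = cnj (pp_log z (exp (- Complex \<sigma> \<theta>)))"
        unfolding z_def using X[OF x] sc by (intro pp_log_cnj) auto
      ultimately show ?thesis unfolding C by (simp add: exp_cnj)
    qed
    have arc1: "Re (integral {- (24 * \<sigma>)..24 * \<sigma>} ?f) = 2 * Re (2 * of_real pi * (M * (1 + e)))"
      using integral_symmetric_cnj[OF cont(1) sym, of "24 * \<sigma>"] sc e(1) by (simp add: M_def mult.commute)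
    have arc2: "norm (integral {- (24 * \<sigma>)..24 * \<sigma>} ?g) \<le> 2 * exp k2 * exp ((3/2 - \<epsilon>) * \<nu>)"
    proof -
      have b: "norm (?g \<theta>) \<le> exp k2 * exp ((3/2 - \<epsilon>) * \<nu>)" if \<theta>: "\<theta> \<in> {- (24 * \<sigma>)..24 * \<sigma>}" for \<theta>
      proof -
        define w where "w = Complex \<sigma> \<theta>"
        have w: "Re w > 0" "\<bar>Im w\<bar> \<le> 24 * Re w" "Re w = \<sigma>" using sc \<theta> by (auto simp: w_def)
        define t where "t = \<theta> / \<sigma>"
        have t: "\<bar>t\<bar> \<le> 24" "\<theta> = \<sigma> * t" using \<theta> sc by (auto simp: t_def abs_divide divide_le_eq abs_le_iff)
        have Cw: "C2 * norm w ^ 2 \<le> 1"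
        proof -
          have "C2 * norm w ^ 2 \<le> E / \<nu>"
            using arc_point(4)[OF ReL n(1) t(1) less_imp_le[OF C2(1)] EE(2), folded \<sigma>_def \<nu>_def] by (simp add: w_def t(2))
          also have "\<dots> \<le> 1" using En sc by simp
          finally show ?thesis .
        qed
        \<comment> \<open>The trivial bound \<open>|w| >= \<sigma>\<close> suffices on this arc:
          \<open>|Li3 x| = 4 \<sigma>^2 \<nu>\<close>, and the gap \<open>\<epsilon>0\<close>
          between \<open>Li3 (x^2)\<close> and \<open>|Li3 x|\<close> keeps the term below
          \<open>\<nu> / 2\<close>.\<close>
        have "norm (Li3 (z\<^sup>2) / (8 * w\<^sup>2)) \<le> (1 - \<epsilon>0) * \<nu> / 2"
        proof -
          have x2: "x\<^sup>2 < 1" "x\<^sup>2 > 0" using X[OF x] by (auto simp: abs_square_less_1)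
          have "Li3 (z\<^sup>2) = of_real (Li3 (x\<^sup>2))" unfolding z_def of_real_power[symmetric] using x2 by (intro Li3_of_real) auto
          moreover have "Li3 (x\<^sup>2) > 0" using x2 Li3_real_signs(3)[of "x\<^sup>2"] by simp
          ultimately have "norm (Li3 (z\<^sup>2) / (8 * w\<^sup>2)) = Li3 (x\<^sup>2) / (8 * norm w ^ 2)" by (simp add: norm_divide norm_mult norm_power)
          also have "\<dots> \<le> Li3 (x\<^sup>2) / (8 * \<sigma>\<^sup>2)"
          proof (intro divide_left_mono mult_left_mono power_mono mult_pos_pos zero_less_power)
            show "\<sigma> \<le> norm w" using complex_Re_le_cmod[of w] w by simp
          qed (use sc w \<open>Li3 (x\<^sup>2) > 0\<close> in auto)
          also have "\<dots> \<le> ((1 - \<epsilon>0) * \<bar>Li3 x\<bar>) / (8 * \<sigma>\<^sup>2)" using \<epsilon>0(2)[OF x] by (intro divide_right_mono) auto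
          also have "\<bar>Li3 x\<bar> = 4 * (\<sigma>\<^sup>2 * \<nu>)" unfolding sc(3) LRe using \<alpha>3[OF x] by simp
          also have "((1 - \<epsilon>0) * (4 * (\<sigma>\<^sup>2 * \<nu>))) / (8 * \<sigma>\<^sup>2) = (1 - \<epsilon>0) * \<nu> / 2" using sc(1) by simp
          finally show ?thesis .
        qed
        then have "Re (Li3 (z\<^sup>2) / (8 * w\<^sup>2)) \<le> (1 - \<epsilon>0) * \<nu> / 2" using complex_Re_le_cmod order_trans by blast
        moreover have "Re ?K2 \<le> k2 - 1" using Re_Ln_minus_const_le[OF r(3)[OF x] r(2)] by (simp add: z_def k2_def)
        moreover have "Re (pp_log z (- exp (- w)) - (Li3 (z\<^sup>2) / (8 * w\<^sup>2) + ?K2)) \<le> 1"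
          using C2(2)[OF nz(3) w(1,2)] Cw complex_Re_le_cmod[of "pp_log z (- exp (- w)) - (Li3 (z\<^sup>2) / (8 * w\<^sup>2) + ?K2)"] by linarith
        ultimately have "Re (pp_log z (- exp (- w))) \<le> (1 - \<epsilon>0) * \<nu> / 2 + k2" by simp
        moreover have "\<epsilon> * \<nu> \<le> \<epsilon>0 / 2 * \<nu>" using \<epsilon>(2) sc by (intro mult_right_mono) auto
        ultimately have "Re (pp_log z (- exp (- w))) + \<nu> \<le> k2 + (3/2 - \<epsilon>) * \<nu>"
          by (simp only: left_diff_distrib diff_divide_distrib)
        then show ?thesis using sc(4) by (simp add: w_def norm_exp_eq_Re exp_add[symmetric])
      qed
      have "norm (integral {- (24 * \<sigma>)..24 * \<sigma>} ?g) \<le> exp k2 * exp ((3/2 - \<epsilon>) * \<nu>) * (24 * \<sigma> - - (24 * \<sigma>))"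
        using sc by (intro integral_bound cont b) auto
      also have "\<dots> \<le> exp k2 * exp ((3/2 - \<epsilon>) * \<nu>) * 2" using d by (intro mult_left_mono) auto
      finally show ?thesis by simp
    qed
    obtain R where R: "2 * of_real pi * pp_poly n z =
       integral {- (24 * \<sigma>)..24 * \<sigma>} ?f + (-1) ^ n * integral {- (24 * \<sigma>)..24 * \<sigma>} ?g + R"
      "norm R \<le> 2 * pi * exp (35 / 384 * norm z / \<sigma>\<^sup>2 + real n * \<sigma>)"
      using circle_split[OF nz(1) sc(1) d n(1)] by blast
    define R' where "R' = (-1) ^ n * integral {- (24 * \<sigma>)..24 * \<sigma>} ?g + R"
    have R': "norm R' \<le> B * exp ((3/2 - \<epsilon>) * \<nu>)"
    proof -
      have "35 / 384 * norm z / \<sigma>\<^sup>2 + real n * \<sigma> \<le> (3/2 - 3/76) * \<nu>"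
        using minor_exponent[OF nz(2,1) n(1)] unfolding \<sigma>_def \<nu>_def L_def .
      also have "\<dots> \<le> (3/2 - \<epsilon>) * \<nu>" using \<epsilon> sc by (intro mult_right_mono) auto
      finally have "norm R \<le> 2 * pi * exp ((3/2 - \<epsilon>) * \<nu>)" using R(2) by (smt (verit) exp_le_cancel_iff mult_left_mono pi_gt_zero)
      moreover have "norm ((-1) ^ n * integral {- (24 * \<sigma>)..24 * \<sigma>} ?g) \<le> 2 * exp k2 * exp ((3/2 - \<epsilon>) * \<nu>)"
        using arc2 by (simp add: norm_mult norm_power)
      ultimately show ?thesis unfolding R'_def B_def distrib_right by (intro norm_triangle_le add_mono)
    qed
    have Qz: "pp_poly n z = of_real (pp_poly n x)" by (simp add: pp_poly_def z_def)
    have "2 * pi * pp_poly n x = Re (2 * of_real pi * pp_poly n z)" unfolding Qz by simp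
    also have "\<dots> = 2 * Re (2 * of_real pi * (M * (1 + e))) + Re R'" unfolding R(1) R'_def using arc1 by simp
    also have "\<dots> = 2 * pi * (2 * Re M + 2 * Re (M * e)) + Re R'" by (simp add: algebra_simps)
    finally have Q2: "2 * pi * pp_poly n x = 2 * pi * (2 * Re M + 2 * Re (M * e)) + Re R'" .
    have Q: "pp_poly n x = 2 * Re M + 2 * Re (M * e) + Re R' / (2 * pi)"
    proof -
      have "pp_poly n x = (2 * pi * pp_poly n x) / (2 * pi)" by simp
      then show ?thesis unfolding Q2 add_divide_distrib by simp
    qed
    \<comment> \<open>The square root halves the argument \<open>pi/3\<close> of \<open>L\<close>,
      hence the shift \<open>pi/6\<close> in the cosine. The constant \<open>2 powr (7/6)\<close> is
      2, for the two saddles, times the \<open>2 powr (1/6)\<close> in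
      \<open>(2 * l) powr (1/6)\<close>.\<close>
    have m: "M = of_real (P n x / 2) * exp (\<i> * of_real (ph n x))" and P0: "P n x > 0"
    proof -
      define l where "l = \<bar>Li3 x\<bar>"
      have l: "l > 0" using X(5)[OF x] by (simp add: l_def)
      have a2: "2 * \<alpha> x = (2 * l) powr (1/3)" by (simp add: \<alpha>_def l_def)
      have n0: "real n > 0" using n by simp
      have k1: "exp ?K1 = of_real (root 12 (1 - x))"
      proof -
        have "Ln (of_real (1 - x)) = of_real (ln (1 - x))" using X[OF x] by (intro Ln_of_real) auto
        then have "Ln (1 - z) = of_real (ln (1 - x))" by (simp add: z_def)
        then have "exp ?K1 = of_real (exp (ln (1 - x) / 12))" by (simp flip: exp_of_real)
        also have "exp (ln (1 - x) / 12) = root 12 (1 - x)" using X[OF x] by (simp add: root_powr_inverse powr_def)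
        finally show ?thesis .
      qed
      have Lc: "L = of_real (2 * \<alpha> x) * exp (\<i> * of_real (pi / 3))" using L1(1)[OF x] by (simp add: L_def z_def)
      have cs: "csqrt (L / of_real (6 * pi * real n powr (4/3))) =
          of_real ((2 * l) powr (1/6) / sqrt (6 * pi * real n powr (4/3))) * exp (\<i> * of_real (pi / 6))" (is "_ = ?w")
      proof (rule csqrt_unique)
        have "((2 * l) powr (1/6))\<^sup>2 = (2 * l) powr (1/3)" using l by (simp add: powr_power)
        then have "?w\<^sup>2 = of_real ((2 * l) powr (1/3) / (6 * pi * real n powr (4/3))) * (exp (\<i> * of_real (pi / 6)))\<^sup>2"
          unfolding power_mult_distrib of_real_power[symmetric] power_divide using n0 by simp
        also have "(exp (\<i> * of_real (pi / 6)))\<^sup>2 = exp (\<i> * of_real (pi / 3))"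
          by (simp add: exp_double[symmetric])
        also have "of_real ((2 * l) powr (1/3) / (6 * pi * real n powr (4/3))) * exp (\<i> * of_real (pi / 3)) = L / of_real (6 * pi * real n powr (4/3))"
          unfolding Lc a2 of_real_divide by simp
        finally show "?w\<^sup>2 = L / of_real (6 * pi * real n powr (4/3))" .
        have "Re ?w = (2 * l) powr (1/6) / sqrt (6 * pi * real n powr (4/3)) * cos (pi / 6)" by (simp add: Re_exp)
        also have "\<dots> > 0" using l n0 by (intro mult_pos_pos divide_pos_pos) (auto simp: cos_30)
        finally show "0 < Re ?w \<or> Re ?w = 0 \<and> 0 \<le> Im ?w" by simp
      qed
      have r3: "root 3 2 * l powr (1/3) = (2 * l) powr (1/3)"
        using l by (simp add: root_powr_inverse powr_mult)
      have r7: "2 powr (7/6) * l powr (1/6) = 2 * (2 * l) powr (1/6)"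
      proof -
        have "2 powr (7/6) = 2 * 2 powr (1/6 :: real)" using powr_add[of 2 1 "1/6 :: real"] by simp
        then show ?thesis using l by (simp add: powr_mult)
      qed
      have ex: "exp (3/2 * of_real (real n powr (2/3)) * L) =
          of_real (exp (3/4 * root 3 2 * real n powr (2/3) * l powr (1/3))) * exp (\<i> * of_real (3 * sqrt 3 / 4 * root 3 2 * real n powr (2/3) * l powr (1/3)))"
      proof -
        have a': "\<alpha> x = root 3 2 * l powr (1/3) / 2" using a2 r3 by simp
        have "L = of_real (\<alpha> x) + \<i> * of_real (\<alpha> x * sqrt 3)" using LRe LIm by (simp add: complex_eq_iff)
        then have "3/2 * of_real (real n powr (2/3)) * L = of_real (3/4 * root 3 2 * real n powr (2/3) * l powr (1/3)) +
           \<i> * of_real (3 * sqrt 3 / 4 * root 3 2 * real n powr (2/3) * l powr (1/3))"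
          unfolding a' by (simp add: algebra_simps)
        then show ?thesis by (simp only: exp_add exp_of_real)
      qed
      have Pl: "P n x / 2 = root 12 (1 - x) * ((2 * l) powr (1/6) / sqrt (6 * pi * real n powr (4/3))) * exp (3/4 * root 3 2 * real n powr (2/3) * l powr (1/3))"
      proof -
        have "P n x = root 12 (1 - x) * ((2 powr (7/6) * l powr (1/6)) / sqrt (6 * pi * real n powr (4/3))) * exp (3/4 * root 3 2 * real n powr (2/3) * l powr (1/3))"
          unfolding P_def l_def[symmetric] by (simp add: mult_ac)
        then show ?thesis unfolding r7 by simp
      qed
      show "M = of_real (P n x / 2) * exp (\<i> * of_real (ph n x))"
        unfolding M_def k1 cs ex Pl ph_def l_def[symmetric] of_real_add distrib_left exp_add by (simp add: mult_ac)
      have "P n x / 2 > 0" unfolding Pl using l n0 X[OF x] by simp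
      then show "P n x > 0" by simp
    qed
    have ReM: "2 * Re M = P n x * cos (ph n x)" unfolding m by (simp add: Re_exp)
    have nM: "norm M = P n x / 2" unfolding m using P0 by (simp add: norm_mult)
    have Er: "Er n x = 2 * Re (M * e) / P n x + Re R' / (2 * pi) / P n x"
      unfolding Er_def Q ReM using P0 by (simp add: add_divide_distrib)
    have e_le: "D / sqrt \<nu> \<le> D / sqrt \<alpha>0 * real n powr (-1/3)"
      unfolding \<nu>_def using \<alpha>(1) \<alpha>(2)[OF x] n D by (intro inverse_sqrt_scale) (auto simp: LRe)
    have "\<bar>2 * Re (M * e) / P n x\<bar> \<le> norm e"
    proof -
      have "\<bar>Re (M * e)\<bar> \<le> P n x / 2 * norm e" using abs_Re_le_cmod[of "M * e"] by (simp add: norm_mult nM)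
      then have "\<bar>2 * Re (M * e)\<bar> \<le> norm e * P n x" by (simp add: abs_mult mult.commute del: times_complex.sel)
      then show ?thesis using P0 by (simp add: abs_divide divide_le_eq del: times_complex.sel)
    qed
    moreover have "\<bar>Re R' / (2 * pi) / P n x\<bar> \<le> Z * real n powr (-1/3)"
    proof -
      have "\<bar>Re R' / (2 * pi) / P n x\<bar> = \<bar>Re R'\<bar> / (2 * pi * P n x)" using P0 by (simp add: abs_divide abs_mult)
      also have "\<dots> \<le> norm R' / norm M"
      proof (rule frac_le)
        have "P n x / 2 * 1 \<le> P n x * (2 * pi)" using P0 pi_gt3 by (simp add: field_simps)
        then show "norm M \<le> 2 * pi * P n x" unfolding nM by (simp add: mult_ac)
      qed (use abs_Re_le_cmod P0 nM in auto)
      also have "\<dots> = norm (R' / M)" by (simp add: norm_divide)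
      also have "\<dots> \<le> Z * real n powr (-1/3)"
        unfolding Z_def M_def
      proof (rule remainder_bound)
        show "k \<le> Re ?K1"
        proof -
          have x1: "1 - z \<noteq> 0" using nz by auto
          have "1 - r \<le> norm (1 - z)" using norm_triangle_ineq2[of 1 z] nz by simp
          then have "ln (1 - r) \<le> ln (norm (1 - z))" using r x1 by simp
          then show ?thesis using x1 by (simp add: k_def)
        qed
        show "norm R' \<le> B * exp ((3/2 - \<epsilon>) * (Re L * real n powr (2/3)))" using R' by (simp add: \<nu>_def)
      qed (use \<alpha> x n \<epsilon> B in \<open>auto simp: LRe\<close>)
      finally show ?thesis .
    qed
    ultimately have "\<bar>Er n x\<bar> \<le> D / sqrt \<alpha>0 * real n powr (-1/3) + Z * real n powr (-1/3)"
      unfolding Er using e(2) e_le by linarith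
    then show ?thesis using P0 by (simp add: Cst_def algebra_simps Er_def)
  qed
  have "\<forall>\<^sub>F n in sequentially. \<forall>x\<in>X. \<bar>Er n x\<bar> \<le> Cst * real n powr (-1/3) \<and> pp_poly n x = P n x * (cos (ph n x) + Er n x)"
    using eventually_large[OF \<alpha>(1), of \<alpha>1 "max E 1"]
    by eventually_elim (use main in blast)
  then show ?thesis unfolding P_def ph_def by (intro exI[of _ Er] exI[of _ Cst])
qed auto

theorem theorem3:
  "(\<forall>X::real set. compact X \<and> X \<subseteq> {x_star<..<0} \<longrightarrow>
      (\<exists>(E :: nat \<Rightarrow> real \<Rightarrow> real) (C :: real). \<forall>\<^sub>F n in sequentially. \<forall>x\<in>X.
         \<bar>E n x\<bar> \<le> C * real n powr (-1/3) \<and>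
         pp_poly n x =
           2 powr (7/6) * root 12 (1 - x) * (1 / sqrt (6 * pi * real n powr (4/3)))
           * \<bar>Li3 x\<bar> powr (1/6)
           * exp (3/4 * root 3 2 * real n powr (2/3) * \<bar>Li3 x\<bar> powr (1/3))
           * (cos (3 * sqrt 3 / 4 * root 3 2 * real n powr (2/3) * \<bar>Li3 x\<bar> powr (1/3) + pi / 6)
              + E n x)))
   \<and>
   (\<forall>X::complex set. compact X \<and> X \<subseteq> level_set - {complex_of_real x_star} \<longrightarrow>
      (\<exists>(E1 :: nat \<Rightarrow> complex \<Rightarrow> complex) (E2 :: nat \<Rightarrow> complex \<Rightarrow> complex) (C :: real).
         \<forall>\<^sub>F n in sequentially. \<forall>x\<in>X.
         norm (E1 n x) \<le> C * real n powr (-1/3) \<and>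
         norm (E2 n x) \<le> C * real n powr (-1/3) \<and>
         pp_poly n x =
           (1 - x) powr (1/12)
           * csqrt (L_phase 1 x / complex_of_real (6 * pi * real n powr (4/3)))
           * exp (3/2 * complex_of_real (real n powr (2/3)) * L_phase 1 x)
           * (1 + E1 n x)
           + (-1) ^ n * (1 - x\<^sup>2) powr (1/24) * ((1 - x) / (1 + x)) powr (1/8)
           * csqrt (L_phase 2 x / complex_of_real (6 * pi * real n powr (4/3)))
           * exp (3/2 * complex_of_real (real n powr (2/3)) * L_phase 2 x)
           * (1 + E2 n x)))"
  using pp_poly_asymp_negative_real pp_poly_asymp_level_set by blast

end
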